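(* Let $\Theta=(\Gamma,(x_{k,i}))$ be a patch framework in $\mathbb{R}^d$ with $m$ views, with $\Gamma$ connected and with every view affinely non-degenerate. Suppose $S^*\in\mathbb{O}(d)^m$ is a perfect alignment. Then the Riemannian gradient descent algorithm (with parameters $\beta,\gamma\in(0,1)$) converges locally linearly to $\widetilde S^*=\pi(S^* )$ if any of the following holds: (1) $\mathrm{rank}(C)=(m-1)d$. (2) $\mathrm{rank}(\mathbb{L}(S^* ))=(m-1)d(d-1)/2$. Moreover, condition (1), which characterizes affine rigidity (it holds iff $\Theta(S^* )$ is affinely rigid), implies condition (2), which characterizes infinitesimal rigidity (it holds iff $\Theta(S^* )$ is infinitesimally rigid) as well as generic local rigidity (if $\Theta(S^* )$ is generic, it holds iff $\Theta(S^* )$ is locally rigid).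
   Context: Notation. $[A_i]_1^m$ is the vertical stack of $A_1,\dots,A_m$; $[A]_i$ is the $i$th $d$-row block of $A$; $M_{ij}$ is the $(i,j)$ block of size $d\times d$ of an $md\times md$ matrix $M$; $A^\dagger$ is the Moore–Penrose pseudoinverse. Patch framework. $\Gamma$ is a bipartite graph on $n+m$ vertices; vertex $k\in\{1,\dots,n\}$ represents the $k$th point and vertex $n+i$, $i\in\{1,\dots,m\}$, the $i$th view; $(k,i)\in E(\Gamma)$ means that point $k$ is in view $i$, with local coordinates $x_{k,i}\in\mathbb{R}^d$. The tuple $\Theta=(\Gamma,(x_{k,i}))$ is a patch framework. A view $i$ is affinely non-degenerate if it has at least $d+1$ points and the affine span of $\{x_{k,i}:(k,i)\in E(\Gamma)\}$ has dimension $d$. Put $e_{ki}=e_k-e_{n+i}\in\mathbb{R}^{n+m}$, $\varepsilon_i$ the $i$th standard basis vector of $\mathbb{R}^m$, $\mathcal{L}_\Gamma=\sum_{(k,i)\in E(\Gamma)}e_{ki}e_{ki}^T$, $B=\sum_{(k,i)\in E(\Gamma)}(\varepsilon_i\otimes I_d)x_{k,i}e_{ki}^T$, $D=\sum_{(k,i)\in E(\Gamma)}(\varepsilon_i\otimes I_d)x_{k,i}x_{k,i}^T(\varepsilon_i\otimes I_d)^T$, $C=D-B\mathcal{L}_\Gamma^\dagger B^T\in\mathbb{R}^{md\times md}$ (positive semi-definite). An alignment is $S=[S_i]_1^m\in\mathbb{O}(d)^m\subseteq\mathbb{R}^{md\times d}$; $F(S)=\mathrm{Tr}(CSS^T)$;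 $S$ is perfect if $F(S)=0$. Let $\pi:\mathbb{O}(d)^m\to\mathbb{O}(d)^{m-1}$, $\pi(S)=[S_{i+1}S_1^T]_{i=1}^{m-1}$, which identifies $\mathbb{O}(d)^m/_\sim$ ($S\sim SQ$ for $Q\in\mathbb{O}(d)$) with $\mathbb{O}(d)^{m-1}$. Matrices. $C(S)=\mathrm{blockdiag}(S_1,\dots,S_m)^TC\,\mathrm{blockdiag}(S_1,\dots,S_m)$; $\widehat C(S)$ is block-diagonal with $i$th diagonal block $\sum_jC(S)_{ij}$; $L(S)=C(S)-\widehat C(S)$. $P$ is the $md\times md$ permutation matrix such that row $(p-1)m+i$ of $PX$ is row $(i-1)d+p$ of $X$; $\mathcal{L}(S)=PL(S)P^T$. $\overline P$ is the block matrix with $m\times m$ blocks, block-rows indexed by $(r,s)$, $1\le r<s\le d$, block-columns by $(p,q)\in\{1,\dots,d\}^2$ (both in column-major order), with $((r,s),(p,q))$ block equal to $0$ if $p=q$, $\delta_{pr}\delta_{qs}I_m$ if $p<q$, $-\delta_{ps}\delta_{qr}I_m$ if $p>q$. $\mathbb{L}(S)=\overline P(I_d\otimes\mathcal{L}(S))\overline P^T$. Algorithm (Riemannian gradient descent). Let $\nabla F(S)=2CS$, $\mathrm{grad}\,F(S)=\left[[CS]_i-S_i[CS]_i^TS_i\right]_1^m$ and $R(S,\xi)=[S_i\exp(S_i^T\xi_i)]_1^m$. Given $\widetilde S^k\in\mathbb{O}(d)^{m-1}$: set $S^k=\begin{bmatrix}I_d\\ \widetilde S^k\end{bmatrix}$;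 set $$\alpha_k=\max_{l\in\{0,1,2,\dots\}}\{\beta^l: F(R(S^k,-\beta^l\mathrm{grad}F(S^k)))-F(S^k)\le-\gamma\beta^l\,\mathrm{Tr}(\nabla F(S^k)^T\mathrm{grad}F(S^k))\};$$ set $\widetilde S^{k+1}=\pi(R(S^k,-\alpha_k\mathrm{grad}F(S^k)))$. "Converges locally linearly to $\widetilde S^*$" means: there is a neighbourhood $U$ of $\widetilde S^*$ such that for every initialization $\widetilde S^0\in U$ there are $c>0$, $q\in(0,1)$ with $\|\widetilde S^k-\widetilde S^*\|_F\le c\,q^k$ for all $k$. Rigidity. $\Theta(S)=S^TB\,\mathcal{L}_\Gamma^\dagger(:,1{:}n)(I_n-n^{-1}\mathbf{1}_n\mathbf{1}_n^T)\in\mathbb{R}^{d\times n}$ (first $n$ columns of $\mathcal{L}_\Gamma^\dagger$; $\mathbf{1}_n$ all-ones), with columns $x_k(S)$. For a perfect alignment $S$, the realization $\Theta(S)$ is: affinely rigid if for every $Y\in\mathbb{R}^{d\times n}$ such that for each $i$ there is an affine transform $A_i$ of $\mathbb{R}^d$ with $Y_k=A_i(x_{k,i})$ for all $(k,i)\in E(\Gamma)$, one has $Y=A\Theta(S)$ (columnwise) for some affine transform $A$; infinitesimally rigid if every $(p_k)_1^n\subseteq\mathbb{R}^d$ with $(x_{k_1}(S)-x_{k_2}(S))^T(p_{k_1}-p_{k_2})=0$ for all $i$ and $(k_1,i),(k_2,i)\in E(\Gamma)$ is of the form $p_k=\Omega x_k(S)+t$ with $\Omega$ skew-symmetric and $t\in\mathbb{R}^d$;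 locally rigid if there is $\epsilon>0$ such that for each perfect alignment $O$ with $\|\Theta(O)-\Theta(S)\|_F<\epsilon$, $\Theta(O)=\Theta(SQ)$ for some $Q\in\mathbb{O}(d)$; generic if the coordinates of the points $x_k(S)$ satisfy no non-zero algebraic equation with rational coefficients. *)

theory Defs
  imports "HOL-Analysis.Analysis" "HOL-Library.Poly_Mapping"
begin

text \<open>
  Points are indexed by \<open>'n\<close>, views by \<open>'m\<close> and coordinates of the ambient space by \<open>'d\<close>, so that
  \<open>n\<close>, \<open>m\<close>, \<open>d\<close> are the cardinalities of these types.  An index of \<open>\<real>\<^sup>m\<^sup>d\<close> is a pair \<open>(i, p)\<close>,
  which stands for position \<open>(i - 1) d + p\<close>.  The linear order on \<open>'m\<close> singles out the first view,
  the one on \<open>'d\<close> gives meaning to \<open>r < s\<close> in the definition of \<open>Pbar\<close>.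
  The norm of a matrix type such as \<open>real^'a^'b\<close> is the Frobenius norm.  Beware that \<open>*\<close>, \<open>1\<close> and
  powers are componentwise on these types; the matrix product is \<open>**\<close>.
\<close>

subsection \<open>Matrices\<close>

definition outer :: "real^'a \<Rightarrow> real^'b \<Rightarrow> real^'b^'a" where
  "outer u v = (\<chi> i j. u $ i * v $ j)"

definition is_pinv :: "real^'a^'b \<Rightarrow> real^'b^'a \<Rightarrow> bool" where
  "is_pinv A X \<longleftrightarrow> A ** X ** A = A \<and> X ** A ** X = X \<and>
     transpose (A ** X) = A ** X \<and> transpose (X ** A) = X ** A"

definition pinv :: "real^'a^'b \<Rightarrow> real^'b^'a" where
  "pinv A = (THE X. is_pinv A X)"

definition mat_exp :: "real^'a^'a \<Rightarrow> real^'a^'a" where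
  "mat_exp A = suminf (\<lambda>k. (1 / fact k) *\<^sub>R (((**) A ^^ k) (mat 1)))"

text \<open>Kronecker product; the pair index \<open>(a, b)\<close> is ordered with \<open>a\<close> as the slow index.\<close>

definition kron :: "real^'b::finite^'a::finite \<Rightarrow> real^'e::finite^'c::finite \<Rightarrow> real^('b \<times> 'e)^('a \<times> 'c)" where
  "kron A B = (\<chi> r c. A $ fst r $ fst c * B $ snd r $ snd c)"

definition row_block :: "real^'d^('m::finite \<times> 'd) \<Rightarrow> 'm \<Rightarrow> real^'d^'d" where
  "row_block A i = (\<chi> p q. A $ (i, p) $ q)"

definition stack :: "('m::finite \<Rightarrow> real^'d^'d) \<Rightarrow> real^'d^('m \<times> 'd)" where
  "stack A = (\<chi> r q. A (fst r) $ snd r $ q)"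

definition mat_block :: "real^('m::finite \<times> 'd::finite)^('m \<times> 'd) \<Rightarrow> 'm \<Rightarrow> 'm \<Rightarrow> real^'d^'d" where
  "mat_block M i j = (\<chi> p q. M $ (i, p) $ (j, q))"

definition block_diag :: "('m::finite \<Rightarrow> real^'d^'d) \<Rightarrow> real^('m \<times> 'd)^('m \<times> 'd)" where
  "block_diag A = (\<chi> r c. if fst r = fst c then A (fst r) $ snd r $ snd c else 0)"


subsection \<open>Patch frameworks\<close>

text \<open>
  A patch framework is given by \<open>E\<close> and \<open>x\<close>: the bipartite graph has vertex set \<open>'n + 'm\<close>
  (points and views), \<open>(k, i) \<in> E\<close> means that point \<open>k\<close> lies in view \<open>i\<close>, and \<open>x k i\<close> are its local
  coordinates in that view.  The values \<open>x k i\<close> with \<open>(k, i) \<notin> E\<close> are never used.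
\<close>

definition graph_connected :: "('n \<times> 'm) set \<Rightarrow> bool" where
  "graph_connected E \<longleftrightarrow>
     (let adj = {(Inl k, Inr i) | k i. (k, i) \<in> E} in \<forall>u v. (u, v) \<in> (adj \<union> adj\<inverse>)\<^sup>*)"

definition affinely_nondegenerate ::
    "('n::finite \<times> 'm::finite) set \<Rightarrow> ('n \<Rightarrow> 'm \<Rightarrow> real^'d) \<Rightarrow> 'm \<Rightarrow> bool" where
  "affinely_nondegenerate E x i \<longleftrightarrow>
     card {k. (k, i) \<in> E} \<ge> CARD('d) + 1 \<and>
     aff_dim (affine hull {x k i | k. (k, i) \<in> E}) = int CARD('d)"

definition edge_vec :: "'n::finite \<Rightarrow> 'm::finite \<Rightarrow> real^('n + 'm)" where
  "edge_vec k i = axis (Inl k) 1 - axis (Inr i) 1"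

text \<open>The \<open>md \<times> d\<close> matrix \<open>\<epsilon>\<^sub>i \<otimes> I\<^sub>d\<close>.\<close>

definition view_embed :: "'m::finite \<Rightarrow> real^'d^('m \<times> 'd)" where
  "view_embed i = stack (\<lambda>j. if j = i then mat 1 else 0)"

definition laplacian :: "('n::finite \<times> 'm::finite) set \<Rightarrow> real^('n + 'm)^('n + 'm)" where
  "laplacian E = (\<Sum>(k, i)\<in>E. outer (edge_vec k i) (edge_vec k i))"

definition B_mat ::
    "('n::finite \<times> 'm::finite) set \<Rightarrow> ('n \<Rightarrow> 'm \<Rightarrow> real^'d) \<Rightarrow> real^('n + 'm)^('m \<times> 'd)" where
  "B_mat E x = (\<Sum>(k, i)\<in>E. outer (view_embed i *v x k i) (edge_vec k i))"

definition D_mat ::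
    "('n::finite \<times> 'm::finite) set \<Rightarrow> ('n \<Rightarrow> 'm \<Rightarrow> real^'d) \<Rightarrow> real^('m \<times> 'd)^('m \<times> 'd)" where
  "D_mat E x =
     (\<Sum>(k, i)\<in>E. view_embed i ** outer (x k i) (x k i) ** transpose (view_embed i))"

definition C_mat ::
    "('n::finite \<times> 'm::finite) set \<Rightarrow> ('n \<Rightarrow> 'm \<Rightarrow> real^'d) \<Rightarrow> real^('m \<times> 'd)^('m \<times> 'd)" where
  "C_mat E x = D_mat E x - B_mat E x ** pinv (laplacian E) ** transpose (B_mat E x)"


subsection \<open>Alignments\<close>

definition alignments :: "(real^'d^('m::finite \<times> 'd)) set" where
  "alignments = {S. \<forall>i. orthogonal_matrix (row_block S i)}"

definition align_cost ::
    "('n::finite \<times> 'm::finite) set \<Rightarrow> ('n \<Rightarrow> 'm \<Rightarrow> real^'d) \<Rightarrow> real^'d^('m \<times> 'd) \<Rightarrow> real" where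
  "align_cost E x S = trace (C_mat E x ** S ** transpose S)"

definition perfect_alignment ::
    "('n::finite \<times> 'm::finite) set \<Rightarrow> ('n \<Rightarrow> 'm \<Rightarrow> real^'d) \<Rightarrow> real^'d^('m \<times> 'd) \<Rightarrow> bool" where
  "perfect_alignment E x S \<longleftrightarrow> S \<in> alignments \<and> align_cost E x S = 0"

definition first_view :: "'m::{finite,linorder}" where
  "first_view = Min UNIV"

text \<open>
  Since \<open>m\<close> is the cardinality of a type, there is no type of cardinality \<open>m - 1\<close> (which may be \<open>0\<close>).
  An element of \<open>\<real>\<^sup>(\<^sup>m\<^sup>-\<^sup>1\<^sup>)\<^sup>d\<^sup>\<times>\<^sup>d\<close> is therefore a stack whose \<open>m - 1\<close> blocks sit at the views
  other than the first one, with a zero block at the first view as padding.  This is an isometric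
  copy for the Frobenius norm.  Accordingly \<open>reduced_alignments\<close> is \<open>\<O>(d)\<^sup>m\<^sup>-\<^sup>1\<close>.
\<close>

definition reduced_alignments :: "(real^'d^('m::{finite,linorder} \<times> 'd)) set" where
  "reduced_alignments =
     {T. row_block T first_view = 0 \<and>
         (\<forall>i. i \<noteq> first_view \<longrightarrow> orthogonal_matrix (row_block T i))}"

text \<open>The map \<open>\<pi>\<close>.\<close>

definition reduce :: "real^'d^('m::{finite,linorder} \<times> 'd) \<Rightarrow> real^'d^('m \<times> 'd)" where
  "reduce S = stack (\<lambda>i. if i = first_view then 0
                         else row_block S i ** transpose (row_block S first_view))"

text \<open>The stack of \<open>I\<^sub>d\<close> on top of an element of \<open>\<O>(d)\<^sup>m\<^sup>-\<^sup>1\<close>.\<close>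

definition unreduce :: "real^'d^('m::{finite,linorder} \<times> 'd) \<Rightarrow> real^'d^('m \<times> 'd)" where
  "unreduce T = stack (\<lambda>i. if i = first_view then mat 1 else row_block T i)"


subsection \<open>The matrix \<open>\<bbbL>(S)\<close>\<close>

definition C_at ::
    "('n::finite \<times> 'm::finite) set \<Rightarrow> ('n \<Rightarrow> 'm \<Rightarrow> real^'d) \<Rightarrow> real^'d^('m \<times> 'd) \<Rightarrow> real^('m \<times> 'd)^('m \<times> 'd)" where
  "C_at E x S = transpose (block_diag (row_block S)) ** C_mat E x ** block_diag (row_block S)"

definition C_hat ::
    "('n::finite \<times> 'm::finite) set \<Rightarrow> ('n \<Rightarrow> 'm \<Rightarrow> real^'d) \<Rightarrow> real^'d^('m \<times> 'd) \<Rightarrow> real^('m \<times> 'd)^('m \<times> 'd)" where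
  "C_hat E x S = block_diag (\<lambda>i. \<Sum>j\<in>UNIV. mat_block (C_at E x S) i j)"

definition L_mat ::
    "('n::finite \<times> 'm::finite) set \<Rightarrow> ('n \<Rightarrow> 'm \<Rightarrow> real^'d) \<Rightarrow> real^'d^('m \<times> 'd) \<Rightarrow> real^('m \<times> 'd)^('m \<times> 'd)" where
  "L_mat E x S = C_at E x S - C_hat E x S"

text \<open>Row index \<open>(p, i)\<close> stands for position \<open>(p - 1) m + i\<close>.\<close>

definition P_mat :: "real^('m::finite \<times> 'd::finite)^('d \<times> 'm)" where
  "P_mat = (\<chi> r c. if fst r = snd c \<and> snd r = fst c then 1 else 0)"

definition L_cal ::
    "('n::finite \<times> 'm::finite) set \<Rightarrow> ('n \<Rightarrow> 'm \<Rightarrow> real^'d) \<Rightarrow> real^'d^('m \<times> 'd) \<Rightarrow> real^('d \<times> 'm)^('d \<times> 'm)" where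
  "L_cal E x S = P_mat ** L_mat E x S ** transpose P_mat"

text \<open>
  Column index \<open>(q, (p, j))\<close> is entry \<open>j\<close> of block column \<open>(p, q)\<close>, and row index \<open>(s, (r, i))\<close> is
  entry \<open>i\<close> of block row \<open>(r, s)\<close>: in column-major order the second component is the slow index, and
  this matches the indices of \<open>I\<^sub>d \<otimes> \<L>(S)\<close>.  Block rows exist for \<open>r < s\<close> only; as there may be none
  of them (\<open>d = 1\<close>) while types are inhabited, the index pairs with \<open>r \<ge> s\<close> are kept and carry zero
  rows.  Hence \<open>L_bb\<close> below is \<open>\<bbbL>(S)\<close> padded by zero rows and zero columns, which leaves its rank
  unchanged.
\<close>

definition Pbar :: "real^('d \<times> ('d \<times> 'm::finite))^('d::{finite,linorder} \<times> ('d \<times> 'm))" where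
  "Pbar = (\<chi> row col. case row of (s, (r, i)) \<Rightarrow> case col of (q, (p, j)) \<Rightarrow>
     if r < s \<and> i = j then
       (if p < q \<and> p = r \<and> q = s then 1
        else if p > q \<and> p = s \<and> q = r then - 1
        else 0)
     else 0)"

definition L_bb ::
    "('n::finite \<times> 'm::finite) set \<Rightarrow> ('n \<Rightarrow> 'm \<Rightarrow> real^'d::{finite,linorder}) \<Rightarrow> real^'d::_^('m \<times> 'd) \<Rightarrow>
     real^('d \<times> ('d \<times> 'm))^('d \<times> ('d \<times> 'm))" where
  "L_bb E x S = Pbar ** kron (mat 1) (L_cal E x S) ** transpose Pbar"


subsection \<open>Riemannian gradient descent\<close>

definition egrad ::
    "('n::finite \<times> 'm::finite) set \<Rightarrow> ('n \<Rightarrow> 'm \<Rightarrow> real^'d) \<Rightarrow> real^'d^('m \<times> 'd) \<Rightarrow> real^'d^('m \<times> 'd)" where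
  "egrad E x S = 2 *\<^sub>R (C_mat E x ** S)"

definition rgrad ::
    "('n::finite \<times> 'm::finite) set \<Rightarrow> ('n \<Rightarrow> 'm \<Rightarrow> real^'d) \<Rightarrow> real^'d^('m \<times> 'd) \<Rightarrow> real^'d^('m \<times> 'd)" where
  "rgrad E x S = stack (\<lambda>i. row_block (C_mat E x ** S) i -
     row_block S i ** transpose (row_block (C_mat E x ** S) i) ** row_block S i)"

definition retract :: "real^'d^('m::finite \<times> 'd) \<Rightarrow> real^'d^('m \<times> 'd) \<Rightarrow> real^'d^('m \<times> 'd)" where
  "retract S \<xi> = stack (\<lambda>i. row_block S i ** mat_exp (transpose (row_block S i) ** row_block \<xi> i))"

definition step_size ::
    "('n::finite \<times> 'm::finite) set \<Rightarrow> ('n \<Rightarrow> 'm \<Rightarrow> real^'d) \<Rightarrow> real \<Rightarrow> real \<Rightarrow> real^'d^('m \<times> 'd) \<Rightarrow> real" where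
  "step_size E x \<beta> \<gamma> S = (GREATEST a. \<exists>l::nat. a = \<beta> ^ l \<and>
     align_cost E x (retract S (- (\<beta> ^ l *\<^sub>R rgrad E x S))) - align_cost E x S
       \<le> - \<gamma> * \<beta> ^ l * trace (transpose (egrad E x S) ** rgrad E x S))"

definition rgd_step ::
    "('n::finite \<times> 'm::{finite,linorder}) set \<Rightarrow> ('n \<Rightarrow> 'm \<Rightarrow> real^'d) \<Rightarrow> real \<Rightarrow> real \<Rightarrow>
     real^'d^('m \<times> 'd) \<Rightarrow> real^'d^('m \<times> 'd)" where
  "rgd_step E x \<beta> \<gamma> T =
     (let S = unreduce T
      in reduce (retract S (- (step_size E x \<beta> \<gamma> S *\<^sub>R rgrad E x S))))"

definition rgd_iterate ::
    "('n::finite \<times> 'm::{finite,linorder}) set \<Rightarrow> ('n \<Rightarrow> 'm \<Rightarrow> real^'d) \<Rightarrow> real \<Rightarrow> real \<Rightarrow>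
     real^'d^('m \<times> 'd) \<Rightarrow> nat \<Rightarrow> real^'d^('m \<times> 'd)" where
  "rgd_iterate E x \<beta> \<gamma> T0 k = (rgd_step E x \<beta> \<gamma> ^^ k) T0"

definition rgd_converges_locally_linearly ::
    "('n::finite \<times> 'm::{finite,linorder}) set \<Rightarrow> ('n \<Rightarrow> 'm \<Rightarrow> real^'d) \<Rightarrow> real \<Rightarrow> real \<Rightarrow>
     real^'d^('m \<times> 'd) \<Rightarrow> bool" where
  "rgd_converges_locally_linearly E x \<beta> \<gamma> T \<longleftrightarrow>
     (\<exists>U. openin (top_of_set reduced_alignments) U \<and> T \<in> U \<and>
        (\<forall>T0\<in>U. \<exists>c q. c > 0 \<and> 0 < q \<and> q < 1 \<and>
           (\<forall>k. norm (rgd_iterate E x \<beta> \<gamma> T0 k - T) \<le> c * q ^ k)))"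


subsection \<open>Realizations and rigidity\<close>

definition realization ::
    "('n::finite \<times> 'm::finite) set \<Rightarrow> ('n \<Rightarrow> 'm \<Rightarrow> real^'d) \<Rightarrow> real^'d^('m \<times> 'd) \<Rightarrow> real^'n^'d" where
  "realization E x S =
     transpose S ** B_mat E x ** (\<chi> u k. pinv (laplacian E) $ u $ Inl k) **
     (mat 1 - (1 / real CARD('n)) *\<^sub>R outer (\<chi> k. 1) (\<chi> k. 1))"

definition affine_transform :: "(real^'d \<Rightarrow> real^'d) \<Rightarrow> bool" where
  "affine_transform f \<longleftrightarrow> (\<exists>M t. \<forall>y. f y = M *v y + t)"

definition affinely_rigid ::
    "('n::finite \<times> 'm::finite) set \<Rightarrow> ('n \<Rightarrow> 'm \<Rightarrow> real^'d) \<Rightarrow> real^'d^('m \<times> 'd) \<Rightarrow> bool" where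
  "affinely_rigid E x S \<longleftrightarrow>
     (\<forall>Y :: real^'n^'d.
        (\<forall>i. \<exists>A. affine_transform A \<and> (\<forall>k. (k, i) \<in> E \<longrightarrow> column k Y = A (x k i))) \<longrightarrow>
        (\<exists>A. affine_transform A \<and> (\<forall>k. column k Y = A (column k (realization E x S)))))"

definition infinitesimally_rigid ::
    "('n::finite \<times> 'm::finite) set \<Rightarrow> ('n \<Rightarrow> 'm \<Rightarrow> real^'d) \<Rightarrow> real^'d^('m \<times> 'd) \<Rightarrow> bool" where
  "infinitesimally_rigid E x S \<longleftrightarrow>
     (\<forall>p :: 'n \<Rightarrow> real^'d.
        (\<forall>i k1 k2. (k1, i) \<in> E \<and> (k2, i) \<in> E \<longrightarrow>
           (column k1 (realization E x S) - column k2 (realization E x S)) \<bullet> (p k1 - p k2) = 0) \<longrightarrow>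
        (\<exists>\<Omega> t. transpose \<Omega> = - \<Omega> \<and> (\<forall>k. p k = \<Omega> *v column k (realization E x S) + t)))"

definition locally_rigid ::
    "('n::finite \<times> 'm::finite) set \<Rightarrow> ('n \<Rightarrow> 'm \<Rightarrow> real^'d) \<Rightarrow> real^'d^('m \<times> 'd) \<Rightarrow> bool" where
  "locally_rigid E x S \<longleftrightarrow>
     (\<exists>\<epsilon>>0. \<forall>S'. perfect_alignment E x S' \<and>
        norm (realization E x S' - realization E x S) < \<epsilon> \<longrightarrow>
        (\<exists>Q. orthogonal_matrix Q \<and> realization E x S' = realization E x (S ** Q)))"

text \<open>
  Rational polynomials in the variables \<open>X\<^sub>k\<^sub>,\<^sub>c\<close> (point \<open>k\<close>, coordinate \<open>c\<close>) are finitely supported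
  maps from exponent vectors to coefficients.
\<close>

definition eval_poly ::
    "((('n::finite \<times> 'd::finite) \<Rightarrow>\<^sub>0 nat) \<Rightarrow>\<^sub>0 rat) \<Rightarrow> ('n \<Rightarrow> real^'d) \<Rightarrow> real" where
  "eval_poly f y =
     (\<Sum>e\<in>Poly_Mapping.keys f. of_rat (Poly_Mapping.lookup f e) *
        (\<Prod>(k, c)\<in>Poly_Mapping.keys e. (y k $ c) ^ Poly_Mapping.lookup e (k, c)))"

definition generic_points :: "('n::finite \<Rightarrow> real^'d) \<Rightarrow> bool" where
  "generic_points y \<longleftrightarrow>
     (\<forall>f :: (('n \<times> 'd) \<Rightarrow>\<^sub>0 nat) \<Rightarrow>\<^sub>0 rat. f \<noteq> 0 \<longrightarrow> eval_poly f y \<noteq> 0)"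

text \<open>
  The points \<open>x\<^sub>k(S)\<close> are centred at the origin, so their coordinates always satisfy the rational
  equation \<open>\<Sum>\<^sub>k x\<^sub>k(S) = 0\<close> and \<open>generic_points\<close> never holds for them (\<open>not_generic_points_realization\<close>).
  Genericity of a realization therefore has to be understood up to translation, i.e. without taking
  the normalization of the centroid into account.  The choice \<open>t = 0\<close> is the literal condition.
\<close>

definition generic_realization ::
    "('n::finite \<times> 'm::finite) set \<Rightarrow> ('n \<Rightarrow> 'm \<Rightarrow> real^'d) \<Rightarrow> real^'d^('m \<times> 'd) \<Rightarrow> bool" where
  "generic_realization E x S \<longleftrightarrow>
     (\<exists>t. generic_points (\<lambda>k. column k (realization E x S) + t))"

lemma generic_realizationI:
  "generic_points (\<lambda>k. column k (realization E x S)) \<Longrightarrow> generic_realization E x S"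
  unfolding generic_realization_def by (rule exI[of _ 0]) simp

lemma sum_column_realization:
  fixes x :: "'n::finite \<Rightarrow> 'm::finite \<Rightarrow> real^'d"
  shows "(\<Sum>k\<in>UNIV. column k (realization E x S)) = 0"
proof -
  have "(\<Sum>k\<in>UNIV. (A ** (mat 1 - (1 / real CARD('n)) *\<^sub>R outer (\<chi> k. 1) (\<chi> k. 1))) $ c $ k) = 0"
    for A :: "real^'n^'d" and c
  proof -
    have "(\<Sum>k\<in>UNIV. (mat 1 - (1 / real CARD('n)) *\<^sub>R outer (\<chi> k. 1) (\<chi> k. 1)) $ l $ k) = (0::real)"
      for l :: 'n
      by (simp add: outer_def mat_def sum_subtractf)
    then show ?thesis
      unfolding matrix_matrix_mult_def
      by (simp add: sum.swap[of _ UNIV UNIV] sum_distrib_left[symmetric])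
  qed
  then show ?thesis
    by (simp add: vec_eq_iff column_def realization_def)
qed

lemma not_generic_points_realization:
  fixes x :: "'n::finite \<Rightarrow> 'm::finite \<Rightarrow> real^'d"
  shows "\<not> generic_points (\<lambda>k. column k (realization E x S))"
proof
  assume gen: "generic_points (\<lambda>k. column k (realization E x S))"
  fix c :: 'd
  define X :: "'n \<Rightarrow> ('n \<times> 'd) \<Rightarrow>\<^sub>0 nat" where "X k = Poly_Mapping.single (k, c) 1" for k
  define f :: "(('n \<times> 'd) \<Rightarrow>\<^sub>0 nat) \<Rightarrow>\<^sub>0 rat" where "f = (\<Sum>k\<in>UNIV. Poly_Mapping.single (X k) 1)"
  have inj: "inj X"
  proof (rule injI)
    fix k l assume "X k = X l"
    then have "Poly_Mapping.keys (X k) = Poly_Mapping.keys (X l)" by simp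
    then show "k = l" by (simp add: X_def)
  qed
  have look: "Poly_Mapping.lookup f e = (if e \<in> range X then 1 else 0)" for e
  proof (cases "e \<in> range X")
    case True
    then obtain k where "e = X k" by auto
    then show ?thesis
      using inj by (simp add: f_def lookup_sum lookup_single when_def inj_eq)
  next
    case False
    then have "X k \<noteq> e" for k by auto
    then show ?thesis
      using False by (simp add: f_def lookup_sum lookup_single when_def)
  qed
  have keys: "Poly_Mapping.keys f = range X"
    by (auto simp: in_keys_iff look split: if_splits)
  have "f \<noteq> 0"
    using look[of "X undefined"] by auto
  moreover have "eval_poly f (\<lambda>k. column k (realization E x S)) = 0"
  proof -
    have "eval_poly f (\<lambda>k. column k (realization E x S)) =
        (\<Sum>k\<in>UNIV. column k (realization E x S) $ c)"
      using inj by (simp add: eval_poly_def keys look sum.reindex) (simp add: X_def)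
    also have "\<dots> = (\<Sum>k\<in>UNIV. column k (realization E x S)) $ c"
      by (simp only: sum_component)
    finally show ?thesis by (simp only: sum_column_realization zero_index)
  qed
  ultimately show False
    using gen by (auto simp: generic_points_def)
qed

end

theory Submission
  imports Defs
begin

text \<open>
  The quadratic form of \<open>C\<close> is the minimum over vertex potentials of the sum of the squared residuals on
  the edges.  Hence \<open>C V = 0\<close> iff the linear maps \<open>V\<^sub>i\<^sup>T\<close>, followed by suitable translations, agree on the points
  shared by the views; at a perfect alignment all the rank conditions become statements about such glued families.
  For convergence, in the gauge where the first block is fixed, condition (2) makes the Hessian of \<open>F\<close> at the
  perfect alignment positive definite.  So \<open>F\<close> grows quadratically and \<open>F \<le> const |grad F|\<^sup>2\<close> nearby, the Armijo
  step sizes are bounded below, and the cost decreases geometrically.  That a generic locally rigid realization is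
  infinitesimally rigid is the Asimow-Roth argument: at a generic configuration the rigidity matrix has maximal
  rank, so every infinitesimal flex is the initial velocity of a curve that preserves all the distances within
  the views.
\<close>

text \<open>The rank conditions are never attacked through matrix entries. Both become kernel
  conditions: for \<open>C\<close> on vectors, and for \<open>C\<close> on stacks of
  \<open>S\<^sub>i X\<^sub>i\<close> with skew \<open>X\<^sub>i\<close>. Nondegenerate views let
  glued points and linear maps determine each other up to translation, so the kernels speak about
  realizations. The obstacle to convergence is that \<open>F\<close> is invariant under right
  multiplication by an orthogonal matrix: perfect alignments come in orbits, and every step moves
  the first block, whose renormalization must be charged to the length of the step. Low cost alone
  does not mean being close to the limit, since the growth bound is only local. The invariant region
  is therefore a ball cut with a sublevel set: a step is too short to leave the ball where growth
  holds, and low cost then pulls the iterate back. The gradient bound comes from testing the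
  gradient against the displacement itself. In the generic part, maximality of the rank is carried
  from an arbitrary configuration to the generic one by a single determinant. Only the derivative of
  the curve at 0 is needed, because local rigidity makes distances constant along a whole piece of
  it.\<close>

lemma inner_matrix_eq: "A \<bullet> B = (\<Sum>i\<in>UNIV. \<Sum>j\<in>UNIV. A $ i $ j * B $ i $ j)" for A B :: "real^'a^'b"
  by (simp add: inner_vec_def)

lemma trace_transpose_mult: "trace (transpose A ** B) = A \<bullet> B" for A B :: "real^'a^'b"
  unfolding inner_matrix_eq trace_def matrix_matrix_mult_def transpose_def
  by (simp, subst sum.swap, simp)

lemma inner_transpose: "transpose A \<bullet> transpose B = A \<bullet> B" for A B :: "real^'a^'b"
  unfolding inner_matrix_eq transpose_def by (simp, subst sum.swap, simp)

lemma norm_transpose: "norm (transpose A) = norm A" for A :: "real^'a^'b"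
  by (simp add: norm_eq_sqrt_inner inner_transpose)

lemma inner_matrix_mult_left: "(A ** X) \<bullet> Y = X \<bullet> (transpose A ** Y)" for A :: "real^'a^'b" and X :: "real^'c^'a"
  unfolding trace_transpose_mult[symmetric] matrix_transpose_mul matrix_mul_assoc ..

lemma inner_matrix_mult_right: "(X ** A) \<bullet> Y = X \<bullet> (Y ** transpose A)" for A :: "real^'a^'b" and X :: "real^'b^'c"
  unfolding inner_transpose[of "X ** A" Y, symmetric] inner_transpose[of X, symmetric]
  by (simp add: matrix_transpose_mul inner_matrix_mult_left)

lemma norm_matrix_mult_le: "norm (A ** B) \<le> norm A * norm B" for A :: "real^'a^'b" and B :: "real^'c^'a"
proof -
  have n2: "(norm M)\<^sup>2 = (\<Sum>i\<in>UNIV. (norm (M $ i))\<^sup>2)" for M :: "real^'x^'y"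
    by (simp add: power2_norm_eq_inner inner_vec_def[of M])
  have "(A ** B) $ i $ j = A $ i \<bullet> (transpose B $ j)" for i j
    by (simp add: matrix_matrix_mult_def inner_vec_def transpose_def)
  then have "(norm (A ** B))\<^sup>2 = (\<Sum>i\<in>UNIV. \<Sum>j\<in>UNIV. (A $ i \<bullet> (transpose B $ j))\<^sup>2)"
    unfolding power2_norm_eq_inner inner_matrix_eq by (simp add: power2_eq_square)
  also have "\<dots> \<le> (\<Sum>i\<in>UNIV. \<Sum>j\<in>UNIV. (norm (A $ i))\<^sup>2 * (norm (transpose B $ j))\<^sup>2)"
    by (intro sum_mono) (metis Cauchy_Schwarz_ineq power2_norm_eq_inner)
  also have "\<dots> = (norm A)\<^sup>2 * (norm (transpose B))\<^sup>2"
    by (simp add: n2 sum_product)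
  also have "\<dots> = (norm A * norm B)\<^sup>2"
    by (simp add: norm_transpose power_mult_distrib)
  finally show ?thesis
    by (rule power2_le_imp_le) simp
qed

lemma norm_orthogonal_mult:
  fixes Q :: "real^'a^'a"
  assumes "orthogonal_matrix Q"
  shows "norm (Q ** X) = norm X"
  using assms
  by (simp add: norm_eq_sqrt_inner inner_matrix_mult_left matrix_mul_assoc orthogonal_matrix)

lemma norm_mult_orthogonal:
  fixes Q :: "real^'a^'a"
  assumes "orthogonal_matrix Q"
  shows "norm (X ** Q) = norm X"
  using norm_orthogonal_mult[of "transpose Q" "transpose X"] assms norm_transpose[of "X ** Q"]
  by (simp add: norm_transpose matrix_transpose_mul)

lemma orthogonal_matrixD:
  fixes Q :: "real^'a^'a"
  assumes "orthogonal_matrix Q"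
  shows "transpose Q ** Q = mat 1" "Q ** transpose Q = mat 1"
    "transpose Q ** (Q ** X) = X" "Q ** (transpose Q ** X) = X"
  using assms by (simp_all add: orthogonal_matrix_def matrix_mul_assoc)

lemma matrix_add_mult: "(A + B) ** C = A ** C + B ** C" for A B :: "real^'a^'b"
  by (simp add: vec_eq_iff matrix_matrix_mult_def distrib_right sum.distrib)

lemma transpose_zero [simp]: "transpose 0 = (0::real^'a^'b)"
  by (simp add: vec_eq_iff transpose_def)

lemma matrix_diff_mult: "(A - B) ** C = A ** C - B ** C" for A B :: "real^'a^'b"
  by (simp add: vec_eq_iff matrix_matrix_mult_def left_diff_distrib sum_subtractf)

lemma matrix_mult_diff: "C ** (A - B) = C ** A - C ** B" for A B :: "real^'a^'b"
  by (simp add: vec_eq_iff matrix_matrix_mult_def right_diff_distrib sum_subtractf)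

lemma matrix_mult_uminus: "C ** (- B) = - (C ** B)" "(- C) ** B = - (C ** B)" for B :: "real^'a^'b"
  by (simp_all add: vec_eq_iff matrix_matrix_mult_def sum_negf)

lemma matrix_mult_zero [simp]: "C ** (0::real^'a^'b) = 0" "(0::real^'b^'c) ** B = 0"
  by (simp_all add: vec_eq_iff matrix_matrix_mult_def)

lemma transpose_add: "transpose (A + B) = transpose A + transpose B" for A B :: "real^'a^'b"
  by (simp add: vec_eq_iff transpose_def)

lemma transpose_diff: "transpose (A - B) = transpose A - transpose B" for A B :: "real^'a^'b"
  by (simp add: vec_eq_iff transpose_def)

lemma transpose_uminus: "transpose (- A) = - transpose A" for A :: "real^'a^'b"
  by (simp add: vec_eq_iff transpose_def)

lemma transpose_scaleR: "transpose (c *\<^sub>R A) = c *\<^sub>R transpose A" for A :: "real^'a^'b"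
  by (simp add: vec_eq_iff transpose_def)

lemma column_matrix_mult: "column c (A ** B) = A *v column c B" for A :: "real^'a^'b"
  by (simp add: vec_eq_iff column_def matrix_matrix_mult_def matrix_vector_mult_def)

lemma matrix_eq_columns: "A = B \<longleftrightarrow> (\<forall>c. column c A = column c B)" for A B :: "real^'a^'b"
  by (auto simp: vec_eq_iff column_def)

lemma column_zero [simp]: "column c (0::real^'a^'b) = 0"
  by (simp add: vec_eq_iff column_def)

lemma inner_columns: "A \<bullet> B = (\<Sum>c\<in>UNIV. column c A \<bullet> column c B)" for A B :: "real^'a^'b"
  unfolding inner_matrix_eq by (subst sum.swap) (simp add: inner_vec_def column_def)


subsection \<open>Stacks of square blocks\<close>

lemma row_block_stack [simp]: "row_block (stack f) i = f i"
  by (simp add: row_block_def stack_def vec_eq_iff)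

lemma stack_row_block [simp]: "stack (row_block V) = V"
  by (simp add: row_block_def stack_def vec_eq_iff)

lemma row_block_eqI: "(\<And>i. row_block V i = row_block W i) \<Longrightarrow> V = W"
  by (metis ext stack_row_block)

lemma row_block_mult: "row_block (V ** Q) i = row_block V i ** Q"
  by (simp add: row_block_def vec_eq_iff matrix_matrix_mult_def)

lemma row_block_linear:
  "row_block (V + W) i = row_block V i + row_block W i"
  "row_block (V - W) i = row_block V i - row_block W i"
  "row_block (- V) i = - row_block V i"
  "row_block (c *\<^sub>R V) i = c *\<^sub>R row_block V i"
  "row_block 0 i = 0"
  by (simp_all add: row_block_def vec_eq_iff)

lemma sum_UNIV_prod: "(\<Sum>a\<in>UNIV. f a) = (\<Sum>i\<in>UNIV. \<Sum>p\<in>UNIV. f (i, p))"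
  for f :: "'a::finite \<times> 'b::finite \<Rightarrow> 'c::comm_monoid_add"
  by (simp add: sum.cartesian_product flip: UNIV_Times_UNIV)

lemma inner_row_blocks: "V \<bullet> W = (\<Sum>i\<in>UNIV. row_block V i \<bullet> row_block W i)"
  by (simp add: inner_vec_def row_block_def sum_UNIV_prod)

lemma norm_row_blocks: "(norm V)\<^sup>2 = (\<Sum>i\<in>UNIV. (norm (row_block V i))\<^sup>2)"
  by (simp add: power2_norm_eq_inner inner_row_blocks)

lemma norm_row_block_le: "norm (row_block V i) \<le> norm V"
proof (rule power2_le_imp_le)
  show "(norm (row_block V i))\<^sup>2 \<le> (norm V)\<^sup>2"
    unfolding norm_row_blocks[of V] by (rule member_le_sum) auto
qed simp


subsection \<open>The pseudoinverse of the Laplacian\<close>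

text \<open>Penrose's argument: \<open>A ** X\<close> and \<open>A ** Y\<close> are symmetric and
  absorb each other, hence coincide, and likewise \<open>X ** A\<close> and
  \<open>Y ** A\<close>.\<close>

lemma is_pinv_unique:
  assumes "is_pinv A X" "is_pinv A Y" shows "X = Y"
proof -
  have X: "A ** X ** A = A" "X ** A ** X = X" "transpose (A ** X) = A ** X" "transpose (X ** A) = X ** A"
    and Y: "A ** Y ** A = A" "Y ** A ** Y = Y" "transpose (A ** Y) = A ** Y" "transpose (Y ** A) = Y ** A"
    using assms by (auto simp: is_pinv_def)
  have "A ** X = transpose (A ** X)" by (simp add: X)
  also have "\<dots> = transpose ((A ** Y) ** (A ** X))" by (simp add: matrix_mul_assoc Y)
  also have "\<dots> = (A ** X) ** (A ** Y)" using X(3) Y(3) by (simp only: matrix_transpose_mul[of "A ** Y"])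
  also have "\<dots> = A ** Y" by (simp add: matrix_mul_assoc X)
  finally have AX: "A ** X = A ** Y" .
  have "X ** A = transpose (X ** A)" by (simp add: X)
  also have "\<dots> = transpose ((X ** A) ** (Y ** A))" by (metis matrix_mul_assoc Y(1))
  also have "\<dots> = (Y ** A) ** (X ** A)" using X(4) Y(4) by (simp only: matrix_transpose_mul[of "X ** A"])
  also have "\<dots> = Y ** A" by (metis matrix_mul_assoc X(1))
  finally have XA: "X ** A = Y ** A" .
  have "X = X ** A ** X" by (simp add: X)
  also have "\<dots> = Y ** (A ** X)" by (simp add: XA matrix_mul_assoc)
  also have "\<dots> = Y" by (simp add: AX matrix_mul_assoc Y)
  finally show ?thesis .
qed

lemma pinv_eqI: "is_pinv A X \<Longrightarrow> pinv A = X"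
  unfolding pinv_def by (blast intro: is_pinv_unique)

lemma inner_edge_vec: "z \<bullet> edge_vec k i = z $ Inl k - z $ Inr i"
  by (simp add: edge_vec_def inner_diff_right inner_axis)

lemma outer_mult_vec: "outer u v *v w = (v \<bullet> w) *\<^sub>R u"
  by (simp add: outer_def vec_eq_iff matrix_vector_mult_def inner_vec_def sum_distrib_left mult_ac)

lemma sum_matrix_vector_mult: "(\<Sum>a\<in>I. f a) *v w = (\<Sum>a\<in>I. f a *v w)" for f :: "'i \<Rightarrow> real^'a^'b"
  by (induction I rule: infinite_finite_induct) (simp_all add: matrix_vector_mult_add_rdistrib)

lemma laplacian_mult: "laplacian E *v z = (\<Sum>(k, i)\<in>E. (z \<bullet> edge_vec k i) *\<^sub>R edge_vec k i)"
  unfolding laplacian_def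
  by (simp add: sum_matrix_vector_mult case_prod_unfold outer_mult_vec inner_commute)

lemma inner_laplacian: "w \<bullet> (laplacian E *v z) = (\<Sum>(k, i)\<in>E. (w \<bullet> edge_vec k i) * (z \<bullet> edge_vec k i))"
  unfolding laplacian_mult by (simp add: inner_sum_right case_prod_unfold mult.commute)

lemma transpose_outer: "transpose (outer u v) = outer v u"
  by (simp add: outer_def transpose_def vec_eq_iff mult.commute)

lemma transpose_sum: "transpose (\<Sum>a\<in>I. f a) = (\<Sum>a\<in>I. transpose (f a))" for f :: "'i \<Rightarrow> real^'a^'b"
  by (induction I rule: infinite_finite_induct) (simp_all add: transpose_add)

lemma transpose_laplacian: "transpose (laplacian E) = laplacian E"
  by (simp add: laplacian_def transpose_sum case_prod_unfold transpose_outer)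

lemma graph_connected_const:
  fixes z :: "real^('n::finite + 'm::finite)"
  assumes "graph_connected E" and "\<And>k i. (k, i) \<in> E \<Longrightarrow> z $ Inl k = z $ Inr i"
  shows "z $ u = z $ v"
proof -
  define adj where "adj = {(Inl k :: 'n + 'm, Inr i :: 'n + 'm) | k i. (k, i) \<in> E}"
  have "(u, v) \<in> (adj \<union> adj\<inverse>)\<^sup>*"
    using assms(1) by (simp add: graph_connected_def adj_def Let_def)
  then show ?thesis
    by (induction rule: rtrancl_induct) (use assms(2) in \<open>auto simp: adj_def\<close>)
qed

text \<open>The orthogonal projector onto the constant vectors, which form the kernel of the
  Laplacian of a connected graph.\<close>

definition mean_mat :: "real^'a^'a" where
  "mean_mat = (1 / real CARD('a)) *\<^sub>R outer (\<chi> k. 1) (\<chi> k. 1)"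

lemma mean_mat_mult: "mean_mat *v z = (\<chi> u. (\<Sum>v\<in>UNIV. z $ v) / real CARD('a))" for z :: "real^'a"
  by (simp add: mean_mat_def scaleR_matrix_vector_assoc[symmetric] outer_mult_vec vec_eq_iff inner_vec_def)

text \<open>Adding the projector \<open>J\<close> onto its kernel makes the Laplacian invertible;
  with \<open>N\<close> the inverse of the sum, \<open>N - J\<close> satisfies the Penrose
  equations.\<close>

lemma laplacian_pinv:
  fixes E :: "('n::finite \<times> 'm::finite) set"
  assumes "graph_connected E"
  shows "laplacian E ** pinv (laplacian E) = mat 1 - mean_mat"
    and "pinv (laplacian E) ** laplacian E = mat 1 - mean_mat"
    and "transpose (pinv (laplacian E)) = pinv (laplacian E)"
proof -
  let ?L = "laplacian E" and ?J = "mean_mat :: real^('n + 'm)^('n + 'm)"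
  define M where "M = ?L + ?J"
  have JJ: "?J ** ?J = ?J"
    by (simp add: matrix_eq mean_mat_mult vec_eq_iff flip: matrix_vector_mul_assoc)
  have Jt: "transpose ?J = ?J"
    by (simp add: mean_mat_def transpose_scaleR transpose_outer)
  have LJ: "?L ** ?J = 0"
    by (simp add: matrix_eq mean_mat_mult laplacian_mult inner_edge_vec flip: matrix_vector_mul_assoc)
  then have JL: "?J ** ?L = 0"
    by (metis Jt transpose_laplacian matrix_transpose_mul transpose_zero)
  \<comment> \<open>The quadratic form of \<open>M\<close> is a sum of squares: the edge part forces
    \<open>z\<close> to be constant, the mean part forces that constant to be zero.\<close>
  have ker: "z = 0" if "M *v z = 0" for z
  proof -
    have "z \<bullet> (?J *v z) = (\<Sum>v\<in>UNIV. z $ v)\<^sup>2 / real CARD('n + 'm)"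
      by (simp add: mean_mat_mult inner_vec_def power2_eq_square sum_distrib_right[symmetric] sum_divide_distrib[symmetric])
    then have "0 = (\<Sum>(k, i)\<in>E. (z \<bullet> edge_vec k i)\<^sup>2) + (\<Sum>v\<in>UNIV. z $ v)\<^sup>2 / real CARD('n + 'm)"
      using arg_cong[OF that, of "\<lambda>w. z \<bullet> w"]
      by (simp add: M_def matrix_vector_mult_add_rdistrib inner_add_right inner_laplacian power2_eq_square)
    moreover have "0 \<le> (\<Sum>(k, i)\<in>E. (z \<bullet> edge_vec k i)\<^sup>2)" "0 \<le> (\<Sum>v\<in>UNIV. z $ v)\<^sup>2 / real CARD('n + 'm)"
      by (auto intro!: sum_nonneg)
    ultimately have a: "(\<Sum>(k, i)\<in>E. (z \<bullet> edge_vec k i)\<^sup>2) = 0" and b: "(\<Sum>v\<in>UNIV. z $ v)\<^sup>2 / real CARD('n + 'm) = 0"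
      by linarith+
    have "z $ Inl k = z $ Inr i" if "(k, i) \<in> E" for k i
      using a that by (subst (asm) sum_nonneg_eq_0_iff) (auto simp: inner_edge_vec)
    then have c: "z $ u = z $ v" for u v
      by (rule graph_connected_const[OF assms])
    have "z $ u = 0" for u
    proof -
      have "(\<Sum>v\<in>UNIV. z $ v) = (\<Sum>v\<in>(UNIV :: ('n + 'm) set). z $ u)"
        by (rule sum.cong[OF refl]) (rule c)
      then have "real CARD('n + 'm) * z $ u = 0"
        using b by (simp only: sum_constant divide_eq_0_iff) auto
      then show ?thesis
        by (simp only: mult_eq_0_iff of_nat_eq_0_iff zero_less_card_finite[THEN less_not_refl2] simp_thms)
    qed
    then show ?thesis by (simp add: vec_eq_iff)
  qed
  then obtain N where NM: "N ** M = mat 1"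
    using matrix_left_invertible_ker by blast
  then have MN: "M ** N = mat 1"
    by (simp add: matrix_left_right_inverse)
  have MJ: "M ** ?J = ?J" and JM: "?J ** M = ?J"
    by (simp_all add: M_def matrix_add_mult matrix_add_ldistrib LJ JL JJ)
  have NJ: "N ** ?J = ?J" and JN: "?J ** N = ?J"
    by (metis MJ NM matrix_mul_assoc matrix_mul_lid) (metis JM MN matrix_mul_assoc matrix_mul_rid)
  have Mt: "transpose M = M"
    by (simp add: M_def transpose_add transpose_laplacian Jt)
  have Nt: "transpose N = N"
    by (metis MN Mt NM matrix_mul_assoc matrix_mul_lid matrix_mul_rid matrix_transpose_mul transpose_mat)
  define X where "X = N - ?J"
  have L: "?L = M - ?J" by (simp add: M_def)
  have LX: "?L ** X = mat 1 - ?J" and XL: "X ** ?L = mat 1 - ?J"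
    by (simp_all add: L X_def matrix_diff_mult matrix_mult_diff MN NM MJ JM NJ JN JJ)
  have Xt: "transpose X = X"
    by (simp add: X_def transpose_diff Nt Jt)
  have XJ: "?J ** X = 0"
    by (simp add: X_def matrix_mult_diff JN JJ)
  have "is_pinv ?L X"
    unfolding is_pinv_def by (simp add: LX XL matrix_diff_mult JL XJ transpose_diff Jt)
  then have "pinv ?L = X"
    by (rule pinv_eqI)
  then show "?L ** pinv ?L = mat 1 - ?J" "pinv ?L ** ?L = mat 1 - ?J" "transpose (pinv ?L) = pinv ?L"
    by (simp_all add: LX XL Xt)
qed

declare transpose_matrix_vector [simp del]

subsection \<open>The kernel of \<open>C\<close>\<close>

definition view_inner :: "('n \<Rightarrow> 'm \<Rightarrow> real^'d) \<Rightarrow> real^('m::finite \<times> 'd) \<Rightarrow> 'n \<Rightarrow> 'm \<Rightarrow> real" where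
  "view_inner x v k i = (\<Sum>p\<in>UNIV. v $ (i, p) * x k i $ p)"

lemma inner_view_embed: "v \<bullet> (view_embed i *v y) = (\<Sum>p\<in>UNIV. v $ (i, p) * y $ p)"
proof -
  have "(view_embed i *v y) $ (j, p) = (if j = i then y $ p else 0)" for j p
    by (cases "j = i")
      (simp_all add: view_embed_def stack_def matrix_vector_mult_def mat_def if_distribR if_distrib[of "\<lambda>a. a * _"] cong: if_cong)
  then have "v \<bullet> (view_embed i *v y) = (\<Sum>j\<in>UNIV. if j = i then \<Sum>p\<in>UNIV. v $ (j, p) * y $ p else 0)"
    unfolding inner_vec_def sum_UNIV_prod by (intro sum.cong) auto
  then show ?thesis by simp
qed

lemma transpose_B_mat_mult: "transpose (B_mat E x) *v v = (\<Sum>(k, i)\<in>E. view_inner x v k i *\<^sub>R edge_vec k i)"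
  unfolding B_mat_def transpose_sum case_prod_unfold transpose_outer sum_matrix_vector_mult outer_mult_vec
  by (simp add: inner_commute[of _ v] inner_view_embed view_inner_def)

lemma inner_D_mat: "u \<bullet> (D_mat E x *v v) = (\<Sum>(k, i)\<in>E. view_inner x u k i * view_inner x v k i)"
proof -
  have "(view_embed i ** outer y y ** transpose (view_embed i)) *v v = (v \<bullet> (view_embed i *v y)) *\<^sub>R (view_embed i *v y)"
    for i :: 'a and y :: "real^'b"
  proof -
    have "(view_embed i ** outer y y ** transpose (view_embed i)) *v v
        = view_embed i *v (outer y y *v (transpose (view_embed i) *v v))"
      by (simp add: matrix_vector_mul_assoc matrix_mul_assoc)
    also have "\<dots> = (y \<bullet> (transpose (view_embed i) *v v)) *\<^sub>R (view_embed i *v y)"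
      by (simp add: outer_mult_vec matrix_vector_mult_scaleR)
    also have "y \<bullet> (transpose (view_embed i) *v v) = v \<bullet> (view_embed i *v y)"
      by (simp add: dot_lmul_matrix[symmetric] inner_commute)
    finally show ?thesis .
  qed
  then show ?thesis
    unfolding D_mat_def sum_matrix_vector_mult
    by (simp add: sum_matrix_vector_mult case_prod_unfold inner_sum_right inner_view_embed view_inner_def mult.commute)
qed

lemma inner_mult_vec_left: "(A *v u) \<bullet> v = u \<bullet> (transpose A *v v)" for A :: "real^'a^'b"
  unfolding transpose_matrix_vector inner_commute[of u "v v* A"] dot_lmul_matrix by (rule inner_commute)

lemma mean_mat_inner_edge_vec: "(mean_mat *v z) \<bullet> edge_vec k i = 0"
  by (simp add: mean_mat_mult inner_edge_vec)

text \<open>The potential on the vertices that minimizes the squared residuals of a linear functional on the views.\<close>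

definition potential ::
    "('n::finite \<times> 'm::finite) set \<Rightarrow> ('n \<Rightarrow> 'm \<Rightarrow> real^'d) \<Rightarrow> real^('m \<times> 'd) \<Rightarrow> real^('n + 'm)" where
  "potential E x v = pinv (laplacian E) *v (transpose (B_mat E x) *v v)"

definition residual ::
    "('n::finite \<times> 'm::finite) set \<Rightarrow> ('n \<Rightarrow> 'm \<Rightarrow> real^'d) \<Rightarrow> real^('m \<times> 'd) \<Rightarrow> 'n \<Rightarrow> 'm \<Rightarrow> real" where
  "residual E x v k i = view_inner x v k i - potential E x v \<bullet> edge_vec k i"

context
  fixes E :: "('n::finite \<times> 'm::finite) set" and x :: "'n \<Rightarrow> 'm \<Rightarrow> real^'d"
  assumes conn: "graph_connected E"
begin

text \<open>The normal equations of the least-squares problem. The pseudoinverse solves them exactly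
  because edge vectors sum to zero, so the right-hand side is orthogonal to the constants.\<close>

lemma laplacian_potential: "laplacian E *v potential E x v = transpose (B_mat E x) *v v"
proof -
  have "(\<Sum>a\<in>UNIV. edge_vec k i $ a) = 0" for k :: 'n and i :: 'm
    by (simp add: edge_vec_def sum_subtractf axis_def)
  then have "(\<Sum>a\<in>UNIV. (transpose (B_mat E x) *v v) $ a) = 0"
    unfolding transpose_B_mat_mult
    by (simp add: case_prod_unfold sum.swap[of _ E] flip: sum_distrib_left)
  then have "mean_mat *v (transpose (B_mat E x) *v v) = 0"
    by (simp add: mean_mat_mult vec_eq_iff)
  then show ?thesis
    unfolding potential_def matrix_vector_mul_assoc[of "laplacian E"] laplacian_pinv(1)[OF conn]
    by (simp add: matrix_vector_mult_diff_rdistrib)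
qed

text \<open>By the normal equations, the two mixed terms in the product of the residuals and the
  product of the potentials all have the same sum, so the expansion collapses to the form of
  \<open>C_mat\<close>. Thus \<open>C\<close> is a Gram matrix.\<close>

lemma inner_C_mat: "u \<bullet> (C_mat E x *v v) = (\<Sum>(k, i)\<in>E. residual E x u k i * residual E x v k i)"
proof -
  let ?z = "potential E x"
  have B: "z \<bullet> (transpose (B_mat E x) *v w) = (\<Sum>(k, i)\<in>E. view_inner x w k i * (z \<bullet> edge_vec k i))" for z w
    by (simp add: transpose_B_mat_mult inner_sum_right case_prod_unfold)
  have uv: "?z u \<bullet> (transpose (B_mat E x) *v v) = (\<Sum>(k, i)\<in>E. (?z u \<bullet> edge_vec k i) * (?z v \<bullet> edge_vec k i))"
    unfolding laplacian_potential[symmetric] inner_laplacian ..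
  have vu: "?z v \<bullet> (transpose (B_mat E x) *v u) = (\<Sum>(k, i)\<in>E. (?z u \<bullet> edge_vec k i) * (?z v \<bullet> edge_vec k i))"
    unfolding laplacian_potential[symmetric] inner_laplacian by (simp add: mult.commute)
  have "u \<bullet> (C_mat E x *v v) = u \<bullet> (D_mat E x *v v) - u \<bullet> (B_mat E x *v ?z v)"
    by (simp add: C_mat_def potential_def matrix_vector_mult_diff_rdistrib inner_diff_right
        matrix_vector_mul_assoc matrix_mul_assoc)
  also have "u \<bullet> (B_mat E x *v ?z v) = ?z v \<bullet> (transpose (B_mat E x) *v u)"
    unfolding inner_commute[of u] by (rule inner_mult_vec_left)
  finally have "u \<bullet> (C_mat E x *v v) = u \<bullet> (D_mat E x *v v)
      - ?z v \<bullet> (transpose (B_mat E x) *v u) - ?z u \<bullet> (transpose (B_mat E x) *v v)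
      + (\<Sum>(k, i)\<in>E. (?z u \<bullet> edge_vec k i) * (?z v \<bullet> edge_vec k i))"
    using uv by simp
  then show ?thesis
    unfolding B inner_D_mat residual_def
    by (simp add: case_prod_unfold algebra_simps sum.distrib sum_subtractf)
qed

lemma C_mat_mult_eq_0_iff_residual: "C_mat E x *v v = 0 \<longleftrightarrow> (\<forall>(k, i)\<in>E. residual E x v k i = 0)"
proof
  assume "C_mat E x *v v = 0"
  then have "(\<Sum>(k, i)\<in>E. residual E x v k i * residual E x v k i) = 0"
    by (simp flip: inner_C_mat)
  then show "\<forall>(k, i)\<in>E. residual E x v k i = 0"
    by (subst (asm) sum_nonneg_eq_0_iff) auto
next
  assume *: "\<forall>(k, i)\<in>E. residual E x v k i = 0"
  have "(\<Sum>(k, i)\<in>E. residual E x u k i * residual E x v k i) = 0" for u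
    using * by (intro sum.neutral) auto
  then have "u \<bullet> (C_mat E x *v v) = 0" for u
    by (simp only: inner_C_mat)
  then show "C_mat E x *v v = 0"
    using inner_eq_zero_iff[of "C_mat E x *v v"] by blast
qed

lemma C_mat_psd: "v \<bullet> (C_mat E x *v v) \<ge> 0"
  unfolding inner_C_mat by (intro sum_nonneg) auto

lemma transpose_C_mat: "transpose (C_mat E x) = C_mat E x"
proof -
  have "u \<bullet> (transpose (C_mat E x) *v v) = u \<bullet> (C_mat E x *v v)" for u v
    unfolding inner_mult_vec_left[symmetric] inner_commute[of "C_mat E x *v u"] inner_C_mat
    by (rule sum.cong) auto
  then have "transpose (C_mat E x) *v v = C_mat E x *v v" for v
    using vector_eq_ldot by blast
  then show ?thesis unfolding matrix_eq by blast
qed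

text \<open>A potential that fits exactly is unique up to a constant, and the pseudoinverse selects
  the one with mean zero over all vertices.\<close>

lemma potential_eqI:
  assumes "\<And>k i. (k, i) \<in> E \<Longrightarrow> view_inner x v k i = z \<bullet> edge_vec k i"
  shows "potential E x v = z - mean_mat *v z"
proof -
  have "transpose (B_mat E x) *v v = laplacian E *v z"
    unfolding transpose_B_mat_mult laplacian_mult using assms by (intro sum.cong) auto
  then show ?thesis
    by (simp add: potential_def matrix_vector_mul_assoc laplacian_pinv(2)[OF conn] matrix_vector_mult_diff_rdistrib)
qed

end

text \<open>A common language for perfect alignments (orthogonal \<open>M i\<close>), affine
  deformations (arbitrary \<open>M i\<close>) and infinitesimal flexes (\<open>M i\<close> a skew
  matrix times the orthogonal map into the realization). The translations are left implicit because
  \<open>C\<close> sees only the linear parts.\<close>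

definition glues ::
    "('n \<times> 'm) set \<Rightarrow> ('n \<Rightarrow> 'm \<Rightarrow> real^'d) \<Rightarrow> ('m \<Rightarrow> real^'d^'e) \<Rightarrow> ('n \<Rightarrow> real^'e) \<Rightarrow> bool" where
  "glues E x M y \<longleftrightarrow> (\<exists>t. \<forall>(k, i)\<in>E. M i *v x k i = y k + t i)"

context
  fixes E :: "('n::finite \<times> 'm::finite) set" and x :: "'n \<Rightarrow> 'm \<Rightarrow> real^'d"
  assumes conn: "graph_connected E"
begin

lemma view_inner_column: "view_inner x (column c V) k i = (transpose (row_block V i) *v x k i) $ c"
  by (simp add: view_inner_def column_def transpose_def row_block_def matrix_vector_mult_def)

text \<open>The optimal potentials have mean zero over points and views together, so the centring
  over the points alone is a further shift.\<close>

lemma realization_nth: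
  "column k (realization E x V) $ c =
     potential E x (column c V) $ Inl k - (\<Sum>l\<in>UNIV. potential E x (column c V) $ Inl l) / real CARD('n)"
proof -
  let ?A = "transpose V ** B_mat E x ** (\<chi> u k. pinv (laplacian E) $ u $ Inl k)"
  have A: "?A $ c $ l = potential E x (column c V) $ Inl l" for l
  proof -
    have sym: "pinv (laplacian E) $ Inl l $ u = pinv (laplacian E) $ u $ Inl l" for u
      using arg_cong[OF laplacian_pinv(3)[OF conn], of "\<lambda>M. M $ u $ Inl l"] by (simp add: transpose_def)
    have "(transpose V ** B_mat E x) $ c $ u = (transpose (B_mat E x) *v column c V) $ u" for u
      by (simp add: matrix_matrix_mult_def matrix_vector_mult_def transpose_def column_def mult.commute)
    then have "?A $ c $ l = (\<Sum>u\<in>UNIV. (transpose (B_mat E x) *v column c V) $ u * pinv (laplacian E) $ u $ Inl l)"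
      by (simp add: matrix_matrix_mult_def[of "transpose V ** B_mat E x"])
    also have "\<dots> = potential E x (column c V) $ Inl l"
      by (simp add: potential_def matrix_vector_mult_def[of "pinv (laplacian E)"] sym mult.commute)
    finally show ?thesis .
  qed
  have "realization E x V = ?A - ?A ** mean_mat"
    by (simp add: realization_def mean_mat_def matrix_mult_diff)
  moreover have "(?A ** mean_mat) $ c $ k = (\<Sum>l\<in>UNIV. ?A $ c $ l) / real CARD('n)"
    by (simp add: matrix_matrix_mult_def[of ?A] mean_mat_def outer_def sum_divide_distrib)
  ultimately show ?thesis
    by (simp add: column_def A)
qed

lemma glues_imp:
  assumes "glues E x (\<lambda>i. transpose (row_block V i)) y"
  shows "C_mat E x ** V = 0" and "column k (realization E x V) = y k - (1 / real CARD('n)) *\<^sub>R (\<Sum>l\<in>UNIV. y l)"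
proof -
  obtain t where t: "\<And>k i. (k, i) \<in> E \<Longrightarrow> transpose (row_block V i) *v x k i = y k + t i"
    using assms by (auto simp: glues_def)
  \<comment> \<open>A view vertex carries \<open>- t i\<close>, so that the difference along an edge
    is \<open>y k + t i\<close> and the residual vanishes.\<close>
  define z where "z c = (\<chi> u. case u of Inl k \<Rightarrow> y k $ c | Inr i \<Rightarrow> - t i $ c)" for c
  have z: "view_inner x (column c V) k i = z c \<bullet> edge_vec k i" if "(k, i) \<in> E" for c k i
    using t[OF that] by (simp add: view_inner_column inner_edge_vec z_def)
  have P: "potential E x (column c V) = z c - mean_mat *v z c" for c
    by (rule potential_eqI[OF conn z])
  have "C_mat E x *v column c V = 0" for c
    unfolding C_mat_mult_eq_0_iff_residual[OF conn] residual_def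
    by (auto simp: z P inner_diff_left mean_mat_inner_edge_vec)
  then show "C_mat E x ** V = 0"
    by (simp add: matrix_eq_columns column_matrix_mult)
  show "column k (realization E x V) = y k - (1 / real CARD('n)) *\<^sub>R (\<Sum>l\<in>UNIV. y l)"
    by (simp add: vec_eq_iff realization_nth P mean_mat_mult z_def sum_subtractf diff_divide_distrib)
qed

text \<open>Zero residuals mean that the potentials glue the maps exactly; recentring only changes
  the translations of the views.\<close>

lemma glues_realization:
  assumes "C_mat E x ** V = 0"
  shows "glues E x (\<lambda>i. transpose (row_block V i)) (\<lambda>k. column k (realization E x V))"
proof -
  let ?z = "\<lambda>c. potential E x (column c V)"
  let ?m = "\<lambda>c. (\<Sum>l\<in>UNIV. ?z c $ Inl l) / real CARD('n)"
  have "C_mat E x *v column c V = 0" for c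
    using assms by (simp flip: column_matrix_mult)
  then have "view_inner x (column c V) k i = ?z c \<bullet> edge_vec k i" if "(k, i) \<in> E" for c k i
    using that unfolding C_mat_mult_eq_0_iff_residual[OF conn] residual_def by fastforce
  then have "transpose (row_block V i) *v x k i = column k (realization E x V) + (\<chi> c. ?m c - ?z c $ Inr i)"
    if "(k, i) \<in> E" for k i
    using that by (simp add: vec_eq_iff realization_nth inner_edge_vec flip: view_inner_column)
  then show ?thesis
    unfolding glues_def by (intro exI[of _ "\<lambda>i. \<chi> c. ?m c - ?z c $ Inr i"]) auto
qed

lemma align_cost_eq: "align_cost E x V = (C_mat E x ** V) \<bullet> V"
proof -
  have "align_cost E x V = trace (transpose (transpose (C_mat E x ** V)) ** transpose V)"
    by (simp add: align_cost_def)
  then show ?thesis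
    unfolding trace_transpose_mult inner_transpose .
qed

lemma align_cost_columns: "align_cost E x V = (\<Sum>c\<in>UNIV. column c V \<bullet> (C_mat E x *v column c V))"
  unfolding align_cost_eq inner_columns column_matrix_mult by (simp add: inner_commute)

lemma align_cost_nonneg: "align_cost E x V \<ge> 0"
  unfolding align_cost_columns by (intro sum_nonneg C_mat_psd[OF conn])

text \<open>The cost is a sum of semidefinite forms, one per column; if it vanishes, so does every
  residual.\<close>

lemma align_cost_eq_0_iff: "align_cost E x V = 0 \<longleftrightarrow> C_mat E x ** V = 0"
proof
  assume "align_cost E x V = 0"
  then have *: "column c V \<bullet> (C_mat E x *v column c V) = 0" for c
    unfolding align_cost_columns by (subst (asm) sum_nonneg_eq_0_iff) (auto intro: C_mat_psd[OF conn])
  have "C_mat E x *v column c V = 0" for c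
    using *[of c] unfolding inner_C_mat[OF conn] C_mat_mult_eq_0_iff_residual[OF conn]
    by (subst (asm) sum_nonneg_eq_0_iff) auto
  then show "C_mat E x ** V = 0"
    by (simp add: matrix_eq_columns column_matrix_mult)
qed (simp add: align_cost_eq)

lemma perfect_alignment_iff: "perfect_alignment E x V \<longleftrightarrow> V \<in> alignments \<and> C_mat E x ** V = 0"
  by (simp add: perfect_alignment_def align_cost_eq_0_iff)

end

subsection \<open>Rank conditions\<close>

lemma rank_add_nullity: "rank A + dim {v. A *v v = 0} = CARD('a)" for A :: "real^'a^'b"
proof -
  have "rows A = range (\<lambda>i. A $ i)"
    by (auto simp: rows_def row_def vec_lambda_eta)
  moreover have "A *v v = 0 \<longleftrightarrow> (\<forall>i. A $ i \<bullet> v = 0)" for v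
    by (simp add: matrix_mult_dot vec_eq_iff)
  moreover have "(\<forall>r\<in>rows A. r \<bullet> v = 0) \<longleftrightarrow> (\<forall>r\<in>span (rows A). orthogonal r v)" for v
    using orthogonal_to_span[of _ "rows A" v] span_superset[of "rows A"]
    by (auto simp: orthogonal_def inner_commute)
  ultimately have "{v. A *v v = 0} = {v \<in> UNIV. \<forall>r\<in>span (rows A). orthogonal r v}"
    by auto
  then show ?thesis
    using dim_subspace_orthogonal_to_vectors[of "span (rows A)" UNIV] by (simp add: row_rank_def)
qed

lemma subspace_kernel: "subspace {v. A *v v = 0}" for A :: "real^'a^'b"
  by (intro linear_subspace_kernel) simp

lemma subspace_dim_eq_iff:
  fixes U V :: "'a::euclidean_space set"
  assumes "subspace U" "subspace V" "U \<subseteq> V"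
  shows "dim V = dim U \<longleftrightarrow> V \<subseteq> U"
  using subspace_dim_equal[OF assms] assms(3) by auto

lemma stack_mult: "stack f ** Q = stack (\<lambda>i. f i ** Q)"
  by (rule row_block_eqI) (simp add: row_block_mult)

lemma alignment_inj:
  assumes "S \<in> alignments" "S *v w = 0" shows "w = 0"
proof -
  have "row_block S i *v w = 0" for i
    using assms(2) by (simp add: vec_eq_iff row_block_def matrix_vector_mult_def)
  then have "transpose (row_block S i) *v (row_block S i *v w) = 0" for i
    by simp
  then show ?thesis
    using assms(1) by (simp add: alignments_def matrix_vector_mul_assoc orthogonal_matrix_def)
qed

text \<open>The kernel always contains the column space of \<open>S\<close>, of dimension
  \<open>d\<close> because the blocks of \<open>S\<close> are invertible. The rank condition says
  that it contains nothing else.\<close>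

lemma rank_C_mat_iff:
  fixes E :: "('n::finite \<times> 'm::finite) set" and x :: "'n \<Rightarrow> 'm \<Rightarrow> real^'d"
  assumes "S \<in> alignments" "C_mat E x ** S = 0"
  shows "rank (C_mat E x) = (CARD('m) - 1) * CARD('d) \<longleftrightarrow> (\<forall>v. C_mat E x *v v = 0 \<longrightarrow> (\<exists>w. v = S *v w))"
proof -
  let ?K = "{v. C_mat E x *v v = 0}"
  have "{w. S *v w = 0} = {0}"
    using alignment_inj[OF assms(1)] by auto
  then have "dim (range ((*v) S)) = CARD('d)"
    using rank_add_nullity[of S] by (simp add: rank_dim_range)
  moreover have "range ((*v) S) \<subseteq> ?K"
    using assms(2) by (auto simp: matrix_vector_mul_assoc)
  moreover have "subspace (range ((*v) S))"
    by (intro linear_subspace_image) simp_all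
  ultimately have "dim ?K = CARD('d) \<longleftrightarrow> ?K \<subseteq> range ((*v) S)"
    using subspace_dim_eq_iff[OF _ subspace_kernel] by metis
  moreover have "rank (C_mat E x) = (CARD('m) - 1) * CARD('d) \<longleftrightarrow> dim ?K = CARD('d)"
  proof -
    have "(CARD('m) - 1) * CARD('d) + CARD('d) = CARD('m) * CARD('d)"
      by (metis Suc_pred' add.commute mult_Suc zero_less_card_finite)
    then show ?thesis
      using rank_add_nullity[of "C_mat E x"] by simp linarith
  qed
  ultimately show ?thesis by auto
qed

text \<open>The stacks of \<open>S\<^sub>i X\<^sub>i\<close> with skew \<open>X\<^sub>i\<close> form
  the tangent space of the product of orthogonal groups at \<open>S\<close>; equal
  \<open>X\<^sub>i\<close> are the directions along the orbit of right multiplication. This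
  predicate links condition (2), infinitesimal rigidity and convergence.\<close>

definition skew_flex_trivial ::
    "('n::finite \<times> 'm::finite) set \<Rightarrow> ('n \<Rightarrow> 'm \<Rightarrow> real^'d) \<Rightarrow> real^'d^('m \<times> 'd) \<Rightarrow> bool" where
  "skew_flex_trivial E x S \<longleftrightarrow>
     (\<forall>X. (\<forall>i. transpose (X i) = - X i) \<and> C_mat E x ** stack (\<lambda>i. row_block S i ** X i) = 0 \<longrightarrow>
        (\<forall>i j. X i = X j))"

section \<open>Skew tuples as coordinates for \<open>L_bb\<close>\<close>

lemma card_less_pairs: "2 * card {(r, s). r < (s::'d::{finite,linorder})} = CARD('d) * (CARD('d) - 1)"
proof -
  let ?U = "{(r, s). r < (s::'d)}" and ?L = "{(r, s). s < (r::'d)}" and ?D = "range (\<lambda>r::'d. (r, r))"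
  have L: "?L = prod.swap ` ?U" by (auto simp: image_iff)
  have cL: "card ?L = card ?U"
    unfolding L by (rule card_image) simp
  have cD: "card ?D = CARD('d)" by (rule card_image) (simp add: inj_on_def)
  have "CARD('d \<times> 'd) = card ((?U \<union> ?L) \<union> ?D)"
    by (rule arg_cong[of _ _ card]) (auto simp: neq_iff)
  also have "\<dots> = card (?U \<union> ?L) + card ?D" by (rule card_Un_disjoint) auto
  also have "card (?U \<union> ?L) = card ?U + card ?L" by (rule card_Un_disjoint) auto
  finally have "2 * card ?U + CARD('d) = CARD('d) * CARD('d)"
    using cL cD by simp
  then show ?thesis
    by (simp add: diff_mult_distrib2)
qed

text \<open>Decodes the padded index of \<open>L_bb\<close>: coordinate \<open>(s, (r, i))\<close>
  with \<open>r < s\<close> is the entry at \<open>(r, s)\<close>, above the diagonal, of the skew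
  matrix of view \<open>i\<close>. Padding coordinates are ignored.\<close>

definition skew_tuple :: "real^('d::_ \<times> ('d \<times> 'm::finite)) \<Rightarrow> 'm \<Rightarrow> real^'d::{finite,linorder}^'d::_" where
  "skew_tuple w i = (\<chi> p q. if p < q then w $ (q, (p, i)) else if q < p then - (w $ (p, (q, i))) else 0)"

lemma transpose_skew_tuple: "transpose (skew_tuple w i) = - skew_tuple w i"
  by (auto simp: skew_tuple_def transpose_def vec_eq_iff)

lemma sum_sum_delta:
  "(\<Sum>s\<in>UNIV. \<Sum>r\<in>UNIV. if s = a then (if r = b then c else 0) else 0) = c"
  for a b :: "'a::finite" and c :: "'b::comm_monoid_add"
proof -
  have "(\<Sum>r\<in>UNIV. if s = a then (if r = b then c else 0) else 0) = (if s = a then c else 0)" for s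
    by simp
  then show ?thesis by simp
qed

text \<open>So \<open>transpose Pbar\<close> vectorizes skew tuples, and \<open>L_bb\<close> is the
  form of \<open>L_cal\<close> compressed to them.\<close>

lemma transpose_Pbar_mult: "(transpose Pbar *v w) $ (q, (p, j)) = skew_tuple w j $ p $ q"
proof -
  have "(transpose Pbar *v w) $ (q, (p, j)) =
      (\<Sum>s\<in>UNIV. \<Sum>r\<in>UNIV. \<Sum>i\<in>UNIV. Pbar $ (s, (r, i)) $ (q, (p, j)) * w $ (s, (r, i)))"
    by (simp add: matrix_vector_mult_def transpose_def sum_UNIV_prod)
  also have "\<dots> = (\<Sum>s\<in>UNIV. \<Sum>r\<in>UNIV. \<Sum>i\<in>UNIV. if i = j then
      (if s = q then (if r = p then (if p < q then w $ (q, (p, j)) else 0) else 0) else 0)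
      + (if s = p then (if r = q then (if q < p then - (w $ (p, (q, j))) else 0) else 0) else 0) else 0)"
    by (intro sum.cong refl) (auto simp: Pbar_def)
  also have "\<dots> = (\<Sum>s\<in>UNIV. \<Sum>r\<in>UNIV.
      (if s = q then (if r = p then (if p < q then w $ (q, (p, j)) else 0) else 0) else 0)
      + (if s = p then (if r = q then (if q < p then - (w $ (p, (q, j))) else 0) else 0) else 0))"
    unfolding sum.delta[OF finite] by simp
  also have "\<dots> = skew_tuple w j $ p $ q"
    unfolding sum.distrib sum_sum_delta by (auto simp: skew_tuple_def)
  finally show ?thesis .
qed

lemma block_diag_stack: "block_diag f ** stack g = stack (\<lambda>i. f i ** g i)"
proof -
  have "(\<Sum>k\<in>UNIV. \<Sum>r\<in>UNIV. (if i = k then f i $ p $ r else 0) * g k $ r $ q) = (\<Sum>r\<in>UNIV. f i $ p $ r * g i $ r $ q)"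
    for i p q by (subst sum.swap) (simp add: if_distrib[of "\<lambda>a. a * _"] cong: if_cong)
  then show ?thesis
    by (simp add: vec_eq_iff matrix_matrix_mult_def block_diag_def stack_def sum_UNIV_prod cong: if_cong)
qed

text \<open>The block row sums of \<open>C(S)\<close> are the blocks of
  \<open>blockdiag(S)\<^sup>T C S\<close>, which is zero. Hence \<open>L(S)\<close> is just
  \<open>C(S)\<close> at a perfect alignment.\<close>

lemma C_hat_perfect:
  assumes "C_mat E x ** S = 0"
  shows "C_hat E x S = 0"
proof -
  have "block_diag (row_block S) ** stack (\<lambda>_. mat 1) = S"
    by (simp add: block_diag_stack)
  then have "C_at E x S ** stack (\<lambda>_. mat 1) = 0"
    using assms by (simp add: C_at_def flip: matrix_mul_assoc)
  moreover have "(C_at E x S ** stack (\<lambda>_. mat 1)) $ (i, p) $ q = (\<Sum>j\<in>UNIV. mat_block (C_at E x S) i j) $ p $ q" for i p q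
    by (simp add: matrix_matrix_mult_def stack_def sum_UNIV_prod mat_def mat_block_def if_distrib[of "\<lambda>a. _ * a"] cong: if_cong)
  ultimately have "(\<Sum>j\<in>UNIV. mat_block (C_at E x S) i j) = 0" for i
    by (simp add: vec_eq_iff)
  then show ?thesis
    by (simp add: C_hat_def block_diag_def vec_eq_iff)
qed

lemma kron_mat_1_mult: "(kron (mat 1) A *v u) $ (q, a) = (A ** (\<chi> b q. u $ (q, b))) $ a $ q"
proof -
  have "(kron (mat 1) A *v u) $ (q, a) = (\<Sum>q'\<in>UNIV. if q = q' then (\<Sum>b\<in>UNIV. A $ a $ b * u $ (q, b)) else 0)"
    unfolding matrix_vector_mult_def kron_def sum_UNIV_prod vec_lambda_beta fst_conv snd_conv
    by (intro sum.cong refl) (auto simp: mat_def)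
  then show ?thesis by (simp add: matrix_matrix_mult_def)
qed

lemma transpose_P_mat_mult: "transpose P_mat ** (\<chi> a q. X (snd a) $ fst a $ q) = stack X"
proof -
  have "(\<Sum>r\<in>UNIV. \<Sum>j\<in>UNIV. (if r = p \<and> j = i then 1 else 0) * X j $ r $ q) = X i $ p $ q" for p i q
    by (subst sum.cong[OF refl, where h = "\<lambda>r. if r = p then X i $ p $ q else 0"])
       (auto simp: if_distrib[of "\<lambda>a. a * _"] cong: if_cong)
  then show ?thesis
    by (simp add: vec_eq_iff matrix_matrix_mult_def P_mat_def transpose_def sum_UNIV_prod stack_def)
qed

context
  fixes E :: "('n::finite \<times> 'm::{finite,linorder}) set" and x :: "'n \<Rightarrow> 'm \<Rightarrow> real^'d::{finite,linorder}"
    and S :: "real^'d::_^('m \<times> 'd)"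
  assumes conn: "graph_connected E" and perfect: "S \<in> alignments" "C_mat E x ** S = 0"
begin

text \<open>The quadratic form of \<open>L_bb\<close> at \<open>w\<close> is the cost of the stack
  \<open>V\<close>. For a compression by \<open>Pbar\<close>, a kernel vector gives in general only
  a vanishing projection; semidefiniteness of the cost upgrades this to
  \<open>C V = 0\<close>.\<close>

lemma L_bb_kernel:
  "L_bb E x S *v w = 0 \<longleftrightarrow> C_mat E x ** stack (\<lambda>i. row_block S i ** skew_tuple w i) = 0"
proof -
  define U :: "real^'d::_^('d \<times> 'm)" where "U = (\<chi> a q. skew_tuple w (snd a) $ fst a $ q)"
  define u where "u = transpose Pbar *v w"
  define V where "V = stack (\<lambda>i. row_block S i ** skew_tuple w i)"
  let ?bd = "block_diag (row_block S)"
  have uU: "U $ a $ q = u $ (q, a)" for a q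
    by (cases a) (simp add: U_def u_def transpose_Pbar_mult)
  have PU: "?bd ** (transpose P_mat ** U) = V"
    unfolding U_def transpose_P_mat_mult V_def block_diag_stack ..
  have "L_cal E x S ** U = P_mat ** transpose ?bd ** C_mat E x ** (?bd ** (transpose P_mat ** U))"
    unfolding L_cal_def L_mat_def C_hat_perfect[OF perfect(2)] C_at_def by (simp add: matrix_mul_assoc)
  then have LU: "L_cal E x S ** U = P_mat ** transpose ?bd ** (C_mat E x ** V)"
    unfolding PU by (simp add: matrix_mul_assoc)
  have UM: "(\<chi> b q. u $ (q, b)) = U" by (simp add: vec_eq_iff uU)
  have K: "(kron (mat 1) (L_cal E x S) *v u) $ (q, a) = (L_cal E x S ** U) $ a $ q" for q a
    by (simp add: kron_mat_1_mult UM)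
  have L: "L_bb E x S *v w = Pbar *v (kron (mat 1) (L_cal E x S) *v u)"
    by (simp add: L_bb_def u_def matrix_vector_mul_assoc matrix_mul_assoc)
  show ?thesis unfolding V_def[symmetric]
  proof
    assume "L_bb E x S *v w = 0"
    then have "0 = (Pbar *v (kron (mat 1) (L_cal E x S) *v u)) \<bullet> w"
      by (simp add: L)
    also have "\<dots> = (kron (mat 1) (L_cal E x S) *v u) \<bullet> u"
      by (simp add: inner_mult_vec_left u_def)
    also have "\<dots> = (\<Sum>q\<in>UNIV. \<Sum>a\<in>UNIV. (L_cal E x S ** U) $ a $ q * U $ a $ q)"
      unfolding inner_vec_def sum_UNIV_prod[where 'a='d and 'b="'d \<times> 'm"] K uU by simp
    also have "\<dots> = (L_cal E x S ** U) \<bullet> U"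
      unfolding inner_matrix_eq by (rule sum.swap)
    also have "\<dots> = (C_mat E x ** V) \<bullet> (transpose (P_mat ** transpose ?bd) ** U)"
      unfolding LU by (rule inner_matrix_mult_left)
    also have "transpose (P_mat ** transpose ?bd) ** U = V"
      unfolding PU[symmetric] by (simp add: matrix_transpose_mul matrix_mul_assoc)
    finally show "C_mat E x ** V = 0"
      by (metis align_cost_eq align_cost_eq_0_iff conn)
  next
    assume "C_mat E x ** V = 0"
    then have "kron (mat 1) (L_cal E x S) *v u = 0"
      unfolding vec_eq_iff[of "kron _ _ *v u"] using K LU by (simp add: split_paired_all)
    then show "L_bb E x S *v w = 0" by (simp add: L)
  qed
qed

text \<open>\<open>K0\<close> collects the trivial flexes together with the padding coordinates. It
  always lies in the kernel \<open>K\<close>, and a dimension count turns the rank condition into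
  \<open>K = K0\<close>.\<close>

lemma rank_L_bb_iff:
  "rank (L_bb E x S) = (CARD('m) - 1) * CARD('d) * (CARD('d) - 1) div 2 \<longleftrightarrow> skew_flex_trivial E x S"
proof -
  define K where "K = {w. L_bb E x S *v w = 0}"
  define K0 :: "(real^('d \<times> ('d \<times> 'm))) set"
    where "K0 = {w. \<forall>r s. r < s \<longrightarrow> (\<forall>i j. w $ (s, (r, i)) = w $ (s, (r, j)))}"
  \<comment> \<open>The free coordinates of \<open>K0\<close>: the padding, and for
    \<open>r < s\<close> the entry of the first view, which determines those of the other
    views.\<close>
  define J where "J = {(s :: 'd, (r :: 'd, i :: 'm)). \<not> (r < s \<and> i \<noteq> first_view)}"
  have subK0: "subspace K0"
    unfolding K0_def subspace_def by (auto; metis)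
  have subK: "subspace K"
    unfolding K_def by (rule subspace_kernel)
  have K0K: "K0 \<subseteq> K"
  proof
    fix w assume "w \<in> K0"
    then have "skew_tuple w i = skew_tuple w first_view" for i
      unfolding K0_def skew_tuple_def vec_eq_iff by (auto; metis)
    then have "row_block S i ** skew_tuple w i = row_block S i ** skew_tuple w first_view" for i
      by (rule arg_cong)
    then have "stack (\<lambda>i. row_block S i ** skew_tuple w i) = S ** skew_tuple w first_view"
      by (intro row_block_eqI) (simp only: row_block_mult row_block_stack)
    then have "C_mat E x ** stack (\<lambda>i. row_block S i ** skew_tuple w i) = 0"
      using perfect(2) by (simp add: matrix_mul_assoc)
    then show "w \<in> K" by (simp add: K_def L_bb_kernel)
  qed
  have dimK0: "dim K0 = card J"
  proof -
    \<comment> \<open>Reading off the free coordinates is an isomorphism of \<open>K0\<close> onto a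
      coordinate subspace, whose dimension is known.\<close>
    define \<phi> :: "real^('d \<times> ('d \<times> 'm)) \<Rightarrow> real^('d \<times> ('d \<times> 'm))"
      where "\<phi> w = (\<chi> j. if j \<in> J then w $ j else 0)" for w
    have lin: "linear \<phi>"
      by (auto simp: \<phi>_def linear_iff vec_eq_iff)
    have ker0: "w = 0" if "w \<in> K0" "\<phi> w = 0" for w
      proof -
        have w0: "w $ j = 0" if "j \<in> J" for j
          using arg_cong[OF \<open>\<phi> w = 0\<close>, of "\<lambda>v. v $ j"] that by (simp add: \<phi>_def)
        have "w $ (s, (r, i)) = 0" for s r i
        proof (cases "(s, (r, i)) \<in> J")
          case True then show ?thesis by (rule w0)
        next
          case False
          then have "r < s" by (simp add: J_def)
          then have "w $ (s, (r, i)) = w $ (s, (r, first_view))"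
            using that(1) by (auto simp: K0_def)
          moreover have "(s, (r, first_view)) \<in> J" by (simp add: J_def)
          ultimately show ?thesis by (simp add: w0)
        qed
        then show ?thesis by (auto simp: vec_eq_iff)
      qed
    have inj: "inj_on \<phi> (span K0)"
    proof (rule inj_onI)
      fix v w assume "v \<in> span K0" "w \<in> span K0" "\<phi> v = \<phi> w"
      then have "v - w \<in> K0" "\<phi> (v - w) = 0"
        using span_eq_iff[THEN iffD2, OF subK0] subK0 by (auto simp: subspace_diff linear_diff[OF lin])
      then show "v = w" using ker0 by fastforce
    qed
    have "\<phi> ` K0 = {w. \<forall>j. j \<notin> J \<longrightarrow> w $ j = 0}"
    proof (intro equalityI subsetI)
      fix w :: "real^('d \<times> ('d \<times> 'm))" assume w: "w \<in> {w. \<forall>j. j \<notin> J \<longrightarrow> w $ j = 0}"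
      define w' :: "real^('d \<times> ('d \<times> 'm))"
        where "w' = (\<chi> j. if j \<in> J then w $ j else w $ (fst j, (fst (snd j), first_view)))"
      have "w' \<in> K0"
        unfolding K0_def by (auto simp: w'_def J_def)
      moreover have "\<phi> w' = w"
        using w by (auto simp: \<phi>_def w'_def vec_eq_iff)
      ultimately show "w \<in> \<phi> ` K0" by blast
    qed (auto simp: \<phi>_def)
    then have "dim (\<phi> ` K0) = card J"
      using dim_substandard_cart[of J, where 'a = real] by (simp only: dim_vec_eq)
    moreover have "dim (\<phi> ` K0) = dim K0"
      by (rule dim_image_eq[OF lin inj])
    ultimately show ?thesis by simp
  qed
  have cardJ: "card J + (CARD('m) - 1) * CARD('d) * (CARD('d) - 1) div 2 = CARD('d \<times> ('d \<times> 'm))"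
  proof -
    let ?P = "{(r, s). r < (s::'d)}"
    have "- J = (\<lambda>((r, s), i). (s, (r, i))) ` (?P \<times> (UNIV - {first_view}))"
      by (auto simp: J_def image_iff)
    moreover have "inj_on (\<lambda>((r, s), i). (s, (r, i))) (?P \<times> (UNIV - {first_view :: 'm}))"
      by (auto simp: inj_on_def)
    ultimately have "card (- J) = card ?P * (CARD('m) - 1)"
      by (simp add: card_image card_cartesian_product card_Diff_singleton)
    moreover have "(CARD('m) - 1) * CARD('d) * (CARD('d) - 1) = (card ?P * (CARD('m) - 1)) * 2"
      unfolding mult.assoc[of _ "CARD('d)"] card_less_pairs[where 'd='d, symmetric] by simp
    then have "(CARD('m) - 1) * CARD('d) * (CARD('d) - 1) div 2 = card ?P * (CARD('m) - 1)"
      by (simp only: nonzero_mult_div_cancel_right)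
    moreover have "card J + card (- J) = CARD('d \<times> ('d \<times> 'm))"
      by (subst card_Un_disjoint[symmetric]) (auto simp: Compl_partition)
    ultimately show ?thesis by (simp only:)
  qed
  have "rank (L_bb E x S) + dim K = CARD('d \<times> ('d \<times> 'm))"
    unfolding K_def by (rule rank_add_nullity)
  then have "rank (L_bb E x S) = (CARD('m) - 1) * CARD('d) * (CARD('d) - 1) div 2 \<longleftrightarrow> dim K = dim K0"
    using cardJ dimK0 by linarith
  also have "\<dots> \<longleftrightarrow> K \<subseteq> K0"
    by (rule subspace_dim_eq_iff[OF subK0 subK K0K])
  also have "\<dots> \<longleftrightarrow> skew_flex_trivial E x S"
  proof
    assume KK: "K \<subseteq> K0"
    show "skew_flex_trivial E x S"
      unfolding skew_flex_trivial_def
    proof (intro allI impI, elim conjE)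
      fix X :: "'m \<Rightarrow> real^'d::_^'d::_" and i j
      assume skew: "\<forall>i. transpose (X i) = - X i" and C: "C_mat E x ** stack (\<lambda>i. row_block S i ** X i) = 0"
      define w :: "real^('d \<times> ('d \<times> 'm))" where "w = (\<chi> a. X (snd (snd a)) $ fst (snd a) $ fst a)"
      have sk: "X i $ p $ q = - (X i $ q $ p)" for i p q
        using arg_cong[OF skew[rule_format, of i], of "\<lambda>M. M $ q $ p"] unfolding transpose_def by simp
      have diag: "X i $ p $ p = 0" for i p using sk[of i p p] by simp
      have "skew_tuple w i $ p $ q = X i $ p $ q" for i p q
        by (cases p q rule: linorder_cases) (use sk[of i p q] in \<open>simp_all add: skew_tuple_def w_def diag\<close>)
      then have X: "skew_tuple w i = X i" for i
        by (simp only: vec_eq_iff) simp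
      have "w \<in> K0"
        using KK C by (auto simp: K_def L_bb_kernel X)
      then have "w $ (q, (p, i)) = w $ (q, (p, j))" if "p < q" for p q
        using that unfolding K0_def by blast
      then show "X i = X j"
        unfolding X[symmetric] skew_tuple_def by (simp add: vec_eq_iff)
    qed
  next
    assume triv: "skew_flex_trivial E x S"
    show "K \<subseteq> K0"
    proof
      fix w assume "w \<in> K"
      then have eq: "skew_tuple w i = skew_tuple w j" for i j
        using triv transpose_skew_tuple[of w] unfolding skew_flex_trivial_def K_def L_bb_kernel by blast
      show "w \<in> K0"
        unfolding K0_def
      proof (intro CollectI allI impI)
        fix r s :: 'd and i j assume "r < s"
        then show "w $ (s, (r, i)) = w $ (s, (r, j))"
          using arg_cong[OF eq[of i j], of "\<lambda>M. M $ r $ s"] by (simp add: skew_tuple_def)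
      qed
    qed
  qed
  finally show ?thesis .
qed

end

subsection \<open>Non-degenerate views\<close>

text \<open>A nonzero functional that is constant on the view would place it in a hyperplane, of
  affine dimension \<open>d - 1\<close>. Every later use of the affine dimension of a view goes
  through this.\<close>

lemma nondegenerate_inner:
  fixes x :: "'n::finite \<Rightarrow> 'm::finite \<Rightarrow> real^'d"
  assumes "affinely_nondegenerate E x i" and "\<And>k. (k, i) \<in> E \<Longrightarrow> u \<bullet> x k i = c"
  shows "u = 0"
proof (rule ccontr)
  assume "u \<noteq> 0"
  have "{x k i | k. (k, i) \<in> E} \<subseteq> {y. u \<bullet> y = c}"
    using assms(2) by auto
  then have "aff_dim {x k i | k. (k, i) \<in> E} \<le> aff_dim {y. u \<bullet> y = c}"
    by (rule aff_dim_subset)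
  also have "\<dots> = int CARD('d) - 1"
    using \<open>u \<noteq> 0\<close> by simp
  finally show False
    using assms(1) by (simp add: affinely_nondegenerate_def)
qed

lemma nondegenerate_mult:
  fixes x :: "'n::finite \<Rightarrow> 'm::finite \<Rightarrow> real^'d"
  assumes "affinely_nondegenerate E x i" and "\<And>k. (k, i) \<in> E \<Longrightarrow> M *v x k i = t"
  shows "M = 0"
proof -
  have "M $ c = 0" for c
    by (rule nondegenerate_inner[OF assms(1), of _ "t $ c"])
       (simp add: matrix_mult_dot flip: assms(2))
  then show ?thesis by (simp add: vec_eq_iff)
qed

lemma nondegenerate_obtain:
  fixes x :: "'n::finite \<Rightarrow> 'm::finite \<Rightarrow> real^'d"
  assumes "affinely_nondegenerate E x i"
  obtains k where "(k, i) \<in> E"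
proof -
  have "card {k. (k, i) \<in> E} \<noteq> 0"
    using assms unfolding affinely_nondegenerate_def by linarith
  then have "{k. (k, i) \<in> E} \<noteq> {}" by (metis card.empty)
  then show ?thesis using that by auto
qed

section \<open>Spanning sets; interpolation by skew and orthogonal maps\<close>

lemma span_UNIV_I:
  fixes A :: "'a::euclidean_space set"
  assumes "\<And>u. (\<And>a. a \<in> A \<Longrightarrow> u \<bullet> a = 0) \<Longrightarrow> u = 0"
  shows "span A = UNIV"
proof (rule ccontr)
  assume "span A \<noteq> UNIV"
  then obtain u where "u \<noteq> 0" "span A \<subseteq> {x. u \<bullet> x = 0}"
    using span_not_univ_subset_hyperplane by blast
  then show False
    using assms[of u] span_superset by blast
qed

lemma nondegenerate_span:
  fixes x :: "'n::finite \<Rightarrow> 'm::finite \<Rightarrow> real^'d"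
  assumes "affinely_nondegenerate E x i"
    and y: "\<And>k. (k, i) \<in> E \<Longrightarrow> y k = Q *v x k i + t" "orthogonal_matrix Q" and k0: "(k0, i) \<in> E"
  shows "span ((\<lambda>k. y k - y k0) ` {k. (k, i) \<in> E}) = UNIV"
proof (rule span_UNIV_I)
  fix u assume u: "a \<in> (\<lambda>k. y k - y k0) ` {k. (k, i) \<in> E} \<Longrightarrow> u \<bullet> a = 0" for a
  have "(transpose Q *v u) \<bullet> x k i = (transpose Q *v u) \<bullet> x k0 i" if "(k, i) \<in> E" for k
  proof -
    have "u \<bullet> (Q *v (x k i - x k0 i)) = 0"
      using u[of "y k - y k0"] that k0 by (auto simp: y(1) matrix_vector_mult_diff_distrib)
    then show ?thesis
      by (simp add: inner_mult_vec_left matrix_vector_mult_diff_distrib inner_diff_right)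
  qed
  then have "transpose Q *v u = 0"
    by (rule nondegenerate_inner[OF assms(1)])
  then have "Q *v (transpose Q *v u) = 0" by simp
  then show "u = 0"
    using y(2) by (simp add: matrix_vector_mul_assoc orthogonal_matrix_def)
qed

text \<open>A basis is selected among the vectors \<open>a k\<close> and the linear map is
  prescribed there. Agreement is claimed on \<open>B\<close> only; the skew and orthogonal versions
  extend it to \<open>K\<close> by means of inner products.\<close>

lemma linear_interpolation:
  fixes a b :: "'k \<Rightarrow> real^'d"
  assumes "span (a ` K) = UNIV"
  obtains B M where "B \<subseteq> K" "span (a ` B) = UNIV" "\<And>k. k \<in> B \<Longrightarrow> b k = M *v a k"
proof -
  obtain B0 where B0: "B0 \<subseteq> a ` K" "independent B0" "a ` K \<subseteq> span B0"
    using maximal_independent_subset by blast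
  have "\<forall>v\<in>B0. \<exists>k\<in>K. a k = v" using B0(1) by auto
  then obtain \<kappa> where \<kappa>: "\<And>v. v \<in> B0 \<Longrightarrow> \<kappa> v \<in> K \<and> a (\<kappa> v) = v"
    by metis
  from linear_independent_extend[OF B0(2), of "\<lambda>v. b (\<kappa> v)"]
  obtain g where g: "linear g" "\<forall>v\<in>B0. g v = b (\<kappa> v)" by blast
  show ?thesis
  proof
    show "\<kappa> ` B0 \<subseteq> K" using \<kappa> by auto
    have "a ` \<kappa> ` B0 = B0" using \<kappa> by (force simp: image_iff)
    then show "span (a ` \<kappa> ` B0) = UNIV"
      using span_mono[OF B0(3)] assms by (simp add: span_span top_le)
    show "b k = matrix g *v a k" if "k \<in> \<kappa> ` B0" for k
      using that \<kappa> g(2) by (auto simp: matrix_works[OF linear_matrix_vector_mul_eq[THEN iffD2, OF g(1)]])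
  qed
qed

lemma bilinear_span:
  fixes P Q :: "real^'d^'e"
  assumes "\<And>u v. u \<in> U \<Longrightarrow> v \<in> V \<Longrightarrow> u \<bullet> (P *v v) = u \<bullet> (Q *v v)" "span U = UNIV" "span V = UNIV"
  shows "P = Q"
proof -
  have "u \<bullet> (P *v v) = u \<bullet> (Q *v v)" if "v \<in> V" for u v
  proof -
    have "u \<in> span U" using assms by auto
    then show ?thesis
      by (induction rule: span_induct_alt) (use assms(1) that in \<open>auto simp: inner_add_left\<close>)
  qed
  then have *: "P *v v = Q *v v" if "v \<in> V" for v
    using that vector_eq_ldot by blast
  have "P *v v = Q *v v" for v
  proof -
    have "v \<in> span V" using assms by auto
    then show ?thesis
      by (induction rule: span_induct_alt) (auto simp: * matrix_vector_right_distrib matrix_vector_mult_scaleR)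
  qed
  then show ?thesis by (simp add: matrix_eq)
qed

lemma vector_eq_span:
  fixes u v :: "real^'d"
  assumes "\<And>a. a \<in> A \<Longrightarrow> a \<bullet> u = a \<bullet> v" "span A = UNIV"
  shows "u = v"
proof -
  have "w \<bullet> u = w \<bullet> v" for w
  proof -
    have "w \<in> span A" using assms by auto
    then show ?thesis
      by (induction rule: span_induct_alt) (use assms(1) in \<open>auto simp: inner_add_left\<close>)
  qed
  then show ?thesis using vector_eq_ldot by blast
qed

text \<open>Skewness of the interpolating matrix need only be tested on basis vectors. For the
  remaining \<open>k\<close>, the relations with the basis determine every
  \<open>a l \<bullet> b k\<close>, hence \<open>b k\<close>.\<close>

lemma skew_interpolation:
  fixes a b :: "'k \<Rightarrow> real^'d"
  assumes sp: "span (a ` K) = UNIV" and sk: "\<And>k l. k \<in> K \<Longrightarrow> l \<in> K \<Longrightarrow> a k \<bullet> b l + a l \<bullet> b k = 0"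
  obtains \<Omega> where "transpose \<Omega> = - \<Omega>" "\<And>k. k \<in> K \<Longrightarrow> b k = \<Omega> *v a k"
proof -
  obtain B M where B: "B \<subseteq> K" "span (a ` B) = UNIV" "\<And>k. k \<in> B \<Longrightarrow> b k = M *v a k"
    using linear_interpolation[OF sp, of b] by blast
  have M: "transpose M = - M"
  proof (rule bilinear_span[OF _ B(2) B(2)])
    fix u v assume "u \<in> a ` B" "v \<in> a ` B"
    then obtain k l where "k \<in> B" "l \<in> B" and [simp]: "u = a k" "v = a l" by auto
    then have "a k \<bullet> (M *v a l) + a l \<bullet> (M *v a k) = 0"
      using sk[of k l] B by auto
    moreover have "u \<bullet> (transpose M *v v) = a l \<bullet> (M *v a k)"
      by (simp add: inner_mult_vec_left[symmetric] inner_commute)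
    moreover have "u \<bullet> (- M *v v) = - (a k \<bullet> (M *v a l))"
      using matrix_vector_mult_diff_rdistrib[of 0 M v] by simp
    ultimately show "u \<bullet> (transpose M *v v) = u \<bullet> (- M *v v)" by linarith
  qed
  have "b k = M *v a k" if "k \<in> K" for k
  proof (rule vector_eq_span[OF _ B(2)])
    fix c assume "c \<in> a ` B"
    then obtain l where l: "l \<in> B" "c = a l" by auto
    have "a l \<bullet> b k = - (a k \<bullet> (M *v a l))"
      using sk[of k l] that l B by auto
    also have "a k \<bullet> (M *v a l) = (- M *v a k) \<bullet> a l"
      by (simp add: inner_mult_vec_left M[symmetric])
    also have "\<dots> = - (a l \<bullet> (M *v a k))"
      using matrix_vector_mult_diff_rdistrib[of 0 M "a k"] by (simp add: inner_commute)
    finally show "c \<bullet> b k = c \<bullet> (M *v a k)" using l by simp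
  qed
  then show ?thesis using M that by blast
qed

lemma orthogonal_interpolation:
  fixes a b :: "'k \<Rightarrow> real^'d"
  assumes sp: "span (a ` K) = UNIV" and sk: "\<And>k l. k \<in> K \<Longrightarrow> l \<in> K \<Longrightarrow> a k \<bullet> a l = b k \<bullet> b l"
  obtains Q where "orthogonal_matrix Q" "\<And>k. k \<in> K \<Longrightarrow> b k = Q *v a k"
proof -
  obtain B M where B: "B \<subseteq> K" "span (a ` B) = UNIV" "\<And>k. k \<in> B \<Longrightarrow> b k = M *v a k"
    using linear_interpolation[OF sp, of b] by blast
  have MM: "transpose M ** M = mat 1"
  proof (rule bilinear_span[OF _ B(2) B(2)])
    fix u v assume "u \<in> a ` B" "v \<in> a ` B"
    then obtain k l where "k \<in> B" "l \<in> B" and [simp]: "u = a k" "v = a l" by auto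
    then have "(M *v a k) \<bullet> (M *v a l) = a k \<bullet> a l"
      using sk[of k l] B(1) by (simp add: B(3)[symmetric] subset_iff)
    then show "u \<bullet> (transpose M ** M *v v) = u \<bullet> (mat 1 *v v)"
      by (simp add: inner_mult_vec_left matrix_vector_mul_assoc)
  qed
  then have orth: "orthogonal_matrix M" by (simp add: orthogonal_matrix)
  have "b k = M *v a k" if "k \<in> K" for k
  proof -
    \<comment> \<open>As \<open>M\<close> is already orthogonal, this is enough, and the Gram
      identities give the inner products with a spanning set.\<close>
    have "transpose M *v b k = a k"
    proof (rule vector_eq_span[OF _ B(2)])
      fix c assume "c \<in> a ` B"
      then obtain l where l: "l \<in> B" "c = a l" by auto
      have "a l \<bullet> (transpose M *v b k) = b l \<bullet> b k"
        using l B by (simp add: inner_mult_vec_left)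
      also have "\<dots> = a l \<bullet> a k" using sk[of l k] that l B by auto
      finally show "c \<bullet> (transpose M *v b k) = c \<bullet> a k" using l by simp
    qed
    then have "M *v (transpose M *v b k) = M *v a k" by simp
    then show ?thesis
      using orth by (simp add: matrix_vector_mul_assoc orthogonal_matrix_def)
  qed
  then show ?thesis using orth that by blast
qed


subsection \<open>Affine and infinitesimal rigidity\<close>

locale rigid_framework =
  fixes E :: "('n::finite \<times> 'm::finite) set" and x :: "'n \<Rightarrow> 'm \<Rightarrow> real^'d"
    and S :: "real^'d^('m \<times> 'd)"
  assumes conn: "graph_connected E" and nondeg: "\<And>i. affinely_nondegenerate E x i"
    and perfect: "S \<in> alignments" "C_mat E x ** S = 0"
begin

abbreviation "r \<equiv> \<lambda>k. column k (realization E x S)"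

lemma orth: "orthogonal_matrix (row_block S i)"
  using perfect(1) by (simp add: alignments_def)

lemma glues_r: "glues E x (\<lambda>i. transpose (row_block S i)) r"
  by (rule glues_realization[OF conn perfect(2)])

lemma r_view:
  obtains t where "\<And>k. (k, i) \<in> E \<Longrightarrow> r k = transpose (row_block S i) *v x k i + t"
proof -
  obtain t where "\<forall>(k, i)\<in>E. transpose (row_block S i) *v x k i = r k + t i"
    using glues_r unfolding glues_def by blast
  then have "r k = transpose (row_block S i) *v x k i + (- t i)" if "(k, i) \<in> E" for k
    using that by auto
  then show ?thesis by (rule that)
qed

lemma glues_linear_image:
  assumes "glues E x L y"
  shows "glues E x (\<lambda>i. M ** L i) (\<lambda>k. M *v y k + c)"
proof -
  obtain t where t: "\<forall>(k, i)\<in>E. L i *v x k i = y k + t i"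
    using assms unfolding glues_def by blast
  show ?thesis unfolding glues_def
  proof (intro exI[of _ "\<lambda>i. M *v t i - c"] ballI, clarify)
    fix k i assume "(k, i) \<in> E"
    then have "M *v (L i *v x k i) = M *v y k + M *v t i"
      using t by (auto simp: matrix_vector_right_distrib)
    then show "M ** L i *v x k i = M *v y k + c + (M *v t i - c)"
      by (simp add: matrix_vector_mul_assoc)
  qed
qed

text \<open>The difference of the two linear parts is constant on each view, hence zero by
  nondegeneracy.\<close>

lemma glues_unique_linear:
  assumes "glues E x L y" "glues E x L' y"
  shows "L = L'"
proof
  fix i
  obtain t t' where "\<forall>(k, i)\<in>E. L i *v x k i = y k + t i" "\<forall>(k, i)\<in>E. L' i *v x k i = y k + t' i"
    using assms unfolding glues_def by blast
  then have "(L i - L' i) *v x k i = t i - t' i" if "(k, i) \<in> E" for k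
    using that by (fastforce simp: matrix_vector_mult_diff_rdistrib)
  then have "L i - L' i = 0"
    by (rule nondegenerate_mult[OF nondeg])
  then show "L i = L' i" by simp
qed

text \<open>After centring, both families are the realization of the same stack; connectivity enters
  through that formula.\<close>

lemma glues_unique_points:
  fixes L :: "'m \<Rightarrow> real^'d^'d"
  assumes "glues E x L y" "glues E x L y'"
  obtains c where "\<And>k. y' k = y k + c"
proof -
  let ?V = "stack (\<lambda>i. transpose (L i))"
  have "glues E x (\<lambda>i. transpose (row_block ?V i)) y" "glues E x (\<lambda>i. transpose (row_block ?V i)) y'"
    using assms by simp_all
  note eq = glues_imp(2)[OF conn this(1)] glues_imp(2)[OF conn this(2)]
  have "y' k = y k + ((1 / real CARD('n)) *\<^sub>R (\<Sum>l\<in>UNIV. y' l) - (1 / real CARD('n)) *\<^sub>R (\<Sum>l\<in>UNIV. y l))" for k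
    using eq[of k] by (simp add: algebra_simps)
  then show ?thesis by (rule that)
qed

lemma glues_kernel: "glues E x L y \<Longrightarrow> C_mat E x ** stack (\<lambda>i. transpose (L i)) = 0"
  by (rule glues_imp(1)[OF conn]) simp

text \<open>Configurations that are affine images of every view are the ones glued by kernel
  matrices of \<open>C\<close>; those that are affine images of the realization are glued by
  matrices \<open>S ** W\<close>.\<close>

lemma affinely_rigid_iff: "affinely_rigid E x S \<longleftrightarrow> (\<forall>v. C_mat E x *v v = 0 \<longrightarrow> (\<exists>w. v = S *v w))"
proof
  assume rigid: "affinely_rigid E x S"
  show "\<forall>v. C_mat E x *v v = 0 \<longrightarrow> (\<exists>w. v = S *v w)"
  proof (intro allI impI)
    fix v assume v: "C_mat E x *v v = 0"
    \<comment> \<open>Repeating \<open>v\<close> in every column turns it into a stack, to which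
      gluing applies; any column of \<open>S ** transpose M\<close> then exhibits \<open>v\<close>
      in the range of \<open>S\<close>.\<close>
    define V :: "real^'d^('m \<times> 'd)" where "V = (\<chi> a c. v $ a)"
    have col: "column c V = v" for c by (simp add: V_def column_def vec_eq_iff)
    have "C_mat E x ** V = 0"
      using v by (simp add: matrix_eq_columns column_matrix_mult col)
    then have gV: "glues E x (\<lambda>i. transpose (row_block V i)) (\<lambda>k. column k (realization E x V))"
      by (rule glues_realization[OF conn])
    then obtain t where t: "\<And>k i. (k, i) \<in> E \<Longrightarrow> transpose (row_block V i) *v x k i = column k (realization E x V) + t i"
      unfolding glues_def by blast
    have "\<exists>A. affine_transform A \<and> (\<forall>k. (k, i) \<in> E \<longrightarrow> column k (realization E x V) = A (x k i))" for i
      by (rule exI[of _ "\<lambda>y. transpose (row_block V i) *v y + (- t i)"])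
         (auto simp: affine_transform_def t intro!: exI[of _ "transpose (row_block V i)"] exI[of _ "- t i"])
    then obtain M c where "\<And>k. column k (realization E x V) = M *v r k + c"
      using rigid unfolding affinely_rigid_def affine_transform_def by metis
    then have "glues E x (\<lambda>i. M ** transpose (row_block S i)) (\<lambda>k. column k (realization E x V))"
      using glues_linear_image[OF glues_r, of M c] by simp
    from glues_unique_linear[OF gV this]
    have "row_block V i = row_block S i ** transpose M" for i
      by (metis matrix_transpose_mul transpose_transpose)
    then have "V = S ** transpose M"
      by (intro row_block_eqI) (simp add: row_block_mult)
    then have "v = S *v column undefined (transpose M)"
      by (metis col column_matrix_mult)
    then show "\<exists>w. v = S *v w" by blast
  qed
next
  assume ker: "\<forall>v. C_mat E x *v v = 0 \<longrightarrow> (\<exists>w. v = S *v w)"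
  show "affinely_rigid E x S" unfolding affinely_rigid_def
  proof (intro allI impI)
    fix Y :: "real^'n^'d"
    assume "\<forall>i. \<exists>A. affine_transform A \<and> (\<forall>k. (k, i) \<in> E \<longrightarrow> column k Y = A (x k i))"
    then have "\<forall>i. \<exists>M t. \<forall>k. (k, i) \<in> E \<longrightarrow> column k Y = M *v x k i + t"
      unfolding affine_transform_def by metis
    then obtain M t where Mt: "\<And>i k. (k, i) \<in> E \<Longrightarrow> column k Y = M i *v x k i + t i"
      by metis
    have gY: "glues E x M (\<lambda>k. column k Y)"
      unfolding glues_def by (intro exI[of _ "\<lambda>i. - t i"]) (auto simp: Mt)
    define V where "V = stack (\<lambda>i. transpose (M i))"
    have "C_mat E x ** V = 0"
      unfolding V_def by (rule glues_kernel[OF gY])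
    then have "C_mat E x *v column c V = 0" for c
      by (simp flip: column_matrix_mult)
    then have "\<forall>c. \<exists>w. column c V = S *v w"
      using ker by simp
    then obtain w where w: "\<And>c. column c V = S *v w c"
      by metis
    define W where "W = (\<chi> a c. w c $ a)"
    have "column c W = w c" for c
      by (simp add: W_def column_def vec_eq_iff)
    then have V: "V = S ** W"
      by (simp add: matrix_eq_columns column_matrix_mult w)
    have "M i = transpose W ** transpose (row_block S i)" for i
    proof -
      have "transpose (M i) = row_block S i ** W"
        using V by (metis V_def row_block_mult row_block_stack)
      then show ?thesis by (metis matrix_transpose_mul transpose_transpose)
    qed
    then have "M = (\<lambda>i. transpose W ** transpose (row_block S i))"
      by (rule ext)
    then have "glues E x M (\<lambda>k. transpose W *v r k + 0)"
      using glues_linear_image[OF glues_r, of "transpose W" 0] by simp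
    from glues_unique_points[OF this gY] obtain c where "\<And>k. column k Y = transpose W *v r k + 0 + c"
      by blast
    then show "\<exists>A. affine_transform A \<and> (\<forall>k. column k Y = A (r k))"
      unfolding affine_transform_def by (intro exI[of _ "\<lambda>y. transpose W *v y + c"]) auto
  qed
qed

text \<open>Columnwise, a flex in the kernel has the form \<open>S ** W\<close>; cancelling the
  orthogonal blocks gives \<open>X i = W\<close> for every view. This is the passage from condition
  (1) to condition (2).\<close>

lemma kernel_imp_skew_flex_trivial:
  assumes "\<forall>v. C_mat E x *v v = 0 \<longrightarrow> (\<exists>w. v = S *v w)"
  shows "skew_flex_trivial E x S"
  unfolding skew_flex_trivial_def
proof (intro allI impI, elim conjE)
  fix X :: "'m \<Rightarrow> real^'d^'d" and i j
  define V where "V = stack (\<lambda>i. row_block S i ** X i)"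
  assume "C_mat E x ** stack (\<lambda>i. row_block S i ** X i) = 0"
  then have "C_mat E x *v column c V = 0" for c
    by (simp add: V_def flip: column_matrix_mult)
  then have "\<forall>c. \<exists>w. column c V = S *v w"
    using assms by simp
  then obtain w where w: "\<And>c. column c V = S *v w c"
    by metis
  define W where "W = (\<chi> a c. w c $ a)"
  have "column c W = w c" for c
    by (simp add: W_def column_def vec_eq_iff)
  then have V: "V = S ** W"
    by (simp add: matrix_eq_columns column_matrix_mult w)
  have "X i = W" for i
  proof -
    have "row_block S i ** X i = row_block S i ** W"
      using arg_cong[OF V, of "\<lambda>V. row_block V i"] by (simp add: V_def row_block_mult)
    then have "transpose (row_block S i) ** (row_block S i ** X i) = transpose (row_block S i) ** (row_block S i ** W)"
      by simp
    then show ?thesis by (simp add: orthogonal_matrixD[OF orth])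
  qed
  then show "X i = X j" by simp
qed

text \<open>On one view a flex has the form \<open>\<Omega>\<^sub>i r + t\<close> with
  \<open>\<Omega>\<^sub>i\<close> skew, by nondegeneracy. Such maps glue precisely when the stack
  with \<open>X\<^sub>i = - \<Omega>\<^sub>i\<close> lies in the kernel, the sign coming from the
  transposition in the gluing. Equal \<open>\<Omega>\<^sub>i\<close> give the trivial
  flexes.\<close>

lemma infinitesimally_rigid_iff: "infinitesimally_rigid E x S \<longleftrightarrow> skew_flex_trivial E x S"
proof
  assume rigid: "infinitesimally_rigid E x S"
  show "skew_flex_trivial E x S"
    unfolding skew_flex_trivial_def
  proof (intro allI impI, elim conjE)
    fix X :: "'m \<Rightarrow> real^'d^'d" and i j
    assume skew: "\<forall>i. transpose (X i) = - X i" and C: "C_mat E x ** stack (\<lambda>i. row_block S i ** X i) = 0"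
    define V where "V = stack (\<lambda>i. row_block S i ** X i)"
    let ?p = "\<lambda>k. column k (realization E x V)"
    have tV: "transpose (row_block V i) = - (X i ** transpose (row_block S i))" for i
      using skew by (simp add: V_def matrix_transpose_mul matrix_mult_uminus)
    have gV: "glues E x (\<lambda>i. - (X i ** transpose (row_block S i))) ?p"
      using glues_realization[OF conn, of x V] C by (simp add: V_def[symmetric] tV)
    then obtain t where t: "\<And>k i. (k, i) \<in> E \<Longrightarrow> - (X i ** transpose (row_block S i)) *v x k i = ?p k + t i"
      unfolding glues_def by blast
    have "(r k - r l) \<bullet> (?p k - ?p l) = 0" if kl: "(k, i) \<in> E" "(l, i) \<in> E" for k l i
    proof -
      obtain s where s: "\<And>k. (k, i) \<in> E \<Longrightarrow> r k = transpose (row_block S i) *v x k i + s"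
        using r_view by blast
      define a where "a = transpose (row_block S i) *v (x k i - x l i)"
      have "r k - r l = a"
        using s kl by (simp add: a_def matrix_vector_mult_diff_distrib)
      moreover have "?p k - ?p l = - (X i ** transpose (row_block S i)) *v (x k i - x l i)"
        using t[OF kl(1)] t[OF kl(2)] by (simp add: matrix_vector_mult_diff_distrib)
      then have "?p k - ?p l = - X i *v a"
        by (simp add: a_def matrix_vector_mul_assoc matrix_mult_uminus)
      moreover have "a \<bullet> (- X i *v a) = 0"
      proof -
        have "a \<bullet> (- X i *v a) = a \<bullet> (transpose (X i) *v a)" by (simp add: skew)
        also have "\<dots> = a \<bullet> (X i *v a)" by (simp add: inner_mult_vec_left[symmetric] inner_commute)
        also have "\<dots> = - (a \<bullet> (- X i *v a))"
          using matrix_vector_mult_diff_rdistrib[of 0 "X i" a] by simp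
        finally show ?thesis by simp
      qed
      ultimately show ?thesis by simp
    qed
    then obtain \<Omega> c where "\<And>k. ?p k = \<Omega> *v r k + c"
      using rigid unfolding infinitesimally_rigid_def by meson
    then have "glues E x (\<lambda>i. \<Omega> ** transpose (row_block S i)) ?p"
      using glues_linear_image[OF glues_r, of \<Omega> c] by simp
    from glues_unique_linear[OF gV this]
    have "- (X i ** transpose (row_block S i)) = \<Omega> ** transpose (row_block S i)" for i
      by meson
    then have "- (X i ** transpose (row_block S i)) ** row_block S i = \<Omega> ** transpose (row_block S i) ** row_block S i" for i
      by simp
    then have "- X i = \<Omega>" for i
      by (simp add: matrix_mult_uminus orthogonal_matrixD[OF orth] flip: matrix_mul_assoc)
    then show "X i = X j" by (metis minus_minus)
  qed
next
  assume triv: "skew_flex_trivial E x S"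
  show "infinitesimally_rigid E x S" unfolding infinitesimally_rigid_def
  proof (intro allI impI)
    fix p :: "'n \<Rightarrow> real^'d"
    assume p: "\<forall>i k1 k2. (k1, i) \<in> E \<and> (k2, i) \<in> E \<longrightarrow> (r k1 - r k2) \<bullet> (p k1 - p k2) = 0"
    have "\<exists>\<Omega>. transpose \<Omega> = - \<Omega> \<and> (\<exists>t. \<forall>k. (k, i) \<in> E \<longrightarrow> (\<Omega> ** transpose (row_block S i)) *v x k i = p k + t)" for i
    proof -
      obtain s where s: "\<And>k. (k, i) \<in> E \<Longrightarrow> r k = transpose (row_block S i) *v x k i + s"
        using r_view by blast
      obtain k0 where k0: "(k0, i) \<in> E" using nondegenerate_obtain[OF nondeg] .
      let ?a = "\<lambda>k. r k - r k0" and ?b = "\<lambda>k. p k - p k0"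
      have sk: "?a k \<bullet> ?b l + ?a l \<bullet> ?b k = 0" if "(k, i) \<in> E" "(l, i) \<in> E" for k l
      proof -
        have "(r k - r k0) \<bullet> (p k - p k0) = 0" "(r l - r k0) \<bullet> (p l - p k0) = 0" "(r k - r l) \<bullet> (p k - p l) = 0"
          using p that k0 by blast+
        then show ?thesis by (simp add: inner_diff_left inner_diff_right)
      qed
      have sp: "span (?a ` {k. (k, i) \<in> E}) = UNIV"
        by (rule nondegenerate_span[OF nondeg s _ k0]) (auto simp: orth)
      obtain \<Omega> where \<Omega>: "transpose \<Omega> = - \<Omega>" "\<And>k. (k, i) \<in> E \<Longrightarrow> ?b k = \<Omega> *v ?a k"
        by (rule skew_interpolation[OF sp, of ?b]) (use sk in auto)
      have "(\<Omega> ** transpose (row_block S i)) *v x k i = p k + (\<Omega> *v (r k0 - s) - p k0)" if "(k, i) \<in> E" for k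
      proof -
        have "\<Omega> *v (r k - s) = \<Omega> *v (r k0 - s) + (p k - p k0)"
          using \<Omega>(2)[OF that] by (simp add: matrix_vector_mult_diff_distrib)
        then show ?thesis
          using s[OF that] by (simp add: algebra_simps flip: matrix_vector_mul_assoc)
      qed
      then show ?thesis using \<Omega>(1) by blast
    qed
    then obtain \<Omega> t where sk: "\<And>i. transpose (\<Omega> i) = - \<Omega> i"
      and t: "\<And>i k. (k, i) \<in> E \<Longrightarrow> (\<Omega> i ** transpose (row_block S i)) *v x k i = p k + t i"
      by metis
    have gp: "glues E x (\<lambda>i. \<Omega> i ** transpose (row_block S i)) p"
      unfolding glues_def using t by (intro exI[of _ t]) auto
    have "transpose (\<Omega> i ** transpose (row_block S i)) = row_block S i ** (- \<Omega> i)" for i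
      by (simp add: matrix_transpose_mul sk)
    then have "C_mat E x ** stack (\<lambda>i. row_block S i ** (- \<Omega> i)) = 0"
      using glues_kernel[OF gp] by simp
    moreover have "transpose (- \<Omega> i) = - (- \<Omega> i)" for i
      by (simp add: transpose_uminus sk)
    ultimately have "- \<Omega> i = - \<Omega> j" for i j
      using triv[unfolded skew_flex_trivial_def, THEN spec[of _ "\<lambda>i. - \<Omega> i"]] by blast
    then obtain \<Omega>0 where \<Omega>0: "\<And>i. \<Omega> i = \<Omega>0" by (metis minus_minus)
    have "glues E x (\<lambda>i. \<Omega> i ** transpose (row_block S i)) (\<lambda>k. \<Omega>0 *v r k + 0)"
      unfolding \<Omega>0 by (rule glues_linear_image[OF glues_r])
    from glues_unique_points[OF this gp] obtain c where "\<And>k. p k = \<Omega>0 *v r k + 0 + c"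
      by blast
    then show "\<exists>\<Omega> t. transpose \<Omega> = - \<Omega> \<and> (\<forall>k. p k = \<Omega> *v r k + t)"
      using sk unfolding \<Omega>0 by (intro exI[of _ \<Omega>0] exI[of _ c]) auto
  qed
qed

end

subsection \<open>The matrix exponential\<close>

definition mat_pow :: "real^'a^'a \<Rightarrow> nat \<Rightarrow> real^'a^'a" where
  "mat_pow A k = ((**) A ^^ k) (mat 1)"

lemma mat_pow_0 [simp]: "mat_pow A 0 = mat 1" and mat_pow_Suc: "mat_pow A (Suc k) = A ** mat_pow A k"
  by (simp_all add: mat_pow_def)

lemma norm_mat_pow_le: "norm (mat_pow A k) \<le> norm (mat 1 :: real^'a^'a) * norm A ^ k" for A :: "real^'a^'a"
proof (induction k)
  case (Suc k)
  have "norm (mat_pow A (Suc k)) \<le> norm A * norm (mat_pow A k)"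
    unfolding mat_pow_Suc by (rule norm_matrix_mult_le)
  also have "\<dots> \<le> norm A * (norm (mat 1 :: real^'a^'a) * norm A ^ k)"
    by (intro mult_left_mono Suc.IH) simp
  finally show ?case by (simp add: mult_ac)
qed simp

lemma summable_norm_pow: "summable (\<lambda>k. c * (1 / fact k * a ^ k))" for a c :: real
  using summable_mult[OF summable_exp[of a], of c] by (simp add: divide_inverse)

lemma norm_mat_exp_term_le:
  "norm ((1 / fact k) *\<^sub>R mat_pow A k) \<le> norm (mat 1 :: real^'a^'a) * (1 / fact k * norm A ^ k)" for A :: "real^'a^'a"
  using mult_left_mono[OF norm_mat_pow_le[of A k], of "1 / fact k"] by (simp add: mult_ac)

lemma mat_exp_sums: "(\<lambda>k. (1 / fact k) *\<^sub>R mat_pow A k) sums mat_exp A" for A :: "real^'a^'a"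
proof -
  have "summable (\<lambda>k. (1 / fact k) *\<^sub>R mat_pow A k)"
    by (rule summable_comparison_test'[OF summable_norm_pow norm_mat_exp_term_le])
  then show ?thesis
    unfolding mat_exp_def mat_pow_def by (rule summable_sums)
qed

text \<open>The tail from the quadratic term on is compared with the series of \<open>exp\<close>.
  The factor \<open>norm (mat 1)\<close> appears because the Frobenius norm of the identity is not 1
  in general.\<close>

lemma mat_exp_remainder:
  "norm (mat_exp A - mat 1 - A) \<le> norm (mat 1 :: real^'a^'a) * (norm A)\<^sup>2 * exp (norm A)" for A :: "real^'a^'a"
proof -
  let ?c = "norm (mat 1 :: real^'a^'a)"
  have "(\<lambda>k. (1 / fact (k + 2)) *\<^sub>R mat_pow A (k + 2)) sums (mat_exp A - (\<Sum>k<2. (1 / fact k) *\<^sub>R mat_pow A k))"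
    using mat_exp_sums by (rule sums_split_initial_segment)
  then have eq: "mat_exp A - mat 1 - A = suminf (\<lambda>k. (1 / fact (k + 2)) *\<^sub>R mat_pow A (k + 2))"
    by (simp add: sums_iff numeral_2_eq_2 mat_pow_Suc)
  have "norm ((1 / fact (k + 2)) *\<^sub>R mat_pow A (k + 2)) \<le> (?c * (norm A)\<^sup>2) * (1 / fact k * norm A ^ k)" for k
  proof -
    have "norm ((1 / fact (k + 2)) *\<^sub>R mat_pow A (k + 2)) \<le> ?c * (1 / fact (k + 2) * norm A ^ (k + 2))"
      by (rule norm_mat_exp_term_le)
    also have "\<dots> \<le> ?c * (1 / fact k * norm A ^ (k + 2))"
      by (intro mult_left_mono mult_right_mono divide_left_mono fact_mono) auto
    finally show ?thesis by (simp only: power_add mult_ac)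
  qed
  then have "norm (mat_exp A - mat 1 - A) \<le> suminf (\<lambda>k. (?c * (norm A)\<^sup>2) * (1 / fact k * norm A ^ k))"
    unfolding eq by (rule norm_suminf_le) (rule summable_norm_pow)
  also have "\<dots> = (?c * (norm A)\<^sup>2) * exp (norm A)"
    unfolding exp_def using summable_exp[of "norm A"]
    by (subst suminf_mult) (simp_all add: divide_inverse)
  finally show ?thesis .
qed

lemma mat_pow_scaleR: "mat_pow (t *\<^sub>R A) k = t ^ k *\<^sub>R mat_pow A k" for A :: "real^'a^'a"
  by (induction k) (simp_all add: mat_pow_Suc scalar_matrix_assoc[symmetric] matrix_scalar_ac)

lemma mat_exp_nth_sums: "(\<lambda>k. mat_pow A k $ i $ j / fact k * t ^ k) sums (mat_exp (t *\<^sub>R A) $ i $ j)"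
  for A :: "real^'a^'a"
proof -
  have "bounded_linear (\<lambda>M :: real^'a^'a. M $ i $ j)"
    by (intro bounded_linear_compose[OF bounded_linear_vec_nth] bounded_linear_vec_nth)
  from bounded_linear.sums[OF this mat_exp_sums[of "t *\<^sub>R A"]]
  show ?thesis by (simp add: mat_pow_scaleR mult_ac)
qed

text \<open>Each entry is a power series in \<open>t\<close>; differentiation shifts the index and
  pulls out one factor \<open>A\<close>.\<close>

lemma mat_exp_nth_deriv:
  "((\<lambda>t. mat_exp (t *\<^sub>R A) $ i $ j) has_field_derivative (\<Sum>l\<in>UNIV. A $ i $ l * mat_exp (t *\<^sub>R A) $ l $ j)) (at t)"
  for A :: "real^'a^'a"
proof -
  let ?c = "\<lambda>i k. mat_pow A k $ i $ j / fact k"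
  have eq: "mat_exp (t *\<^sub>R A) $ i $ j = suminf (\<lambda>k. ?c i k * t ^ k)" and su: "summable (\<lambda>k. ?c i k * t ^ k)" for t i
    using mat_exp_nth_sums[of A i j t] by (simp_all add: sums_iff)
  have "diffs (?c i) k * t ^ k = (\<Sum>l\<in>UNIV. A $ i $ l * (?c l k * t ^ k))" for k
  proof -
    have fs: "real (Suc k) * (y / fact (Suc k)) = y / fact k" for y :: real
      by (simp add: fact_Suc del: of_nat_Suc)
    then show ?thesis
      unfolding diffs_def mat_pow_Suc fs
      by (simp add: matrix_matrix_mult_def sum_divide_distrib sum_distrib_left mult_ac del: of_nat_Suc fact_Suc)
  qed
  then have "suminf (\<lambda>k. diffs (?c i) k * t ^ k) = suminf (\<lambda>k. \<Sum>l\<in>UNIV. A $ i $ l * (?c l k * t ^ k))"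
    by simp
  also have "\<dots> = (\<Sum>l\<in>UNIV. A $ i $ l * suminf (\<lambda>k. ?c l k * t ^ k))"
    by (simp only: suminf_sum[OF summable_mult[OF su]] suminf_mult[OF su])
  finally have d: "suminf (\<lambda>k. diffs (?c i) k * t ^ k) = (\<Sum>l\<in>UNIV. A $ i $ l * mat_exp (t *\<^sub>R A) $ l $ j)"
    by (simp only: eq)
  show ?thesis
    using termdiffs_strong_converges_everywhere[OF su[of i], of t] unfolding d by (simp only: eq)
qed

text \<open>Along \<open>e = exp (t A)\<close> the product \<open>e\<^sup>T e\<close> has derivative
  \<open>e\<^sup>T (A\<^sup>T + A) e = 0\<close>, so it keeps its value \<open>mat 1\<close> at
  \<open>t = 0\<close>.\<close>

lemma orthogonal_mat_exp:
  fixes A :: "real^'a^'a"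
  assumes "transpose A = - A"
  shows "orthogonal_matrix (mat_exp A)"
proof -
  let ?e = "\<lambda>t. mat_exp (t *\<^sub>R A)"
  have sk: "A $ k $ l = - (A $ l $ k)" for k l
    using arg_cong[OF assms, of "\<lambda>M. M $ l $ k"] unfolding transpose_def by simp
  have neg: "A $ k $ l * a * b = - (A $ l $ k * a * b)" for k l a b
    using sk[of k l] by simp
  have "(transpose (?e t) ** ?e t) $ i $ j = (transpose (?e 0) ** ?e 0) $ i $ j" for t i j
  proof (rule DERIV_isconst_all[where f = "\<lambda>t. (transpose (?e t) ** ?e t) $ i $ j"], rule allI)
    fix t
    have "(\<Sum>l\<in>UNIV. \<Sum>k\<in>UNIV. A $ l $ k * ?e t $ l $ i * ?e t $ k $ j)
        = (\<Sum>l\<in>UNIV. \<Sum>k\<in>UNIV. A $ k $ l * ?e t $ k $ i * ?e t $ l $ j)"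
      by (rule sum.swap)
    also have "\<dots> = (\<Sum>l\<in>UNIV. \<Sum>k\<in>UNIV. - (A $ l $ k * ?e t $ k $ i * ?e t $ l $ j))"
      by (intro sum.cong refl neg)
    finally have 0: "(\<Sum>l\<in>UNIV. (\<Sum>k\<in>UNIV. A $ l $ k * ?e t $ k $ i) * ?e t $ l $ j
        + (\<Sum>k\<in>UNIV. A $ l $ k * ?e t $ k $ j) * ?e t $ l $ i) = 0"
      by (simp add: sum.distrib sum_distrib_left sum_distrib_right sum_negf mult_ac)
    have "((\<lambda>t. \<Sum>l\<in>UNIV. ?e t $ l $ i * ?e t $ l $ j) has_field_derivative
        (\<Sum>l\<in>UNIV. (\<Sum>k\<in>UNIV. A $ l $ k * ?e t $ k $ i) * ?e t $ l $ j
        + (\<Sum>k\<in>UNIV. A $ l $ k * ?e t $ k $ j) * ?e t $ l $ i)) (at t)"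
      by (rule DERIV_sum[where f' = "\<lambda>l. (\<Sum>k\<in>UNIV. A $ l $ k * ?e t $ k $ i) * ?e t $ l $ j
        + (\<Sum>k\<in>UNIV. A $ l $ k * ?e t $ k $ j) * ?e t $ l $ i"]) (intro DERIV_mult mat_exp_nth_deriv)
    then show "((\<lambda>t. (transpose (?e t) ** ?e t) $ i $ j) has_field_derivative 0) (at t)"
      unfolding 0 by (simp add: matrix_matrix_mult_def transpose_def)
  qed
  then have "transpose (?e 1) ** ?e 1 = transpose (?e 0) ** ?e 0"
    unfolding vec_eq_iff by blast
  moreover have "?e 0 = mat 1"
    using mat_exp_remainder[of "0 :: real^'a^'a"] by simp
  ultimately show ?thesis
    by (simp add: orthogonal_matrix)
qed


subsection \<open>Blockwise products of stacks\<close>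

definition block_mult :: "real^'d^('m::finite \<times> 'd) \<Rightarrow> real^'d^('m \<times> 'd) \<Rightarrow> real^'d^('m \<times> 'd)" where
  "block_mult V W = stack (\<lambda>i. row_block V i ** row_block W i)"

definition block_transpose :: "real^'d^('m::finite \<times> 'd) \<Rightarrow> real^'d^('m \<times> 'd)" where
  "block_transpose V = stack (\<lambda>i. transpose (row_block V i))"

lemma row_block_mult_transpose [simp]:
  "row_block (block_mult V W) i = row_block V i ** row_block W i"
  "row_block (block_transpose V) i = transpose (row_block V i)"
  by (simp_all add: block_mult_def block_transpose_def)

lemma block_mult_linear:
  "block_mult (V + V') W = block_mult V W + block_mult V' W"
  "block_mult (V - V') W = block_mult V W - block_mult V' W"
  "block_mult V (W + W') = block_mult V W + block_mult V W'"
  "block_mult V (W - W') = block_mult V W - block_mult V W'"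
  "block_mult V (c *\<^sub>R W) = c *\<^sub>R block_mult V W"
  by (rule row_block_eqI;
      simp add: row_block_linear matrix_add_mult matrix_diff_mult matrix_add_ldistrib matrix_mult_diff matrix_scalar_ac
        scalar_matrix_assoc[symmetric])+

lemma block_transpose_linear:
  "block_transpose (V + W) = block_transpose V + block_transpose W"
  "block_transpose (V - W) = block_transpose V - block_transpose W"
  "block_transpose (c *\<^sub>R W) = c *\<^sub>R block_transpose W"
  "block_transpose (- W) = - block_transpose W"
  "block_transpose (block_transpose W) = W"
  by (rule row_block_eqI; simp add: row_block_linear transpose_add transpose_diff transpose_scaleR transpose_uminus)+

lemma norm_block_transpose [simp]: "norm (block_transpose V) = norm V"
proof -
  have "(norm (block_transpose V))\<^sup>2 = (norm V)\<^sup>2"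
    by (simp add: norm_row_blocks norm_transpose)
  then show ?thesis by simp
qed

lemma norm_block_mult_le: "norm (block_mult V W) \<le> norm V * norm W"
proof (rule power2_le_imp_le)
  have "(norm (block_mult V W))\<^sup>2 \<le> (\<Sum>i\<in>UNIV. (norm (row_block V i) * norm (row_block W i))\<^sup>2)"
    unfolding norm_row_blocks by (intro sum_mono power_mono) (simp_all add: norm_matrix_mult_le)
  also have "\<dots> \<le> (\<Sum>i\<in>UNIV. (norm V)\<^sup>2 * (norm (row_block W i))\<^sup>2)"
    by (intro sum_mono) (simp add: power_mult_distrib mult_right_mono power_mono norm_row_block_le)
  also have "\<dots> = (norm V * norm W)\<^sup>2"
    by (simp add: norm_row_blocks[of W] power_mult_distrib sum_distrib_left)
  finally show "(norm (block_mult V W))\<^sup>2 \<le> (norm V * norm W)\<^sup>2" .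
qed simp

lemma alignmentsD: "V \<in> alignments \<Longrightarrow> orthogonal_matrix (row_block V i)"
  by (simp add: alignments_def)

lemma norm_block_mult_alignment:
  assumes "V \<in> alignments" shows "norm (block_mult V W) = norm W"
proof -
  have "(norm (block_mult V W))\<^sup>2 = (norm W)\<^sup>2"
    by (simp add: norm_row_blocks norm_orthogonal_mult[OF alignmentsD[OF assms]])
  then show ?thesis by simp
qed

lemma norm_le_sum_row_blocks: "norm V \<le> (\<Sum>i\<in>UNIV. norm (row_block V i))"
proof -
  have "norm V = L2_set (\<lambda>i. norm (row_block V i)) UNIV"
    by (simp add: L2_set_def flip: norm_row_blocks)
  then show ?thesis by (simp add: L2_set_le_sum)
qed

definition id_stack :: "real^'d^('m::finite \<times> 'd)" where
  "id_stack = stack (\<lambda>_. mat 1)"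

lemma norm_alignment:
  fixes V :: "real^'d^('m::finite \<times> 'd)"
  assumes "V \<in> alignments" shows "norm V = norm (id_stack :: real^'d^('m::finite \<times> 'd))"
proof -
  have "block_mult V id_stack = V"
    by (rule row_block_eqI) (simp add: id_stack_def)
  then show ?thesis
    using norm_block_mult_alignment[OF assms, of id_stack] by simp
qed

lemma alignments_mult: "V \<in> alignments \<Longrightarrow> orthogonal_matrix Q \<Longrightarrow> V ** Q \<in> alignments"
  by (simp add: alignments_def row_block_mult orthogonal_matrix_mul)

subsection \<open>Growth of the cost and of its gradient\<close>

locale alignment_problem =
  fixes E :: "('n::finite \<times> 'm::finite) set" and x :: "'n \<Rightarrow> 'm \<Rightarrow> real^'d"
  assumes conn: "graph_connected E"
begin

abbreviation "C \<equiv> C_mat E x"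
abbreviation "F \<equiv> align_cost E x"
abbreviation "G \<equiv> rgrad E x"
abbreviation "c \<equiv> norm (C_mat E x)"

lemmas F_eq = align_cost_eq[OF conn, of x]
lemmas F_nonneg = align_cost_nonneg[OF conn, of x]

lemma C_sym: "(C ** V) \<bullet> W = V \<bullet> (C ** W)"
  by (simp add: inner_matrix_mult_left transpose_C_mat[OF conn])

lemma F_add: "F (V + W) = F V + 2 * ((C ** V) \<bullet> W) + F W"
proof -
  have "(C ** W) \<bullet> V = (C ** V) \<bullet> W"
    unfolding C_sym[of W] by (rule inner_commute)
  then show ?thesis
    by (simp add: F_eq matrix_add_ldistrib inner_add_left inner_add_right)
qed

lemma norm_C_mult_le: "norm (C ** V) \<le> c * norm V"
  by (rule norm_matrix_mult_le)

lemma inner_C_le: "\<bar>(C ** V) \<bullet> W\<bar> \<le> c * norm V * norm W"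
  by (rule order_trans[OF Cauchy_Schwarz_ineq2 mult_right_mono[OF norm_C_mult_le norm_ge_zero]])

lemma F_le: "F V \<le> c * (norm V)\<^sup>2"
  using inner_C_le[of V V] by (simp add: F_eq power2_eq_square mult.assoc)

lemma F_mult_orthogonal:
  assumes "orthogonal_matrix Q" shows "F (V ** Q) = F V"
proof -
  have "F (V ** Q) = ((C ** V) ** Q) \<bullet> (V ** Q)"
    by (simp add: F_eq matrix_mul_assoc)
  also have "\<dots> = (C ** V) \<bullet> ((V ** Q) ** transpose Q)"
    by (rule inner_matrix_mult_right)
  also have "(V ** Q) ** transpose Q = V"
    by (simp add: orthogonal_matrixD[OF assms] flip: matrix_mul_assoc)
  finally show ?thesis by (simp add: F_eq)
qed

lemma rgrad_block: "row_block (G V) i = row_block (C ** V) i - row_block V i ** transpose (row_block (C ** V) i) ** row_block V i"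
  by (simp add: rgrad_def)

text \<open>On a block, the map taking \<open>P\<close> to \<open>V P\<^sup>T V\<close> is an
  isometry, so both terms of the gradient have equal norm. The identity reflects that
  \<open>G V\<close> is the tangential projection of the Euclidean gradient
  \<open>2 C V\<close>.\<close>

lemma rgrad_inner:
  assumes V: "V \<in> alignments"
  shows "(C ** V) \<bullet> G V = (norm (G V))\<^sup>2 / 2"
proof -
  let ?P = "\<lambda>i. row_block (C ** V) i" and ?V = "row_block V"
  have "(norm (?P i - ?V i ** transpose (?P i) ** ?V i))\<^sup>2 = 2 * (?P i \<bullet> (?P i - ?V i ** transpose (?P i) ** ?V i))" for i
  proof -
    have "norm (?V i ** transpose (?P i) ** ?V i) = norm (?P i)"
      by (simp add: norm_mult_orthogonal norm_orthogonal_mult alignmentsD[OF V] norm_transpose)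
    then have "(?V i ** transpose (?P i) ** ?V i) \<bullet> (?V i ** transpose (?P i) ** ?V i) = ?P i \<bullet> ?P i"
      by (simp add: norm_eq)
    then show ?thesis
      unfolding power2_norm_eq_inner inner_diff_left inner_diff_right
      by (simp add: inner_commute[of "?V i ** transpose (?P i) ** ?V i" "?P i"])
  qed
  then have "(norm (G V))\<^sup>2 = 2 * ((C ** V) \<bullet> G V)"
    by (simp add: norm_row_blocks inner_row_blocks rgrad_block sum_distrib_left)
  then show ?thesis by simp
qed

text \<open>Against a tangent vector \<open>V W\<close> the subtracted term of the gradient
  contributes as much as \<open>C V\<close> itself.\<close>

lemma rgrad_inner_skew:
  assumes V: "V \<in> alignments" and W: "block_transpose W = - W"
  shows "G V \<bullet> block_mult V W = 2 * ((C ** V) \<bullet> block_mult V W)"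
proof -
  let ?P = "\<lambda>i. row_block (C ** V) i" and ?V = "row_block V" and ?W = "row_block W"
  have "(?V i ** transpose (?P i) ** ?V i) \<bullet> (?V i ** ?W i) = - (?P i \<bullet> (?V i ** ?W i))" for i
  proof -
    have tW: "transpose (?W i) = - ?W i"
      using arg_cong[OF W, of "\<lambda>V. row_block V i"] by (simp add: row_block_linear)
    have "(?V i ** transpose (?P i) ** ?V i) \<bullet> (?V i ** ?W i) = (transpose (?P i) ** ?V i) \<bullet> ?W i"
      by (simp add: inner_matrix_mult_left orthogonal_matrixD[OF alignmentsD[OF V]] flip: matrix_mul_assoc)
    also have "\<dots> = (transpose (?V i) ** ?P i) \<bullet> transpose (?W i)"
      by (simp add: matrix_transpose_mul flip: inner_transpose[of "transpose (?P i) ** ?V i"])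
    also have "\<dots> = - (?P i \<bullet> (?V i ** ?W i))"
      by (simp add: tW inner_matrix_mult_left)
    finally show ?thesis .
  qed
  then show ?thesis
    by (simp add: inner_row_blocks rgrad_block inner_diff_left sum_distrib_left)
qed

text \<open>Fixing block \<open>f\<close> removes the trivial flexes, so the form is positive on a
  compact unit sphere and has a positive minimum there; homogeneity does the rest.\<close>

lemma skew_flex_positive:
  assumes S: "S \<in> alignments" "C ** S = 0" and triv: "skew_flex_trivial E x S"
  obtains \<mu> where "\<mu> > 0"
    "\<And>W. block_transpose W = - W \<Longrightarrow> row_block W f = 0 \<Longrightarrow> \<mu> * (norm W)\<^sup>2 \<le> F (block_mult S W)"
proof -
  define K :: "(real^'d^('m \<times> 'd)) set"
    where "K = {W. block_transpose W = - W} \<inter> {W. row_block W f = 0} \<inter> sphere 0 1"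
  have cont: "continuous_on UNIV (block_transpose :: real^'d^('m \<times> 'd) \<Rightarrow> _)"
    "continuous_on UNIV (\<lambda>W :: real^'d^('m \<times> 'd). row_block W f)"
    by (intro linear_continuous_on linear_conv_bounded_linear[THEN iffD1] linearI;
        simp add: block_transpose_linear row_block_linear)+
  have "closed {W :: real^'d^('m \<times> 'd). block_transpose W = - W}" "closed {W :: real^'d^('m \<times> 'd). row_block W f = 0}"
    by (intro closed_Collect_eq continuous_intros cont)+
  then have "compact K"
    unfolding K_def by (intro closed_Int_compact closed_Int compact_sphere) auto
  have "linear (\<lambda>W. block_mult S W)" "linear (\<lambda>W. C ** block_mult S W)"
    by (intro linearI; simp add: block_mult_linear matrix_add_ldistrib matrix_scalar_ac scalar_matrix_assoc[symmetric])+
  then have contF: "continuous_on K (\<lambda>W. F (block_mult S W))"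
    unfolding F_eq by (intro continuous_intros linear_continuous_on linear_conv_bounded_linear[THEN iffD1]) auto
  have pos: "F (block_mult S W) > 0" if "W \<in> K" for W
  proof (rule ccontr)
    assume "\<not> F (block_mult S W) > 0"
    then have "F (block_mult S W) = 0" using F_nonneg[of "block_mult S W"] by simp
    then have "C ** stack (\<lambda>i. row_block S i ** row_block W i) = 0"
      by (simp add: align_cost_eq_0_iff[OF conn] block_mult_def)
    moreover have skW: "block_transpose W = - W"
      using that by (simp add: K_def)
    have "transpose (row_block W i) = - row_block W i" for i
      using arg_cong[OF skW, of "\<lambda>V. row_block V i"] by (simp add: row_block_linear)
    ultimately have "row_block W i = row_block W f" for i
      using triv[unfolded skew_flex_trivial_def, THEN spec[of _ "row_block W"]] by blast
    then have "row_block W i = row_block 0 i" for i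
      using that by (simp add: K_def row_block_linear)
    then have "W = 0" by (rule row_block_eqI)
    then show False using that by (simp add: K_def)
  qed
  obtain \<mu> where \<mu>: "\<mu> > 0" "\<And>W. W \<in> K \<Longrightarrow> \<mu> \<le> F (block_mult S W)"
  proof (cases "K = {}")
    \<comment> \<open>No nonzero admissible \<open>W\<close> exists, for instance when
      \<open>d = 1\<close> or \<open>m = 1\<close>, and any constant will do.\<close>
    case True then show ?thesis using that[of 1] by simp
  next
    case False
    from continuous_attains_inf[OF \<open>compact K\<close> False contF]
    obtain W where "W \<in> K" "\<forall>W'\<in>K. F (block_mult S W) \<le> F (block_mult S W')" by blast
    then show ?thesis using that[of "F (block_mult S W)"] pos by blast
  qed
  show ?thesis
  proof (rule that[OF \<mu>(1)])
    fix W :: "real^'d^('m \<times> 'd)" assume W: "block_transpose W = - W" "row_block W f = 0"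
    show "\<mu> * (norm W)\<^sup>2 \<le> F (block_mult S W)"
    proof (cases "W = 0")
      case True then show ?thesis by (simp add: F_nonneg)
    next
      case False
      define U where "U = (1 / norm W) *\<^sub>R W"
      have "U \<in> K"
        using W False by (simp add: K_def U_def block_transpose_linear row_block_linear)
      then have "\<mu> \<le> F (block_mult S U)" by (rule \<mu>(2))
      also have "\<dots> = F (block_mult S W) / (norm W)\<^sup>2"
        by (simp add: F_eq U_def block_mult_linear matrix_scalar_ac power2_eq_square scalar_matrix_assoc[symmetric])
      finally show ?thesis
        using False by (simp add: field_simps)
    qed
  qed
qed

text \<open>
  With \<open>V = S + D\<close> and \<open>S\<^sub>i\<^sup>T V\<^sub>i = I + X\<^sub>i\<close>, orthogonality gives \<open>X\<^sub>i + X\<^sub>i\<^sup>T = - X\<^sub>i\<^sup>T X\<^sub>i\<close>: up to an error of second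
  order, \<open>X\<close> is skew, and there the quadratic form \<open>F\<close> is positive definite.
\<close>

lemma local_growth:
  assumes S: "S \<in> alignments" "C ** S = 0" and triv: "skew_flex_trivial E x S"
  obtains \<rho> \<mu> where "\<rho> > 0" "\<mu> > 0"
    "\<And>V. V \<in> alignments \<Longrightarrow> row_block V f = row_block S f \<Longrightarrow> norm (V - S) \<le> \<rho> \<Longrightarrow>
       \<mu> * (norm (V - S))\<^sup>2 \<le> F V \<and> \<mu> * norm (V - S) \<le> norm (G V)"
proof -
  obtain \<nu> where \<nu>: "\<nu> > 0"
    "\<And>W. block_transpose W = - W \<Longrightarrow> row_block W f = 0 \<Longrightarrow> \<nu> * (norm W)\<^sup>2 \<le> F (block_mult S W)"
    using skew_flex_positive[OF S triv] by blast
  \<comment> \<open>The bound 1 gives \<open>r\<^sup>2 \<le> r\<close>; the other gives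
    \<open>c * r \<le> \<nu> / 8\<close>, which keeps the cubic errors below a fraction of the
    quadratic term.\<close>
  define \<rho> where "\<rho> = min 1 (\<nu> / (8 * (c + 1)))"
  \<comment> \<open>The cost estimate leaves \<open>\<nu> / 4 - \<nu> / 8\<close>, the gradient
    estimate \<open>\<nu> - 3 * \<nu> / 8\<close>; the smaller one serves for both.\<close>
  define \<mu> where "\<mu> = \<nu> / 8"
  have c0: "c \<ge> 0" by simp
  show ?thesis
  proof (rule that[of \<rho> \<mu>])
    show "\<rho> > 0" "\<mu> > 0"
      using \<nu>(1) by (auto simp: \<rho>_def \<mu>_def intro!: divide_pos_pos add_nonneg_pos)
    fix V assume V: "V \<in> alignments" and Vf: "row_block V f = row_block S f" and r: "norm (V - S) \<le> \<rho>"
    define D where "D = V - S"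
    define X where "X = block_mult (block_transpose S) D"
    define W where "W = (1 / 2) *\<^sub>R (X - block_transpose X)"
    define H where "H = (1 / 2) *\<^sub>R (X + block_transpose X)"
    define r where "r = norm D"
    have r0: "r \<ge> 0" and r1: "r \<le> 1" and r2: "8 * (c + 1) * r \<le> \<nu>"
      using r c0 by (auto simp: r_def D_def \<rho>_def pos_le_divide_eq mult.commute)
    have SX: "block_mult S X = D"
      by (rule row_block_eqI) (simp add: X_def orthogonal_matrixD[OF alignmentsD[OF S(1)]])
    have nX: "norm X = r"
      using norm_block_mult_alignment[OF S(1), of X] by (simp add: SX r_def)
    have XWH: "X = W + H"
      by (simp add: W_def H_def algebra_simps flip: scaleR_add_left)
    have W_skew: "block_transpose W = - W"
      by (simp add: W_def block_transpose_linear scaleR_diff_right)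
    have "row_block D f = 0" using Vf by (simp add: D_def row_block_linear)
    then have Wf: "row_block W f = 0"
      by (simp add: W_def X_def row_block_linear)
    have nW: "norm W \<le> r"
    proof -
      have "norm W \<le> (1 / 2) * (norm X + norm (block_transpose X))"
        unfolding W_def norm_scaleR by (intro mult_mono norm_triangle_ineq4) auto
      then show ?thesis by (simp add: nX)
    qed
    have nH: "norm H \<le> r\<^sup>2 / 2"
    proof -
      have "X + block_transpose X = - block_mult (block_transpose X) X"
      proof (rule row_block_eqI)
        fix i
        let ?Q = "transpose (row_block S i) ** row_block V i"
        have Xi: "row_block X i = ?Q - mat 1"
          by (simp add: X_def D_def row_block_linear matrix_mult_diff orthogonal_matrixD[OF alignmentsD[OF S(1)]])
        have "orthogonal_matrix ?Q"
          by (intro orthogonal_matrix_mul) (simp_all add: alignmentsD S V)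
        then have "transpose ?Q ** ?Q = mat 1" by (simp add: orthogonal_matrixD)
        then show "row_block (X + block_transpose X) i = row_block (- block_mult (block_transpose X) X) i"
          unfolding row_block_linear row_block_mult_transpose Xi transpose_diff matrix_diff_mult matrix_mult_diff
          by simp
      qed
      then have "norm (X + block_transpose X) \<le> norm X * norm X"
        using norm_block_mult_le[of "block_transpose X" X] by simp
      then show ?thesis by (simp add: H_def nX power2_eq_square)
    qed
    have nW': "r / 2 \<le> norm W"
    proof -
      have "r \<le> norm W + norm H" using norm_triangle_ineq[of W H] by (simp add: nX flip: XWH)
      moreover have "r\<^sup>2 \<le> r" using r0 r1 by (simp add: power2_eq_square mult_left_le)
      ultimately show ?thesis using nH by simp
    qed
    define w h where "w = block_mult S W" and "h = block_mult S H"
    have D: "D = w + h" by (simp add: w_def h_def flip: block_mult_linear XWH SX)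
    have nw: "norm w = norm W" and nh: "norm h = norm H"
      by (simp_all add: w_def h_def norm_block_mult_alignment[OF S(1)])
    have CV: "C ** V = C ** D"
      using S(2) by (simp add: D_def matrix_mult_diff)
    have FV: "F V = F D"
    proof -
      have "V = S + D" by (simp add: D_def)
      then have "F V = F S + 2 * ((C ** S) \<bullet> D) + F D" by (simp only: F_add)
      then show ?thesis by (simp add: S(2) F_eq)
    qed
    have Fw: "\<nu> * (norm W)\<^sup>2 \<le> F w"
      unfolding w_def by (rule \<nu>(2)[OF W_skew Wf])
    have whe: "\<bar>(C ** w) \<bullet> h\<bar> \<le> c * norm W * (r\<^sup>2 / 2)"
      using inner_C_le[of w h] nH mult_left_mono[OF nH, of "c * norm W"] by (simp add: nw nh)
    have cW: "c * norm W * r\<^sup>2 \<le> c * r * r\<^sup>2"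
      using nW by (intro mult_right_mono mult_left_mono) auto
    have e1: "c * r * r\<^sup>2 \<le> (\<nu> / 8) * r\<^sup>2"
    proof (intro mult_right_mono)
      show "c * r \<le> \<nu> / 8" using r2 r0 by (simp add: algebra_simps)
    qed simp
    have W2: "r\<^sup>2 / 4 \<le> (norm W)\<^sup>2"
      using power_mono[OF nW', of 2] r0 by (simp add: power_divide)
    have "F V \<ge> \<nu> * (norm W)\<^sup>2 - c * norm W * r\<^sup>2"
      using Fw whe F_nonneg[of h] unfolding FV D F_add by (simp add: abs_le_iff)
    moreover have "\<nu> * (r\<^sup>2 / 4) \<le> \<nu> * (norm W)\<^sup>2"
      using W2 \<nu>(1) by (intro mult_left_mono) auto
    ultimately have growth: "\<mu> * r\<^sup>2 \<le> F V"
      using cW e1 by (simp add: \<mu>_def)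
    have "\<mu> * r \<le> norm (G V)"
    proof (cases "norm W = 0")
      case True
      then show ?thesis using nW' r0 by simp
    next
      case False
      define p q where pq_def: "p = c * norm W * (r\<^sup>2 / 2)" "q = c * r * (r * norm W)"
      \<comment> \<open>The gradient is tested against the tangent vector \<open>V W\<close>, which
        is the displacement up to second order. Its norm is that of \<open>W\<close>, so one factor
        \<open>norm W\<close> cancels in the end.\<close>
      have "block_mult V W = w + block_mult D W"
        by (simp add: w_def D_def block_mult_linear)
      then have eq: "G V \<bullet> block_mult V W = 2 * ((C ** D) \<bullet> w + (C ** D) \<bullet> block_mult D W)"
        unfolding rgrad_inner_skew[OF V W_skew] CV by (simp add: inner_add_right)
      have "(C ** D) \<bullet> w = F w + (C ** w) \<bullet> h"
      proof -
        have "(C ** h) \<bullet> w = (C ** w) \<bullet> h"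
          unfolding C_sym[of h] by (rule inner_commute)
        then show ?thesis
          by (simp add: D F_eq matrix_add_ldistrib inner_add_left)
      qed
      moreover have "\<bar>(C ** D) \<bullet> block_mult D W\<bar> \<le> c * r * (r * norm W)"
        using order_trans[OF inner_C_le mult_left_mono[OF norm_block_mult_le]] by (simp add: r_def)
      ultimately have "2 * (\<nu> * (norm W)\<^sup>2 - c * norm W * (r\<^sup>2 / 2) - c * r * (r * norm W)) \<le> G V \<bullet> block_mult V W"
        using Fw whe unfolding eq pq_def[symmetric] abs_le_iff by (smt (verit))
      also have "\<dots> \<le> norm (G V) * norm W"
        using norm_cauchy_schwarz[of "G V" "block_mult V W"] by (simp add: norm_block_mult_alignment[OF V])
      finally have "norm W * (2 * \<nu> * norm W - 3 * c * r\<^sup>2) \<le> norm W * norm (G V)"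
        by (simp add: algebra_simps power2_eq_square)
      then have "2 * \<nu> * norm W - 3 * c * r\<^sup>2 \<le> norm (G V)"
        using False by simp
      moreover have "\<nu> * r \<le> 2 * \<nu> * norm W"
        using mult_left_mono[OF nW', of "2 * \<nu>"] \<nu>(1) by simp
      moreover have "c * r\<^sup>2 \<le> (\<nu> / 8) * r"
        using mult_right_mono[of "c * r" "\<nu> / 8" r] r0 r2 by (simp add: algebra_simps power2_eq_square)
      moreover have "\<nu> * r \<ge> 0" using \<nu>(1) r0 by simp
      ultimately show ?thesis by (simp add: \<mu>_def)
    qed
    with growth show "\<mu> * (norm (V - S))\<^sup>2 \<le> F V \<and> \<mu> * norm (V - S) \<le> norm (G V)"
      by (simp add: r_def D_def)
  qed
qed


subsection \<open>Armijo steps\<close>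

lemma norm_rgrad_le:
  assumes V: "V \<in> alignments"
  shows "norm (G V) \<le> 2 * c * norm V"
proof -
  have "(norm (G V))\<^sup>2 / 2 \<le> norm (C ** V) * norm (G V)"
    unfolding rgrad_inner[OF V, symmetric] by (rule norm_cauchy_schwarz)
  also have "\<dots> \<le> c * norm V * norm (G V)"
    using norm_C_mult_le[of V] by (intro mult_right_mono) auto
  finally have "norm (G V) * norm (G V) \<le> norm (G V) * (2 * c * norm V)"
    by (simp add: power2_eq_square mult_ac)
  then show ?thesis
    by (cases "norm (G V) = 0") auto
qed

text \<open>A second-order expansion along the retraction, with constants independent of
  \<open>V\<close> and \<open>\<tau>\<close>: all alignments have the same norm, which bounds the
  gradient, and the error is proportional to the squared gradient.\<close>

lemma retract_descent:
  obtains K k where "K > 0" "k > 0"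
    "\<And>V \<tau>. V \<in> alignments \<Longrightarrow> 0 \<le> \<tau> \<Longrightarrow> \<tau> \<le> 1 \<Longrightarrow>
       retract V (- (\<tau> *\<^sub>R G V)) \<in> alignments \<and>
       F (retract V (- (\<tau> *\<^sub>R G V))) \<le> F V - \<tau> * (norm (G V))\<^sup>2 + K * \<tau>\<^sup>2 * (norm (G V))\<^sup>2 \<and>
       norm (retract V (- (\<tau> *\<^sub>R G V)) - V) \<le> k * \<tau> * norm (G V)"
proof -
  define n0 where "n0 = norm (id_stack :: real^'d^('m \<times> 'd))"
  define g where "g = 2 * c * n0"
  \<comment> \<open>Since \<open>g\<close> bounds every gradient, \<open>exp g\<close> bounds the
    exponential factor of the remainder; the number of views pays for summing block norms.\<close>
  define k1 where "k1 = real CARD('m) * (norm (mat 1 :: real^'d^'d) * exp g)"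
  define k where "k = 1 + k1 * g"
  \<comment> \<open>The summands come from the remainder paired with \<open>C V\<close> and from the
    quadratic term \<open>F \<Delta>\<close>; the 1 ensures \<open>K > 0\<close>.\<close>
  define K where "K = 2 * c * n0 * k1 + c * k\<^sup>2 + 1"
  have g0: "g \<ge> 0" and k10: "k1 \<ge> 0" by (auto simp: g_def k1_def n0_def)
  have "k > 0" using g0 k10 by (simp add: k_def add_pos_nonneg)
  have "K > 0" using k10 by (simp add: K_def n0_def add_nonneg_pos)
  show ?thesis
  proof (rule that[OF \<open>K > 0\<close> \<open>k > 0\<close>])
    fix V :: "real^'d^('m \<times> 'd)" and \<tau> :: real assume V: "V \<in> alignments" and \<tau>: "0 \<le> \<tau>" "\<tau> \<le> 1"
    let ?V = "row_block V" and ?P = "row_block (C ** V)"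
    have nV: "norm V = n0" unfolding n0_def by (rule norm_alignment[OF V])
    define \<gamma> where "\<gamma> = norm (G V)"
    have \<gamma>: "0 \<le> \<gamma>" "\<gamma> \<le> g" using norm_rgrad_le[OF V] by (simp_all add: \<gamma>_def g_def nV)
    \<comment> \<open>\<open>Z i\<close> is skew, so the exponentials of its multiples are
      orthogonal and the retraction stays among the alignments.\<close>
    define Z where "Z i = transpose (?V i) ** row_block (G V) i" for i
    have Z: "Z i = transpose (?V i) ** ?P i - transpose (?P i) ** ?V i" for i
      by (simp add: Z_def rgrad_block matrix_mult_diff orthogonal_matrixD[OF alignmentsD[OF V]] flip: matrix_mul_assoc)
    have VZ: "?V i ** Z i = row_block (G V) i" for i
      by (simp add: Z_def orthogonal_matrixD[OF alignmentsD[OF V]])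
    have Zsk: "transpose (- (\<tau> *\<^sub>R Z i)) = - (- (\<tau> *\<^sub>R Z i))" for i
      by (simp add: Z transpose_uminus transpose_scaleR transpose_diff matrix_transpose_mul scaleR_diff_right)
    have nZ: "norm (Z i) \<le> \<gamma>" for i
      using norm_row_block_le[of "G V" i] alignmentsD[OF V, of i] by (simp add: Z_def norm_orthogonal_mult \<gamma>_def)
    define Rt where "Rt = retract V (- (\<tau> *\<^sub>R G V))"
    have Rt: "row_block Rt i = ?V i ** mat_exp (- (\<tau> *\<^sub>R Z i))" for i
      by (simp add: Rt_def retract_def row_block_linear matrix_mult_uminus Z_def matrix_scalar_ac scalar_matrix_assoc[symmetric])
    have Rt_al: "Rt \<in> alignments"
      unfolding alignments_def
      using orthogonal_mat_exp[OF Zsk] alignmentsD[OF V] by (auto simp: Rt intro!: orthogonal_matrix_mul)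
    define R where "R = stack (\<lambda>i. mat_exp (- (\<tau> *\<^sub>R Z i)) - mat 1 - (- (\<tau> *\<^sub>R Z i)))"
    have "norm (row_block R i) \<le> norm (mat 1 :: real^'d^'d) * exp g * (\<tau>\<^sup>2 * \<gamma>\<^sup>2)" for i
    proof -
      have n: "norm (- (\<tau> *\<^sub>R Z i)) \<le> \<tau> * \<gamma>"
        using \<tau> nZ[of i] by (simp add: mult_left_mono)
      also have "\<dots> \<le> g" using \<tau> \<gamma> by (meson mult_left_le_one_le order_trans)
      finally have "exp (norm (- (\<tau> *\<^sub>R Z i))) \<le> exp g" by simp
      moreover have "(norm (- (\<tau> *\<^sub>R Z i)))\<^sup>2 \<le> \<tau>\<^sup>2 * \<gamma>\<^sup>2"
        using power_mono[OF n, of 2] by (simp add: power_mult_distrib)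
      ultimately have "norm (mat 1 :: real^'d^'d) * (norm (- (\<tau> *\<^sub>R Z i)))\<^sup>2 * exp (norm (- (\<tau> *\<^sub>R Z i)))
          \<le> norm (mat 1 :: real^'d^'d) * (\<tau>\<^sup>2 * \<gamma>\<^sup>2) * exp g"
        by (intro mult_mono mult_left_mono) auto
      with mat_exp_remainder[of "- (\<tau> *\<^sub>R Z i)"] show ?thesis
        by (simp add: R_def mult_ac)
    qed
    then have "(\<Sum>i\<in>UNIV. norm (row_block R i)) \<le> (\<Sum>i\<in>(UNIV :: 'm set). norm (mat 1 :: real^'d^'d) * exp g * (\<tau>\<^sup>2 * \<gamma>\<^sup>2))"
      by (intro sum_mono)
    then have nR: "norm R \<le> k1 * (\<tau>\<^sup>2 * \<gamma>\<^sup>2)"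
      using norm_le_sum_row_blocks[of R] by (simp add: k1_def mult.assoc)
    define \<Delta> where "\<Delta> = Rt - V"
    have \<Delta>: "\<Delta> = block_mult V R - \<tau> *\<^sub>R G V"
      by (rule row_block_eqI)
         (simp add: \<Delta>_def row_block_linear Rt R_def matrix_mult_diff matrix_add_ldistrib matrix_scalar_ac
           scalar_matrix_assoc[symmetric] VZ)
    have n\<Delta>: "norm \<Delta> \<le> k * \<tau> * \<gamma>"
    proof -
      have "norm \<Delta> \<le> norm R + \<tau> * \<gamma>"
        unfolding \<Delta> using norm_triangle_ineq4[of "block_mult V R" "\<tau> *\<^sub>R G V"] \<tau>
        by (simp add: norm_block_mult_alignment[OF V] \<gamma>_def)
      also have "k1 * (\<tau>\<^sup>2 * \<gamma>\<^sup>2) \<le> k1 * (\<tau> * (\<gamma> * g))"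
      proof (rule mult_left_mono[OF _ k10])
        have "\<tau>\<^sup>2 \<le> \<tau>" "\<gamma>\<^sup>2 \<le> \<gamma> * g"
          using \<tau> \<gamma> by (auto simp: power2_eq_square mult_left_le mult_left_mono)
        then show "\<tau>\<^sup>2 * \<gamma>\<^sup>2 \<le> \<tau> * (\<gamma> * g)"
          using \<tau> by (intro mult_mono) auto
      qed
      then have "norm R + \<tau> * \<gamma> \<le> k1 * (\<tau> * (\<gamma> * g)) + \<tau> * \<gamma>" using nR by simp
      also have "\<dots> = k * \<tau> * \<gamma>" by (simp add: k_def algebra_simps)
      finally show ?thesis .
    qed
    have "F Rt = F V + 2 * ((C ** V) \<bullet> \<Delta>) + F \<Delta>"
      using F_add[of V \<Delta>] by (simp add: \<Delta>_def)
    also have "2 * ((C ** V) \<bullet> \<Delta>) = 2 * ((C ** V) \<bullet> block_mult V R) - \<tau> * \<gamma>\<^sup>2"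
      by (simp add: \<Delta> inner_diff_right rgrad_inner[OF V] \<gamma>_def)
    also have "2 * ((C ** V) \<bullet> block_mult V R) \<le> 2 * (c * n0 * (k1 * (\<tau>\<^sup>2 * \<gamma>\<^sup>2)))"
    proof -
      have "(C ** V) \<bullet> block_mult V R \<le> c * n0 * norm R"
        using inner_C_le[of V "block_mult V R"] by (simp add: norm_block_mult_alignment[OF V] nV)
      also have "\<dots> \<le> c * n0 * (k1 * (\<tau>\<^sup>2 * \<gamma>\<^sup>2))" by (intro mult_left_mono nR) (simp add: n0_def)
      finally show ?thesis by simp
    qed
    also have "F \<Delta> \<le> c * (k\<^sup>2 * (\<tau>\<^sup>2 * \<gamma>\<^sup>2))"
    proof -
      have "(norm \<Delta>)\<^sup>2 \<le> k\<^sup>2 * (\<tau>\<^sup>2 * \<gamma>\<^sup>2)"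
        using power_mono[OF n\<Delta>, of 2] by (simp add: power_mult_distrib mult_ac)
      then show ?thesis by (intro order_trans[OF F_le] mult_left_mono) auto
    qed
    finally have "F Rt \<le> F V - \<tau> * \<gamma>\<^sup>2 + K * \<tau>\<^sup>2 * \<gamma>\<^sup>2 - \<tau>\<^sup>2 * \<gamma>\<^sup>2"
      by (simp add: K_def algebra_simps)
    then have "F Rt \<le> F V - \<tau> * \<gamma>\<^sup>2 + K * \<tau>\<^sup>2 * \<gamma>\<^sup>2"
      using mult_nonneg_nonneg[OF zero_le_power2[of \<tau>] zero_le_power2[of \<gamma>]] by linarith
    with Rt_al n\<Delta> show "retract V (- (\<tau> *\<^sub>R G V)) \<in> alignments \<and>
       F (retract V (- (\<tau> *\<^sub>R G V))) \<le> F V - \<tau> * (norm (G V))\<^sup>2 + K * \<tau>\<^sup>2 * (norm (G V))\<^sup>2 \<and>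
       norm (retract V (- (\<tau> *\<^sub>R G V)) - V) \<le> k * \<tau> * norm (G V)"
      by (simp add: Rt_def \<Delta>_def \<gamma>_def)
  qed
qed

end

context alignment_problem
begin

lemma trace_egrad_rgrad:
  assumes "V \<in> alignments"
  shows "trace (transpose (egrad E x V) ** G V) = (norm (G V))\<^sup>2"
  unfolding trace_transpose_mult egrad_def inner_scaleR_left rgrad_inner[OF assms] by simp

text \<open>Every trial step of size at most \<open>(1 - \<gamma>) / K\<close> passes the test, so
  backtracking stops at 1 or no lower than \<open>\<beta>\<close> times that threshold.\<close>

lemma armijo_step:
  assumes \<beta>: "0 < \<beta>" "\<beta> < 1" and \<gamma>: "0 < \<gamma>" "\<gamma> < 1"
  obtains a k where "0 < a" "0 < k"
    "\<And>V \<alpha>. V \<in> alignments \<Longrightarrow> \<alpha> = step_size E x \<beta> \<gamma> V \<Longrightarrow>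
       a \<le> \<alpha> \<and> \<alpha> \<le> 1 \<and> retract V (- (\<alpha> *\<^sub>R G V)) \<in> alignments \<and>
       F (retract V (- (\<alpha> *\<^sub>R G V))) \<le> F V - \<gamma> * \<alpha> * (norm (G V))\<^sup>2 \<and>
       norm (retract V (- (\<alpha> *\<^sub>R G V)) - V) \<le> k * \<alpha> * norm (G V)"
proof -
  obtain K k where K: "K > 0" and k: "k > 0" and descent:
    "\<And>V \<tau>. V \<in> alignments \<Longrightarrow> 0 \<le> \<tau> \<Longrightarrow> \<tau> \<le> 1 \<Longrightarrow>
       retract V (- (\<tau> *\<^sub>R G V)) \<in> alignments \<and>
       F (retract V (- (\<tau> *\<^sub>R G V))) \<le> F V - \<tau> * (norm (G V))\<^sup>2 + K * \<tau>\<^sup>2 * (norm (G V))\<^sup>2 \<and>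
       norm (retract V (- (\<tau> *\<^sub>R G V)) - V) \<le> k * \<tau> * norm (G V)"
    using retract_descent by blast
  define t where "t = (1 - \<gamma>) / K"
  define a where "a = min 1 (\<beta> * t)"
  have t: "t > 0" using K \<gamma> by (simp add: t_def)
  have a: "a > 0" using t \<beta> by (simp add: a_def)
  show ?thesis
  proof (rule that[OF a k])
    fix V :: "real^'d^('m \<times> 'd)" and \<alpha> assume V: "V \<in> alignments" and \<alpha>: "\<alpha> = step_size E x \<beta> \<gamma> V"
    define P where "P l \<longleftrightarrow> F (retract V (- (\<beta> ^ l *\<^sub>R G V))) - F V \<le> - \<gamma> * \<beta> ^ l * (norm (G V))\<^sup>2" for l :: nat
    have pow: "0 < \<beta> ^ l" "\<beta> ^ l \<le> 1" for l
      using \<beta> by (auto simp: power_le_one)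
    have small: "P l" if "\<beta> ^ l \<le> t" for l
    proof -
      have "K * \<beta> ^ l \<le> 1 - \<gamma>"
        using that K by (simp add: t_def field_simps)
      then have "K * \<beta> ^ l * (\<beta> ^ l * (norm (G V))\<^sup>2) \<le> (1 - \<gamma>) * (\<beta> ^ l * (norm (G V))\<^sup>2)"
        using pow[of l] by (intro mult_right_mono) auto
      then show ?thesis
        using descent[OF V less_imp_le[OF pow(1)[of l]] pow(2)] by (simp add: P_def algebra_simps power2_eq_square)
    qed
    have "\<exists>l. P l"
    proof -
      obtain l where "\<beta> ^ l < t" using real_arch_pow_inv[OF t \<beta>(2)] by blast
      then show ?thesis using small[of l] by auto
    qed
    define l where "l = (LEAST l. P l)"
    have Pl: "P l" unfolding l_def by (rule LeastI_ex) fact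
    have least: "l \<le> l'" if "P l'" for l' unfolding l_def using that by (rule Least_le)
    have "\<alpha> = (GREATEST a. \<exists>l. a = \<beta> ^ l \<and> P l)"
      unfolding \<alpha> step_size_def trace_egrad_rgrad[OF V] P_def ..
    \<comment> \<open>The greatest accepted power belongs to the least accepted exponent, because
      \<open>\<beta> < 1\<close>.\<close>
    also have "\<dots> = \<beta> ^ l"
      by (rule Greatest_equality) (use Pl least \<beta> in \<open>auto intro: power_decreasing\<close>)
    finally have \<alpha>l: "\<alpha> = \<beta> ^ l" .
    have "a \<le> \<alpha>"
    proof (cases l)
      case 0 then show ?thesis by (simp add: \<alpha>l a_def)
    next
      case (Suc l')
      then have "\<not> P l'" using least[of l'] by auto
      then have "t < \<beta> ^ l'" using small[of l'] by linarith
      then have "\<beta> * t \<le> \<beta> ^ l" using \<beta> Suc by simp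
      then show ?thesis by (simp add: \<alpha>l a_def)
    qed
    moreover have "F (retract V (- (\<alpha> *\<^sub>R G V))) \<le> F V - \<gamma> * \<alpha> * (norm (G V))\<^sup>2"
      using Pl by (simp add: P_def \<alpha>l)
    ultimately show "a \<le> \<alpha> \<and> \<alpha> \<le> 1 \<and> retract V (- (\<alpha> *\<^sub>R G V)) \<in> alignments \<and>
       F (retract V (- (\<alpha> *\<^sub>R G V))) \<le> F V - \<gamma> * \<alpha> * (norm (G V))\<^sup>2 \<and>
       norm (retract V (- (\<alpha> *\<^sub>R G V)) - V) \<le> k * \<alpha> * norm (G V)"
      using descent[OF V less_imp_le[OF pow(1)[of l]] pow(2)] pow(2)[of l] unfolding \<alpha>l by blast
  qed
qed

end


subsection \<open>Local linear convergence\<close>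

text \<open>Conjugating the skew matrices by \<open>Q\<close> carries flexes of
  \<open>S ** Q\<close> to flexes of \<open>S\<close>.\<close>

lemma skew_flex_trivial_mult_orthogonal:
  assumes Q: "orthogonal_matrix Q" and triv: "skew_flex_trivial E x S"
  shows "skew_flex_trivial E x (S ** Q)"
  unfolding skew_flex_trivial_def
proof (intro allI impI, elim conjE)
  fix X i j assume skew: "\<forall>i. transpose (X i) = - X i"
    and C: "C_mat E x ** stack (\<lambda>i. row_block (S ** Q) i ** X i) = 0"
  define Y where "Y i = Q ** X i ** transpose Q" for i
  have "transpose (Y i) = - Y i" for i
    using skew by (simp add: Y_def matrix_transpose_mul matrix_mult_uminus matrix_mul_assoc)
  moreover have "stack (\<lambda>i. row_block S i ** Y i) = stack (\<lambda>i. row_block (S ** Q) i ** X i) ** transpose Q"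
    by (simp add: stack_mult Y_def row_block_mult matrix_mul_assoc)
  then have "C_mat E x ** stack (\<lambda>i. row_block S i ** Y i) = 0"
    by (simp add: matrix_mul_assoc C)
  ultimately have "Y i = Y j"
    using triv[unfolded skew_flex_trivial_def, THEN spec[of _ Y]] by blast
  then have "transpose Q ** Y i ** Q = transpose Q ** Y j ** Q" by simp
  then show "X i = X j"
    by (simp add: Y_def orthogonal_matrixD[OF Q] flip: matrix_mul_assoc)
qed

section \<open>Normalization of the first block and convergence\<close>

lemma unreduce_alignments: "T \<in> reduced_alignments \<Longrightarrow> unreduce T \<in> alignments"
  by (simp add: reduced_alignments_def alignments_def unreduce_def orthogonal_matrix_id)

lemma reduce_reduced_alignments: "V \<in> alignments \<Longrightarrow> reduce V \<in> reduced_alignments"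
  by (simp add: reduced_alignments_def alignments_def reduce_def orthogonal_matrix_mul)

lemma unreduce_reduce: "V \<in> alignments \<Longrightarrow> unreduce (reduce V) = V ** transpose (row_block V first_view)"
  by (rule row_block_eqI) (auto simp: unreduce_def reduce_def row_block_mult alignments_def orthogonal_matrix_def)

lemma unreduce_diff:
  assumes "T \<in> reduced_alignments" "T' \<in> reduced_alignments"
  shows "unreduce T - unreduce T' = T - T'"
  by (rule row_block_eqI) (use assms in \<open>auto simp: unreduce_def reduced_alignments_def row_block_linear\<close>)

lemma row_block_unreduce_first: "row_block (unreduce T) first_view = mat 1"
  by (simp add: unreduce_def)

lemma norm_mult_orthogonal_diff_le:
  fixes Q :: "real^'a^'a"
  assumes "orthogonal_matrix Q"
  shows "norm (V ** Q - W) \<le> norm (V - W) + norm W * norm (Q - mat 1)"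
proof -
  have "V ** Q - W = (V - W) ** Q + W ** (Q - mat 1)"
    by (simp add: matrix_diff_mult matrix_mult_diff)
  then have "norm (V ** Q - W) \<le> norm ((V - W) ** Q) + norm (W ** (Q - mat 1))"
    by (simp add: norm_triangle_ineq)
  also have "\<dots> \<le> norm (V - W) + norm W * norm (Q - mat 1)"
    by (intro add_mono norm_matrix_mult_le) (simp add: norm_mult_orthogonal[OF assms])
  finally show ?thesis .
qed

text \<open>\<open>N\<close> is a ball of radius \<open>\<rho> / 2\<close> cut with a sublevel set.
  One normalized step moves by at most \<open>\<rho> / 2\<close>, so growth still applies to the
  result, and its smaller cost forces it back into the smaller ball.\<close>

lemma rgd_local_linear_convergence:
  fixes E :: "('n::finite \<times> 'm::{finite,linorder}) set" and x :: "'n \<Rightarrow> 'm \<Rightarrow> real^'d"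
  assumes conn: "graph_connected E" and S: "S \<in> alignments" "C_mat E x ** S = 0"
    and triv: "skew_flex_trivial E x S" and \<beta>: "0 < \<beta>" "\<beta> < 1" and \<gamma>: "0 < \<gamma>" "\<gamma> < 1"
  shows "rgd_converges_locally_linearly E x \<beta> \<gamma> (reduce S)"
proof -
  interpret alignment_problem E x by unfold_locales (rule conn)
  define Q where "Q = transpose (row_block S first_view)"
  define S' where "S' = unreduce (reduce S)"
  have Q: "orthogonal_matrix Q" using alignmentsD[OF S(1)] by (simp add: Q_def)
  have S'Q: "S' = S ** Q" using unreduce_reduce[OF S(1)] by (simp add: S'_def Q_def)
  have S': "S' \<in> alignments" "C ** S' = 0" "skew_flex_trivial E x S'" "row_block S' first_view = mat 1"
    using S triv Q unfolding S'Q
    by (auto simp: alignments_mult matrix_mul_assoc skew_flex_trivial_mult_orthogonal)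
       (simp add: S'_def row_block_unreduce_first flip: S'Q)
  have red: "reduce S \<in> reduced_alignments" by (rule reduce_reduced_alignments[OF S(1)])
  obtain \<rho> \<mu> where \<rho>: "\<rho> > 0" and \<mu>: "\<mu> > 0" and growth:
    "\<And>V. V \<in> alignments \<Longrightarrow> row_block V first_view = row_block S' first_view \<Longrightarrow> norm (V - S') \<le> \<rho> \<Longrightarrow>
       \<mu> * (norm (V - S'))\<^sup>2 \<le> F V \<and> \<mu> * norm (V - S') \<le> norm (G V)"
    using local_growth[OF S'(1-3), of first_view] by blast
  obtain a k where a: "0 < a" and k: "0 < k" and step:
    "\<And>V \<alpha>. V \<in> alignments \<Longrightarrow> \<alpha> = step_size E x \<beta> \<gamma> V \<Longrightarrow>
       a \<le> \<alpha> \<and> \<alpha> \<le> 1 \<and> retract V (- (\<alpha> *\<^sub>R G V)) \<in> alignments \<and>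
       F (retract V (- (\<alpha> *\<^sub>R G V))) \<le> F V - \<gamma> * \<alpha> * (norm (G V))\<^sup>2 \<and>
       norm (retract V (- (\<alpha> *\<^sub>R G V)) - V) \<le> k * \<alpha> * norm (G V)"
    using armijo_step[OF \<beta> \<gamma>] by blast
  \<comment> \<open>Renormalizing the first block can enlarge the displacement by the factor
    \<open>1 + norm S'\<close>.\<close>
  define k' where "k' = k * (1 + norm S')"
  \<comment> \<open>The first bound returns an iterate to the half ball by growth of the cost; the
    second limits the step, as \<open>\<gamma> * (\<alpha> * norm (G V))\<^sup>2\<close> is at most
    the current cost.\<close>
  define \<epsilon> where "\<epsilon> = min (\<mu> * (\<rho> / 2)\<^sup>2) (\<gamma> * (\<rho> / (2 * k'))\<^sup>2)"
  \<comment> \<open>A step removes at least the fraction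
    \<open>\<gamma> * a * \<mu>\<^sup>2 / (c + 1)\<close> of the cost; the maximum with 1/2 keeps
    the rate positive.\<close>
  define q2 where "q2 = max (1 / 2) (1 - \<gamma> * a * \<mu>\<^sup>2 / (c + 1))"
  have k': "k' > 0" using k by (simp add: k'_def add_pos_nonneg)
  have \<epsilon>: "\<epsilon> > 0" using \<mu> \<rho> \<gamma> k' by (simp add: \<epsilon>_def)
  have c1: "c + 1 > 0" using norm_ge_zero[of C] by linarith
  have q2: "0 < q2" "q2 < 1" using \<gamma> a \<mu> c1 by (auto simp: q2_def)
  define N where "N = {T \<in> reduced_alignments. norm (unreduce T - S') \<le> \<rho> / 2 \<and> F (unreduce T) \<le> \<epsilon>}"
  have inv: "rgd_step E x \<beta> \<gamma> T \<in> N \<and> F (unreduce (rgd_step E x \<beta> \<gamma> T)) \<le> q2 * F (unreduce T)" if T: "T \<in> N" for T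
  proof -
    define V where "V = unreduce T"
    define \<alpha> where "\<alpha> = step_size E x \<beta> \<gamma> V"
    define V' where "V' = retract V (- (\<alpha> *\<^sub>R G V))"
    define R where "R = row_block V' first_view"
    define W where "W = V' ** transpose R"
    have V: "V \<in> alignments" "row_block V first_view = mat 1" "norm (V - S') \<le> \<rho> / 2" "F V \<le> \<epsilon>"
      using T by (auto simp: N_def V_def unreduce_alignments row_block_unreduce_first)
    note st = step[OF V(1) \<alpha>_def, folded V'_def]
    have V': "V' \<in> alignments" using st by blast
    have R: "orthogonal_matrix R" using alignmentsD[OF V'] by (simp add: R_def)
    have eq: "rgd_step E x \<beta> \<gamma> T = reduce V'"
      by (simp add: rgd_step_def Let_def V_def V'_def \<alpha>_def)
    have W: "unreduce (reduce V') = W"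
      using unreduce_reduce[OF V'] by (simp add: W_def R_def)
    have FW: "F W = F V'" using R by (simp add: W_def F_mult_orthogonal)
    have Wal: "W \<in> alignments" using R V' by (simp add: W_def alignments_mult)
    have Wf: "row_block W first_view = row_block S' first_view"
      by (simp add: S'(4) row_block_unreduce_first flip: W)
    have dG: "\<gamma> * (\<alpha> * norm (G V))\<^sup>2 \<le> F V"
    proof -
      have "\<gamma> * \<alpha> * (norm (G V))\<^sup>2 \<le> F V"
        using st F_nonneg[of V'] by linarith
      moreover have "\<gamma> * (\<alpha> * norm (G V))\<^sup>2 = \<alpha> * (\<gamma> * \<alpha> * (norm (G V))\<^sup>2)"
        by (simp add: power2_eq_square)
      moreover have "\<alpha> * (\<gamma> * \<alpha> * (norm (G V))\<^sup>2) \<le> 1 * (\<gamma> * \<alpha> * (norm (G V))\<^sup>2)"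
        using st a \<gamma> by (intro mult_right_mono) auto
      ultimately show ?thesis by linarith
    qed
    also have "\<dots> \<le> \<gamma> * (\<rho> / (2 * k'))\<^sup>2" using V(4) by (simp add: \<epsilon>_def)
    finally have "(\<alpha> * norm (G V))\<^sup>2 \<le> (\<rho> / (2 * k'))\<^sup>2" using \<gamma> by simp
    then have \<alpha>G: "\<alpha> * norm (G V) \<le> \<rho> / (2 * k')"
      using \<rho> k' by (intro power2_le_imp_le[of "\<alpha> * norm (G V)"]) auto
    have "norm (transpose R - mat 1) \<le> norm (V' - V)"
    proof -
      have "transpose R - mat 1 = transpose (row_block (V' - V) first_view)"
        by (simp add: R_def row_block_linear V(2) transpose_diff)
      then show ?thesis by (simp add: norm_transpose norm_row_block_le)
    qed
    moreover have "norm V = norm S'" using norm_alignment V(1) S'(1) by metis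
    moreover have "norm (W - V) \<le> norm (V' - V) + norm V * norm (transpose R - mat 1)"
      unfolding W_def by (rule norm_mult_orthogonal_diff_le) (simp add: R)
    ultimately have "norm (W - V) \<le> norm (V' - V) + norm S' * norm (V' - V)"
      using mult_left_mono[of "norm (transpose R - mat 1)" "norm (V' - V)" "norm S'"] by simp
    also have "\<dots> = (1 + norm S') * norm (V' - V)" by (simp add: distrib_right)
    also have "\<dots> \<le> (1 + norm S') * (k * (\<alpha> * norm (G V)))"
      using st by (intro mult_left_mono) (auto simp: mult.assoc)
    also have "\<dots> = k' * (\<alpha> * norm (G V))" by (simp add: k'_def)
    also have "\<dots> \<le> k' * (\<rho> / (2 * k'))" using k' \<alpha>G by (intro mult_left_mono) auto
    also have "\<dots> = \<rho> / 2" using k' by simp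
    finally have "norm (W - S') \<le> \<rho>"
      using V(3) norm_triangle_ineq[of "W - V" "V - S'"] by simp
    from growth[OF Wal Wf this] have gW: "\<mu> * (norm (W - S'))\<^sup>2 \<le> F W" by blast
    \<comment> \<open>The cost is at most a multiple of the squared distance and the gradient at
      least a multiple of the distance, so the Armijo decrease is proportional to the cost
      itself.\<close>
    have FV': "F V' \<le> q2 * F V"
    proof -
      have "\<mu> * norm (V - S') \<le> norm (G V)"
        using growth[OF V(1)] V(2,3) S'(4) \<rho> by simp
      then have "(\<mu> * norm (V - S'))\<^sup>2 \<le> (norm (G V))\<^sup>2" using \<mu> by (intro power_mono) auto
      moreover have "F V \<le> (c + 1) * (norm (V - S'))\<^sup>2"
      proof -
        have "F V = F (S' + (V - S'))" by simp
        also have "\<dots> = F (V - S')" unfolding F_add using S'(2) by (simp add: F_eq)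
        also have "\<dots> \<le> c * (norm (V - S'))\<^sup>2" by (rule F_le)
        finally show ?thesis
          using zero_le_power2[of "norm (V - S')"] unfolding distrib_right by linarith
      qed
      then have "\<mu>\<^sup>2 / (c + 1) * F V \<le> (\<mu> * norm (V - S'))\<^sup>2"
      proof -
        have "F V / (c + 1) \<le> (norm (V - S'))\<^sup>2"
          using \<open>F V \<le> (c + 1) * (norm (V - S'))\<^sup>2\<close> c1 by (simp only: pos_divide_le_eq mult.commute)
        then have "\<mu>\<^sup>2 * (F V / (c + 1)) \<le> \<mu>\<^sup>2 * (norm (V - S'))\<^sup>2" by (rule mult_left_mono) simp
        then show ?thesis by (simp add: power_mult_distrib)
      qed
      ultimately have "\<mu>\<^sup>2 / (c + 1) * F V \<le> (norm (G V))\<^sup>2" by linarith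
      then have "\<gamma> * a * (\<mu>\<^sup>2 / (c + 1) * F V) \<le> \<gamma> * \<alpha> * (norm (G V))\<^sup>2"
        using st a \<gamma> c1 F_nonneg[of V] by (intro mult_mono) auto
      then have "F V' \<le> F V - \<gamma> * a * (\<mu>\<^sup>2 / (c + 1) * F V)" using st by linarith
      also have "\<dots> = (1 - \<gamma> * a * \<mu>\<^sup>2 / (c + 1)) * F V" by (simp add: algebra_simps)
      also have "\<dots> \<le> q2 * F V" using F_nonneg by (intro mult_right_mono) (auto simp: q2_def)
      finally show ?thesis .
    qed
    have F\<epsilon>: "F W \<le> \<epsilon>"
      using FV' V(4) q2 F_nonneg[of V] mult_right_mono[of q2 1 "F V"] by (simp add: FW)
    then have "\<mu> * (norm (W - S'))\<^sup>2 \<le> \<mu> * (\<rho> / 2)\<^sup>2" using gW by (simp add: \<epsilon>_def)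
    then have "(norm (W - S'))\<^sup>2 \<le> (\<rho> / 2)\<^sup>2" using \<mu> by simp
    then have "norm (W - S') \<le> \<rho> / 2" using \<rho> by (intro power2_le_imp_le[of "norm (W - S')"]) auto
    then show ?thesis
      using F\<epsilon> FV' FW reduce_reduced_alignments[OF V'] by (simp add: N_def eq W V_def)
  qed
  have iter: "rgd_iterate E x \<beta> \<gamma> T k \<in> N \<and> F (unreduce (rgd_iterate E x \<beta> \<gamma> T k)) \<le> q2 ^ k * F (unreduce T)" if T: "T \<in> N" for T k
  proof (induction k)
    case 0 then show ?case using T by (simp add: rgd_iterate_def)
  next
    case (Suc k)
    let ?T = "rgd_iterate E x \<beta> \<gamma> T k"
    have "F (unreduce (rgd_step E x \<beta> \<gamma> ?T)) \<le> q2 * F (unreduce ?T)" using inv Suc by blast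
    also have "\<dots> \<le> q2 * (q2 ^ k * F (unreduce T))" using Suc q2 by (intro mult_left_mono) auto
    finally show ?case using inv Suc by (simp add: rgd_iterate_def)
  qed
  \<comment> \<open>The cost decays like \<open>q2 ^ k\<close> and dominates the squared distance,
    whence the rate \<open>sqrt q2\<close>; adding 1 keeps the constant positive when the initial
    cost is zero.\<close>
  have conv: "norm (rgd_iterate E x \<beta> \<gamma> T k - reduce S) \<le> (sqrt (F (unreduce T) / \<mu>) + 1) * sqrt q2 ^ k" if T: "T \<in> N" for T k
  proof -
    define T' where "T' = rgd_iterate E x \<beta> \<gamma> T k"
    have T': "T' \<in> N" "F (unreduce T') \<le> q2 ^ k * F (unreduce T)" using iter[OF T] by (auto simp: T'_def)
    have "\<mu> * (norm (unreduce T' - S'))\<^sup>2 \<le> F (unreduce T')"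
      using growth[of "unreduce T'"] T'(1) \<rho> S'(4) by (auto simp: N_def unreduce_alignments row_block_unreduce_first)
    also have "unreduce T' - S' = T' - reduce S"
      using T'(1) red by (simp add: S'_def unreduce_diff N_def)
    finally have "(norm (T' - reduce S))\<^sup>2 \<le> q2 ^ k * (F (unreduce T) / \<mu>)"
      using T'(2) \<mu> by (simp add: field_simps)
    then have "norm (T' - reduce S) \<le> sqrt (q2 ^ k * (F (unreduce T) / \<mu>))" by (rule real_le_rsqrt)
    also have "\<dots> = sqrt (F (unreduce T) / \<mu>) * sqrt q2 ^ k" unfolding real_sqrt_mult real_sqrt_power by (rule mult.commute)
    also have "\<dots> \<le> (sqrt (F (unreduce T) / \<mu>) + 1) * sqrt q2 ^ k"
      using q2 by (intro mult_right_mono) auto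
    finally show ?thesis by (simp add: T'_def)
  qed
  \<comment> \<open>The square root converts the quadratic upper bound on the cost into the sublevel
    condition of \<open>N\<close>.\<close>
  define \<delta> where "\<delta> = min (\<rho> / 2) (sqrt (\<epsilon> / (c + 1)))"
  define U where "U = reduced_alignments \<inter> ball (reduce S) \<delta>"
  have \<delta>: "\<delta> > 0" using \<rho> \<epsilon> c1 by (simp add: \<delta>_def)
  have UN: "U \<subseteq> N"
  proof
    fix T assume T: "T \<in> U"
    then have d: "norm (unreduce T - S') < \<delta>" "T \<in> reduced_alignments"
      using red by (simp_all add: U_def S'_def unreduce_diff dist_norm norm_minus_commute)
    have "F (unreduce T) = F (S' + (unreduce T - S'))" by simp
    also have "\<dots> = F (unreduce T - S')" unfolding F_add using S'(2) by (simp add: F_eq)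
    also have "\<dots> \<le> c * (norm (unreduce T - S'))\<^sup>2" by (rule F_le)
    also have "\<dots> \<le> (c + 1) * (sqrt (\<epsilon> / (c + 1)))\<^sup>2"
      using d(1) by (intro mult_mono power_mono) (auto simp: \<delta>_def)
    also have "\<dots> = \<epsilon>" using \<epsilon> c1 by simp
    finally show "T \<in> N" using d by (simp add: N_def \<delta>_def)
  qed
  show ?thesis
    unfolding rgd_converges_locally_linearly_def
  proof (intro exI[of _ U] conjI ballI)
    show "openin (top_of_set reduced_alignments) U"
      unfolding U_def by (rule openin_open_Int) simp
    show "reduce S \<in> U" using red \<delta> by (simp add: U_def)
    fix T assume "T \<in> U"
    then have T: "T \<in> N" using UN by blast
    have "sqrt (F (unreduce T) / \<mu>) \<ge> 0" using F_nonneg \<mu> by simp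
    then have "sqrt (F (unreduce T) / \<mu>) + 1 > 0" by linarith
    then show "\<exists>c q. c > 0 \<and> 0 < q \<and> q < 1 \<and> (\<forall>k. norm (rgd_iterate E x \<beta> \<gamma> T k - reduce S) \<le> c * q ^ k)"
      using q2 conv[OF T] by (intro exI[of _ "sqrt (F (unreduce T) / \<mu>) + 1"] exI[of _ "sqrt q2"] conjI allI) simp_all
  qed
qed


subsection \<open>Infinitesimal rigidity implies local rigidity\<close>

context rigid_framework
begin

text \<open>\<open>\<Psi>\<close> records the images of differences of points within a view. It is
  injective by nondegeneracy, hence bounded below, and on the kernel of \<open>C\<close> it is read
  off from the realization.\<close>

lemma perfect_norm_diff_le:
  obtains B where "B > 0"
    "\<And>V. C_mat E x ** V = 0 \<Longrightarrow> norm (V - S) \<le> B * norm (realization E x V - realization E x S)"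
proof -
  define \<Psi> :: "real^'d^('m \<times> 'd) \<Rightarrow> real^'d^(('n \<times> 'n) \<times> 'm)"
    where "\<Psi> V = (\<chi> a. case a of ((k, l), i) \<Rightarrow>
      if (k, i) \<in> E \<and> (l, i) \<in> E then transpose (row_block V i) *v (x k i - x l i) else 0)" for V
  have lin: "linear \<Psi>"
    by (rule linearI)
       (auto simp: \<Psi>_def vec_eq_iff row_block_linear transpose_add transpose_scaleR matrix_vector_mult_add_rdistrib
         scaleR_matrix_vector_assoc[symmetric] split: prod.split)
  have "V = 0" if "\<Psi> V = 0" for V
  proof (rule row_block_eqI)
    fix i
    obtain l where l: "(l, i) \<in> E" using nondegenerate_obtain[OF nondeg] .
    have "transpose (row_block V i) *v x k i = transpose (row_block V i) *v x l i" if "(k, i) \<in> E" for k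
      using arg_cong[OF \<open>\<Psi> V = 0\<close>, of "\<lambda>v. v $ ((k, l), i)"] that l
      by (simp add: \<Psi>_def matrix_vector_mult_diff_distrib)
    then have "transpose (row_block V i) = 0"
      by (rule nondegenerate_mult[OF nondeg])
    then show "row_block V i = row_block 0 i"
      by (metis row_block_linear(5) transpose_transpose transpose_zero)
  qed
  then have "inj \<Psi>" by (simp add: linear_injective_0[OF lin])
  then obtain b where b: "b > 0" "\<And>V. b * norm V \<le> norm (\<Psi> V)"
    using linear_inj_bounded_below_pos[OF lin] by blast
  let ?N = "real CARD(('n \<times> 'n) \<times> 'm)"
  have N0: "?N > 0" by (simp only: of_nat_0_less_iff zero_less_card_finite)
  show ?thesis
  proof (rule that[of "2 * ?N / b"])
    show "2 * ?N / b > 0" using b N0 by simp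
    fix V :: "real^'d^('m \<times> 'd)" assume V: "C_mat E x ** V = 0"
    let ?D = "realization E x V - realization E x S"
    have col: "norm (column k M) \<le> norm M" for k and M :: "real^'n^'d"
    proof -
      have "column k M = transpose M $ k" by (simp add: column_def transpose_def vec_eq_iff)
      then show ?thesis using Finite_Cartesian_Product.norm_nth_le[of "transpose M" k] by (simp add: norm_transpose)
    qed
    have diff: "transpose (row_block W i) *v (x k i - x l i) = column k (realization E x W) - column l (realization E x W)"
      if W: "C_mat E x ** W = 0" "(k, i) \<in> E" "(l, i) \<in> E" for W k l i
    proof -
      obtain t where "\<And>k i. (k, i) \<in> E \<Longrightarrow> transpose (row_block W i) *v x k i = column k (realization E x W) + t i"
        using glues_realization[OF conn W(1)] unfolding glues_def by blast
      then show ?thesis using W(2,3) by (simp add: matrix_vector_mult_diff_distrib)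
    qed
    have "norm (\<Psi> (V - S) $ a) \<le> 2 * norm ?D" for a
    proof -
      obtain k l i where a: "a = ((k, l), i)" by (metis prod.exhaust)
      show ?thesis
      proof (cases "(k, i) \<in> E \<and> (l, i) \<in> E")
        case True
        have "\<Psi> (V - S) $ a = column k ?D - column l ?D"
          using True diff[OF V, of k i l] diff[OF perfect(2), of k i l]
          by (simp add: a \<Psi>_def row_block_linear transpose_diff matrix_vector_mult_diff_rdistrib)
             (simp add: column_def vec_eq_iff)
        then show ?thesis
          using norm_triangle_ineq4[of "column k ?D" "column l ?D"] col[of k ?D] col[of l ?D] by simp
      qed (auto simp: a \<Psi>_def)
    qed
    then have "(\<Sum>a\<in>UNIV. norm (\<Psi> (V - S) $ a)) \<le> (\<Sum>a\<in>(UNIV :: (('n \<times> 'n) \<times> 'm) set). 2 * norm ?D)"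
      by (intro sum_mono)
    then have "norm (\<Psi> (V - S)) \<le> ?N * (2 * norm ?D)"
      unfolding norm_vec_def[of "\<Psi> (V - S)"] using L2_set_le_sum[of UNIV "\<lambda>a. norm (\<Psi> (V - S) $ a)"]
      by (simp only: sum_constant) auto
    then have "b * norm (V - S) \<le> 2 * ?N * norm ?D" using b(2)[of "V - S"] by linarith
    then show "norm (V - S) \<le> 2 * ?N / b * norm ?D"
      using b(1) by (simp add: pos_le_divide_eq mult.commute)
  qed
qed

text \<open>A perfect alignment with a nearby realization is close to \<open>S\<close>. Once its
  block \<open>f\<close> is turned onto that of \<open>S\<close>, quadratic growth forces equality
  because its cost is zero.\<close>

lemma skew_flex_trivial_imp_locally_rigid:
  assumes triv: "skew_flex_trivial E x S"
  shows "locally_rigid E x S"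
proof -
  interpret alignment_problem E x by unfold_locales (rule conn)
  define f :: 'm where "f = undefined"
  obtain \<rho> \<mu> where \<rho>: "\<rho> > 0" and \<mu>: "\<mu> > 0" and growth:
    "\<And>V. V \<in> alignments \<Longrightarrow> row_block V f = row_block S f \<Longrightarrow> norm (V - S) \<le> \<rho> \<Longrightarrow>
       \<mu> * (norm (V - S))\<^sup>2 \<le> F V \<and> \<mu> * norm (V - S) \<le> norm (G V)"
    using local_growth[OF perfect triv, of f] by blast
  obtain B where B: "B > 0"
    "\<And>V. C_mat E x ** V = 0 \<Longrightarrow> norm (V - S) \<le> B * norm (realization E x V - realization E x S)"
    using perfect_norm_diff_le by blast
  \<comment> \<open>\<open>B\<close> passes from realizations to alignments, and
    \<open>1 + norm S\<close> pays for matching block \<open>f\<close>.\<close>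
  define \<epsilon> where "\<epsilon> = \<rho> / ((1 + norm S) * B)"
  have s1: "1 + norm S > 0" by (simp add: add_pos_nonneg)
  have "\<epsilon> > 0" using \<rho> B(1) s1 by (simp add: \<epsilon>_def)
  moreover have "\<exists>Q. orthogonal_matrix Q \<and> realization E x V = realization E x (S ** Q)"
    if V: "perfect_alignment E x V" and near: "norm (realization E x V - realization E x S) < \<epsilon>" for V
  proof -
    have Val: "V \<in> alignments" and VC: "C ** V = 0"
      using V by (auto simp: perfect_alignment_iff[OF conn])
    define Q where "Q = transpose (row_block V f) ** row_block S f"
    have Q: "orthogonal_matrix Q"
      using alignmentsD[OF Val] orth by (simp add: Q_def orthogonal_matrix_mul)
    have "norm (Q - mat 1) \<le> norm (V - S)"
    proof -
      have "Q - mat 1 = - (transpose (row_block V f) ** row_block (V - S) f)"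
        by (simp add: Q_def row_block_linear matrix_mult_diff orthogonal_matrixD[OF alignmentsD[OF Val]])
      then show ?thesis
        using alignmentsD[OF Val, of f] by (simp add: norm_orthogonal_mult norm_row_block_le)
    qed
    then have "norm (V ** Q - S) \<le> (1 + norm S) * norm (V - S)"
      using norm_mult_orthogonal_diff_le[OF Q, of V S] mult_left_mono[of "norm (Q - mat 1)" "norm (V - S)" "norm S"]
      by (simp add: distrib_right)
    also have "\<dots> \<le> (1 + norm S) * (B * \<epsilon>)"
      using B near s1 by (intro mult_left_mono order_trans[OF B(2)[OF VC]]) auto
    also have "\<dots> = \<rho>" using B(1) s1 by (simp add: \<epsilon>_def)
    finally have "norm (V ** Q - S) \<le> \<rho>" .
    moreover have "row_block (V ** Q) f = row_block S f"
      using alignmentsD[OF Val, of f] by (simp add: row_block_mult Q_def orthogonal_matrixD)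
    ultimately have "\<mu> * (norm (V ** Q - S))\<^sup>2 \<le> F (V ** Q)"
      using growth alignments_mult[OF Val Q] by blast
    also have "F (V ** Q) = 0"
      unfolding F_mult_orthogonal[OF Q] by (simp add: F_eq VC)
    finally have "V ** Q = S" using \<mu> by (simp add: mult_le_0_iff)
    moreover have "V ** Q ** transpose Q = V"
      using orthogonal_matrixD(2)[OF Q] by (simp flip: matrix_mul_assoc)
    ultimately have "V = S ** transpose Q" by simp
    then show ?thesis using Q by (intro exI[of _ "transpose Q"]) auto
  qed
  ultimately show ?thesis unfolding locally_rigid_def by blast
qed

end

subsection \<open>Rational polynomial functions and generic rank\<close>

definition rat_poly :: "(('n::finite \<Rightarrow> real^'d) \<Rightarrow> real) \<Rightarrow> bool" where
  "rat_poly P \<longleftrightarrow> (\<exists>f. P = eval_poly f)"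

text \<open>The product runs over all coordinates, those outside the support contributing 1, so that
  monomials multiply by adding exponents.\<close>

definition mono_val :: "(('n::finite \<times> 'd::finite) \<Rightarrow>\<^sub>0 nat) \<Rightarrow> ('n \<Rightarrow> real^'d) \<Rightarrow> real" where
  "mono_val e y = (\<Prod>a\<in>UNIV. (y (fst a) $ snd a) ^ Poly_Mapping.lookup e a)"

lemma eval_poly_eq:
  assumes "finite A" "Poly_Mapping.keys f \<subseteq> A"
  shows "eval_poly f y = (\<Sum>e\<in>A. of_rat (Poly_Mapping.lookup f e) * mono_val e y)"
proof -
  have "(\<Prod>(k, c)\<in>Poly_Mapping.keys e. (y k $ c) ^ Poly_Mapping.lookup e (k, c)) = mono_val e y" for e
    unfolding mono_val_def case_prod_unfold prod.collapse
    by (rule prod.mono_neutral_left) (auto simp: in_keys_iff)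
  then have "eval_poly f y = (\<Sum>e\<in>Poly_Mapping.keys f. of_rat (Poly_Mapping.lookup f e) * mono_val e y)"
    by (simp add: eval_poly_def)
  also have "\<dots> = (\<Sum>e\<in>A. of_rat (Poly_Mapping.lookup f e) * mono_val e y)"
    by (rule sum.mono_neutral_left) (use assms in \<open>auto simp: in_keys_iff\<close>)
  finally show ?thesis .
qed

lemma rat_poly_monomial: "rat_poly (\<lambda>y. of_rat q * mono_val e y)"
proof -
  have "eval_poly (Poly_Mapping.single e q) y = of_rat q * mono_val e y" for y
    by (subst eval_poly_eq[of "{e}"]) auto
  then show ?thesis unfolding rat_poly_def by (intro exI[of _ "Poly_Mapping.single e q"]) auto
qed

lemma rat_poly_add: "rat_poly P \<Longrightarrow> rat_poly Q \<Longrightarrow> rat_poly (\<lambda>y. P y + Q y)"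
proof -
  assume "rat_poly P" "rat_poly Q"
  then obtain f g where fg: "P = eval_poly f" "Q = eval_poly g" by (auto simp: rat_poly_def)
  let ?A = "Poly_Mapping.keys f \<union> Poly_Mapping.keys g"
  have "Poly_Mapping.keys (f + g) \<subseteq> ?A" by (rule Poly_Mapping.keys_add)
  then have "eval_poly (f + g) y = eval_poly f y + eval_poly g y" for y
    by (simp add: eval_poly_eq[of ?A] lookup_add of_rat_add distrib_right sum.distrib)
  then show ?thesis unfolding rat_poly_def fg by (intro exI[of _ "f + g"]) auto
qed

lemma rat_poly_const: "rat_poly (\<lambda>_. of_rat q)"
  using rat_poly_monomial[of q 0] by (simp add: mono_val_def)

lemma rat_poly_sum: "(\<And>i. i \<in> I \<Longrightarrow> rat_poly (P i)) \<Longrightarrow> rat_poly (\<lambda>y. \<Sum>i\<in>I. P i y)"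
  by (induction I rule: infinite_finite_induct) (use rat_poly_const[of 0] in \<open>auto intro: rat_poly_add\<close>)

lemma mono_val_add: "mono_val (a + b) y = mono_val a y * mono_val b y"
  by (simp add: mono_val_def lookup_add power_add prod.distrib)

lemma rat_poly_mult: "rat_poly P \<Longrightarrow> rat_poly Q \<Longrightarrow> rat_poly (\<lambda>y. P y * Q y)"
proof -
  assume "rat_poly P" "rat_poly Q"
  then obtain f g where fg: "P = eval_poly f" "Q = eval_poly g" by (auto simp: rat_poly_def)
  have "P y * Q y = (\<Sum>a\<in>Poly_Mapping.keys f. \<Sum>b\<in>Poly_Mapping.keys g.
      of_rat (Poly_Mapping.lookup f a * Poly_Mapping.lookup g b) * mono_val (a + b) y)" for y
    unfolding fg eval_poly_eq[OF finite_keys order_refl] sum_product mono_val_add of_rat_mult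
    by (simp add: mult_ac)
  then show ?thesis by (simp add: rat_poly_sum rat_poly_monomial)
qed

lemma rat_poly_prod: "(\<And>i. i \<in> I \<Longrightarrow> rat_poly (P i)) \<Longrightarrow> rat_poly (\<lambda>y. \<Prod>i\<in>I. P i y)"
  by (induction I rule: infinite_finite_induct) (use rat_poly_const[of 1] in \<open>auto intro: rat_poly_mult\<close>)

lemma rat_poly_coord: "rat_poly (\<lambda>y. y k $ c)"
proof -
  have "mono_val (Poly_Mapping.single (k, c) 1) y = (\<Prod>a\<in>UNIV. if a = (k, c) then y k $ c else 1)" for y :: "'a \<Rightarrow> real^'b"
    unfolding mono_val_def by (rule prod.cong) (auto simp: lookup_single when_def)
  then have "mono_val (Poly_Mapping.single (k, c) 1) y = y k $ c" for y :: "'a \<Rightarrow> real^'b"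
    by simp
  then show ?thesis using rat_poly_monomial[of 1 "Poly_Mapping.single (k, c) 1"] by simp
qed

lemma rat_poly_diff: "rat_poly P \<Longrightarrow> rat_poly Q \<Longrightarrow> rat_poly (\<lambda>y. P y - Q y)"
  using rat_poly_add[of P "\<lambda>y. of_rat (- 1) * Q y"] rat_poly_mult[OF rat_poly_const[of "- 1"], of Q]
  by (simp add: of_rat_minus)

lemma rat_poly_if: "rat_poly P \<Longrightarrow> rat_poly Q \<Longrightarrow> rat_poly (\<lambda>y. if b then P y else Q y)"
  by (cases b) simp_all

lemma rat_poly_0: "rat_poly (\<lambda>_. 0)" and rat_poly_1: "rat_poly (\<lambda>_. 1)"
  using rat_poly_const[of 0] rat_poly_const[of 1] by simp_all

lemma rat_poly_of_int: "rat_poly (\<lambda>_. of_int z)"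
  using rat_poly_const[of "of_int z"] by simp

lemma rat_poly_det:
  fixes A :: "('n::finite \<Rightarrow> real^'d) \<Rightarrow> real^'e^'e"
  assumes "\<And>i j. rat_poly (\<lambda>y. A y $ i $ j)"
  shows "rat_poly (\<lambda>y. det (A y))"
  unfolding det_def by (intro rat_poly_sum rat_poly_mult rat_poly_of_int rat_poly_prod assms)

lemma generic_rat_poly_eq_0:
  assumes "generic_points q" "rat_poly P" "P q = 0"
  shows "P y = 0"
proof -
  obtain f where f: "P = eval_poly f" using assms(2) by (auto simp: rat_poly_def)
  then have "f = 0" using assms(1,3) by (auto simp: generic_points_def)
  then show ?thesis by (simp add: f eval_poly_def)
qed

lemma det_nz_iff_kernel: "det A \<noteq> 0 \<longleftrightarrow> (\<forall>u. A *v u = 0 \<longrightarrow> u = 0)" for A :: "real^'e^'e"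
  unfolding invertible_det_nz[symmetric] invertible_left_inverse matrix_left_invertible_ker ..

text \<open>Independence of a maximal set \<open>J\<close> of columns of \<open>A y\<close> is
  witnessed by a determinant that is a rational polynomial. Being nonzero at \<open>y\<close>, it
  cannot vanish at the generic \<open>q\<close>, so the columns \<open>J\<close> of
  \<open>A q\<close> are independent too.\<close>

lemma generic_rank_max:
  fixes A :: "('n::finite \<Rightarrow> real^'d) \<Rightarrow> real^'e^'f"
  assumes rat: "\<And>i j. rat_poly (\<lambda>y. A y $ i $ j)" and gen: "generic_points q"
  shows "rank (A y) \<le> rank (A q)"
proof -
  obtain B where B: "B \<subseteq> columns (A y)" "independent B" "card B = dim (columns (A y))"
    using basis_exists[of "columns (A y)"] by metis
  have "\<forall>b\<in>B. \<exists>j. column j (A y) = b" using B(1) by (auto simp: columns_def)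
  then obtain \<kappa> where \<kappa>: "\<And>b. b \<in> B \<Longrightarrow> column (\<kappa> b) (A y) = b" by metis
  define J where "J = \<kappa> ` B"
  have inj: "inj_on \<kappa> B" using \<kappa> by (metis inj_onI)
  have cardJ: "card J = rank (A y)"
    by (simp add: J_def card_image[OF inj] B(3) column_rank_def)
  have finB: "finite B" using B(2) by (rule independent_imp_finite)
  \<comment> \<open>The Gram matrix of the columns plus the identity on the coordinates outside
    \<open>J\<close>. Its kernel consists of the linear relations supported in \<open>J\<close>, and
    its size is that of the full index type, so no minors have to be formed.\<close>
  define M where "M y = (\<chi> i j. (\<Sum>l\<in>UNIV. A y $ l $ i * A y $ l $ j) + (if i = j \<and> i \<notin> J then 1 else 0))" for y
  have M: "M y *v u = transpose (A y) *v (A y *v u) + (\<chi> i. if i \<notin> J then u $ i else 0)" for y u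
  proof -
    have "(M y *v u) $ i = (transpose (A y) ** A y *v u) $ i + (\<Sum>j\<in>UNIV. if j = i then (if i \<notin> J then u $ i else 0) else 0)" for i
      unfolding M_def matrix_vector_mult_def matrix_matrix_mult_def transpose_def vec_lambda_beta distrib_right sum.distrib
      by (intro arg_cong2[of _ _ _ _ "(+)"] sum.cong refl) auto
    then show ?thesis
      by (simp add: vec_eq_iff matrix_vector_mul_assoc)
  qed
  have ratM: "rat_poly (\<lambda>y. M y $ i $ j)" for i j
    unfolding M_def vec_lambda_beta
    by (intro rat_poly_add rat_poly_sum rat_poly_mult rat rat_poly_if rat_poly_0 rat_poly_1)
  have "u = 0" if "M y *v u = 0" for u
  proof -
    have "u \<bullet> (\<chi> i. if i \<notin> J then u $ i else 0) = (\<Sum>i\<in>UNIV. if i \<notin> J then (u $ i)\<^sup>2 else 0)"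
      by (auto simp: inner_vec_def power2_eq_square intro!: sum.cong)
    moreover have "u \<bullet> (transpose (A y) *v (A y *v u)) = (norm (A y *v u))\<^sup>2"
      by (simp add: power2_norm_eq_inner flip: inner_mult_vec_left)
    ultimately have "(norm (A y *v u))\<^sup>2 + (\<Sum>i\<in>UNIV. if i \<notin> J then (u $ i)\<^sup>2 else 0) = 0"
      using arg_cong[OF that, of "\<lambda>w. u \<bullet> w"] by (simp add: M inner_add_right)
    moreover have "(\<Sum>i\<in>UNIV. if i \<notin> J then (u $ i)\<^sup>2 else 0) \<ge> 0" by (intro sum_nonneg) auto
    ultimately have Au: "A y *v u = 0" and s0: "(\<Sum>i\<in>UNIV. if i \<notin> J then (u $ i)\<^sup>2 else 0) = 0"
      by (auto simp: add_nonneg_eq_0_iff)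
    have u0: "u $ i = 0" if "i \<notin> J" for i
      using s0 that by (subst (asm) sum_nonneg_eq_0_iff) (auto split: if_splits)
    have "0 = (\<Sum>j\<in>UNIV. u $ j *\<^sub>R column j (A y))"
      using Au by (simp add: matrix_mult_sum scalar_mult_eq_scaleR)
    also have "\<dots> = (\<Sum>j\<in>J. u $ j *\<^sub>R column j (A y))"
      by (rule sum.mono_neutral_right) (auto simp: u0)
    also have "\<dots> = (\<Sum>b\<in>B. u $ \<kappa> b *\<^sub>R b)"
      unfolding J_def by (simp add: sum.reindex[OF inj] \<kappa>)
    finally have "u $ \<kappa> b = 0" if "b \<in> B" for b
      using independentD[OF B(2) finB order_refl, of "\<lambda>b. u $ \<kappa> b"] that by simp
    then have "u $ i = 0" for i using u0 by (cases "i \<in> J") (auto simp: J_def)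
    then show ?thesis by (simp add: vec_eq_iff)
  qed
  then have "det (M y) \<noteq> 0"
    unfolding det_nz_iff_kernel by blast
  then have "det (M q) \<noteq> 0"
    using generic_rat_poly_eq_0[OF gen rat_poly_det[OF ratM]] by blast
  then have injM: "u = 0" if "M q *v u = 0" for u
    using that unfolding det_nz_iff_kernel by blast
  define W :: "(real^'e) set" where "W = {u. \<forall>i. i \<notin> J \<longrightarrow> u $ i = 0}"
  have subW: "subspace W" by (auto simp: W_def subspace_def)
  have dimW: "dim W = card J"
    unfolding W_def using dim_substandard_cart[of J, where 'a = real] by (simp only: dim_vec_eq)
  have "inj_on ((*v) (A q)) (span W)"
  proof (rule inj_onI)
    fix u v assume "u \<in> span W" "v \<in> span W" and eq: "A q *v u = A q *v v"
    then have "u - v \<in> W" using subW span_eq_iff[THEN iffD2, OF subW] by (auto simp: subspace_diff)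
    then have "(\<chi> i. if i \<notin> J then (u - v) $ i else 0) = 0"
      by (simp add: W_def vec_eq_iff)
    moreover have "A q *v (u - v) = 0" using eq by (simp add: matrix_vector_mult_diff_distrib)
    ultimately have "M q *v (u - v) = 0" by (simp only: M) simp
    then show "u = v" using injM[of "u - v"] by simp
  qed
  then have "dim ((*v) (A q) ` W) = dim W"
    by (intro dim_image_eq) auto
  moreover have "dim ((*v) (A q) ` W) \<le> rank (A q)"
    unfolding rank_dim_range by (rule dim_subset) auto
  ultimately show ?thesis using cardJ dimW by simp
qed


subsection \<open>Curves in the fibres of a quadratic map of maximal rank\<close>

text \<open>
  \<open>R u\<close> is half the derivative at \<open>u\<close> of the quadratic map \<open>u \<mapsto> R u *v u\<close>.  Completing it to a local
  diffeomorphism by a map \<open>Pr\<close> onto the kernel of \<open>R p\<close>, the preimage of a line in the kernel is a curve along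
  which the velocity lies in the kernel of \<open>R\<close>, because the rank cannot exceed its value at \<open>p\<close>.
\<close>

lemma quadratic_fibre_curve:
  fixes R :: "real^'a \<Rightarrow> real^'a^'b"
  assumes lin: "linear R" and sym: "\<And>u v. R u *v v = R v *v u"
    and max: "\<And>u. rank (R u) \<le> rank (R p)" and v: "R p *v v = 0"
  obtains \<delta> y where "\<delta> > 0" "y 0 = p" "(y has_vector_derivative v) (at 0)"
    "\<And>t. \<bar>t\<bar> < \<delta> \<Longrightarrow> R (y t) *v y t = R p *v p" "continuous (at 0) y"
proof -
  define K where "K = {u. R p *v u = 0}"
  have subK: "subspace K" unfolding K_def by (rule subspace_kernel)
  obtain B where B: "B \<subseteq> K" "independent B" "K \<subseteq> span B"
    using basis_exists[of K] by metis
  have finB: "finite B" using B(2) by (rule independent_imp_finite)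
  \<comment> \<open>\<open>B\<close> need not be orthonormal, so this need not be a projection. What
    matters is that it maps into \<open>K\<close> and that, on \<open>K\<close>, the form
    \<open>u \<bullet> Pr u\<close> vanishes only at 0.\<close>
  define Pr where "Pr u = (\<Sum>b\<in>B. (b \<bullet> u) *\<^sub>R b)" for u
  have linPr: "linear Pr"
    by (rule linearI) (simp_all add: Pr_def inner_add_right scaleR_add_left sum.distrib scaleR_sum_right)
  have PrK: "Pr u \<in> K" for u
    unfolding Pr_def using B(1) subK by (intro subspace_sum subspace_scale) auto
  have inner_Pr: "u \<bullet> Pr u = (\<Sum>b\<in>B. (b \<bullet> u)\<^sup>2)" for u
    by (simp add: Pr_def inner_sum_right power2_eq_square inner_commute[of u])
  have PrK0: "u = 0" if "u \<in> K" "(\<Sum>b\<in>B. (b \<bullet> u)\<^sup>2) = 0" for u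
  proof -
    have "u \<bullet> b = 0" if "b \<in> B" for b
      using \<open>(\<Sum>b\<in>B. (b \<bullet> u)\<^sup>2) = 0\<close> that finB by (simp add: sum_nonneg_eq_0_iff inner_commute)
    moreover have "u \<in> span B" using \<open>u \<in> K\<close> B(3) by blast
    ultimately have "orthogonal u u"
      by (intro orthogonal_to_span[of u B u]) (auto simp: orthogonal_def)
    then show ?thesis by (simp add: orthogonal_def)
  qed
  let ?Rt = "transpose (R p)"
  have orthK: "(?Rt *v w) \<bullet> u = 0" if "u \<in> K" for u w
    using that by (simp add: inner_mult_vec_left K_def)
  define Q where "Q u = R u *v u" for u
  define N where "N u w = 2 *\<^sub>R (?Rt *v (R u *v w)) + Pr w" for u w
  \<comment> \<open>The first part has values in the range of \<open>transpose (R p)\<close>, the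
    orthogonal complement of \<open>K\<close>, the second in \<open>K\<close>; together they give a
    map of the space to itself with derivative \<open>N u\<close>.\<close>
  define H where "H u = ?Rt *v Q u + Pr u" for u
  have linN: "linear (N u)" for u
    unfolding N_def by (intro linear_compose_add linear_compose_scale_right linPr)
      (rule linearI; simp add: matrix_vector_right_distrib matrix_vector_mult_scaleR)
  have blN: "bounded_linear (N u)" for u using linN by (rule linear_conv_bounded_linear[THEN iffD1])
  have "bilinear (\<lambda>u w. R u *v w)"
    unfolding bilinear_def
    by (auto intro!: linearI simp: linear_add[OF lin] linear_scale[OF lin] matrix_vector_right_distrib
        matrix_vector_mult_scaleR matrix_vector_mult_add_rdistrib scaleR_matrix_vector_assoc[symmetric])
  then have bb: "bounded_bilinear (\<lambda>u w. R u *v w)" by (simp add: bilinear_conv_bounded_bilinear)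
  have derQ: "(Q has_derivative (\<lambda>w. 2 *\<^sub>R (R u *v w))) (at u)" for u
  proof -
    have "(Q has_derivative (\<lambda>w. R u *v w + R w *v u)) (at u)"
      unfolding Q_def using bounded_bilinear.FDERIV[OF bb has_derivative_ident has_derivative_ident] .
    then show ?thesis by (simp add: sym[of _ u] scaleR_2)
  qed
  have derH: "(H has_derivative N u) (at u)" for u
  proof -
    have blRt: "bounded_linear (\<lambda>w. ?Rt *v w)" and blPr: "bounded_linear Pr"
      using linPr by (auto simp: linear_conv_bounded_linear[symmetric])
    have "(H has_derivative (\<lambda>w. ?Rt *v (2 *\<^sub>R (R u *v w)) + Pr w)) (at u)"
      unfolding H_def
      by (intro has_derivative_add bounded_linear.has_derivative[OF blRt derQ]
          bounded_linear.has_derivative[OF blPr has_derivative_ident])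
    then show ?thesis by (simp add: N_def[abs_def] matrix_vector_mult_scaleR)
  qed
  define f' where "f' u = Blinfun (N u)" for u
  have f': "blinfun_apply (f' u) = N u" for u
    unfolding f'_def by (rule bounded_linear_Blinfun_apply[OF blN])
  have contf': "continuous_on UNIV f'"
  proof (rule continuous_on_blinfun_componentwise)
    fix i :: "real^'a" assume "i \<in> Basis"
    have "bounded_linear (\<lambda>u. ?Rt *v (R u *v i))"
      by (rule linear_conv_bounded_linear[THEN iffD1])
         (rule linearI; simp add: linear_add[OF lin] linear_scale[OF lin] matrix_vector_right_distrib
           matrix_vector_mult_scaleR matrix_vector_mult_add_rdistrib scaleR_matrix_vector_assoc[symmetric])
    then show "continuous_on UNIV (\<lambda>u. f' u i)"
      unfolding f' N_def by (intro continuous_intros linear_continuous_on)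
  qed
  have Np0: "w = 0" if "N p w = 0" for w
  proof -
    have "w \<bullet> (?Rt *v (R p *v w)) = (norm (R p *v w))\<^sup>2"
      by (simp add: power2_norm_eq_inner flip: inner_mult_vec_left)
    then have "2 * (norm (R p *v w))\<^sup>2 + (\<Sum>b\<in>B. (b \<bullet> w)\<^sup>2) = 0"
      using arg_cong[OF that, of "\<lambda>z. w \<bullet> z"] by (simp add: N_def inner_add_right inner_Pr)
    moreover have "(\<Sum>b\<in>B. (b \<bullet> w)\<^sup>2) \<ge> 0" by (intro sum_nonneg) auto
    ultimately have "R p *v w = 0" "(\<Sum>b\<in>B. (b \<bullet> w)\<^sup>2) = 0"
      by (auto simp: add_nonneg_eq_0_iff)
    then show ?thesis using PrK0 by (simp add: K_def)
  qed
  then have "inj (N p)" by (simp add: linear_injective_0[OF linN])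
  then obtain g0 where g0: "linear g0" "g0 \<circ> N p = id"
    using linear_injective_left_inverse[OF linN] by blast
  have "Blinfun g0 o\<^sub>L f' p = id_blinfun"
  proof (rule blinfun_eqI)
    fix i
    have "bounded_linear g0" using g0(1) by (rule linear_conv_bounded_linear[THEN iffD1])
    then show "blinfun_apply (Blinfun g0 o\<^sub>L f' p) i = blinfun_apply id_blinfun i"
      using fun_cong[OF g0(2), of i] by (simp add: bounded_linear_Blinfun_apply f')
  qed
  then obtain U' V g g' where V: "open V" "H p \<in> V" and hom: "homeomorphism U' V H g" and pU: "p \<in> U'"
    and g: "\<And>y. y \<in> V \<Longrightarrow> (g has_derivative g' y) (at y)"
    and g': "\<And>y. y \<in> V \<Longrightarrow> g' y = inv (N (g y))" and bij: "\<And>y. y \<in> V \<Longrightarrow> bij (N (g y))"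
    using inverse_function_theorem[of UNIV H f' p "Blinfun g0"] contf' derH unfolding f' by (metis UNIV_I open_UNIV)
  define l where "l t = H p + t *\<^sub>R Pr v" for t
  define y where "y t = g (l t)" for t
  have "continuous_on UNIV l" unfolding l_def by (intro continuous_intros)
  then have "open (l -` V)" using V(1) by (simp add: continuous_on_open_vimage)
  moreover have "0 \<in> l -` V" using V(2) by (simp add: l_def)
  ultimately obtain \<delta> where \<delta>: "\<delta> > 0" "ball 0 \<delta> \<subseteq> l -` V"
    using open_contains_ball by metis
  have lV: "l t \<in> V" if "\<bar>t\<bar> < \<delta>" for t using that \<delta>(2) by (auto simp: dist_norm)
  have y0: "y 0 = p" using homeomorphism_apply1[OF hom pU] by (simp add: y_def l_def)
  define w where "w t = g' (l t) (Pr v)" for t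
  have dery: "(y has_vector_derivative w t) (at t)" if "\<bar>t\<bar> < \<delta>" for t
  proof -
    have "(l has_derivative (\<lambda>s. s *\<^sub>R Pr v)) (at t)"
      unfolding l_def by (auto intro!: derivative_eq_intros)
    from has_derivative_compose[OF this g[OF lV[OF that]]]
    have "(y has_derivative (\<lambda>s. g' (l t) (s *\<^sub>R Pr v))) (at t)"
      by (simp add: y_def[abs_def])
    moreover have "linear (g' (l t))" using g[OF lV[OF that]] by (rule has_derivative_linear)
    ultimately show ?thesis
      by (simp add: has_vector_derivative_def w_def linear_scale)
  qed
  have Nw: "N (y t) (w t) = Pr v" if "\<bar>t\<bar> < \<delta>" for t
    using surj_f_inv_f[OF bij_is_surj[OF bij[OF lV[OF that]]]] by (simp add: w_def g'[OF lV[OF that]] y_def)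
  have w0: "w 0 = v"
  proof -
    have "N p v = Pr v" using v by (simp add: N_def)
    moreover have "N p (w 0) = Pr v" using Nw[of 0] \<delta>(1) by (simp add: y0)
    ultimately show ?thesis using \<open>inj (N p)\<close> by (simp add: inj_eq injD)
  qed
  have Rw: "R (y t) *v w t = 0" if t: "\<bar>t\<bar> < \<delta>" for t
  proof -
    \<comment> \<open>The velocity equation separates: \<open>z\<close> lies in \<open>K\<close> and
      also in the range of \<open>transpose (R p)\<close>, which is orthogonal to \<open>K\<close>,
      so it is zero.\<close>
    define z where "z = Pr (v - w t)"
    have z: "z = 2 *\<^sub>R (?Rt *v (R (y t) *v w t))"
      using Nw[OF t] by (simp add: z_def N_def linear_diff[OF linPr] algebra_simps)
    have "z \<bullet> z = 2 * ((?Rt *v (R (y t) *v w t)) \<bullet> Pr (v - w t))"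
      by (subst z) (simp add: z_def)
    then have "z = 0" using orthK[OF PrK] by simp
    then have k1: "?Rt *v (R (y t) *v w t) = 0" using z by simp
    \<comment> \<open>It remains to cancel \<open>transpose (R p)\<close>. Injectivity of
      \<open>N (y t)\<close> makes \<open>Pr\<close> injective on \<open>K'\<close>, so its
      dimension is at most that of \<open>K\<close>, which by maximality of the rank is at most that
      of the subspace \<open>Ky\<close>.\<close>
    define K' where "K' = {u. ?Rt ** R (y t) *v u = 0}"
    define Ky where "Ky = {u. R (y t) *v u = 0}"
    have subK': "subspace K'" and subKy: "subspace Ky"
      unfolding K'_def Ky_def by (rule subspace_kernel)+
    have KyK': "Ky \<subseteq> K'" by (auto simp: Ky_def K'_def simp flip: matrix_vector_mul_assoc)
    have injN: "inj (N (y t))" using bij_is_inj[OF bij[OF lV[OF t]]] by (simp add: y_def)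
    have "inj_on Pr (span K')"
    proof (rule inj_onI)
      fix a b assume "a \<in> span K'" "b \<in> span K'" "Pr a = Pr b"
      then have "a - b \<in> K'" "Pr (a - b) = 0"
        using subK' span_eq_iff[THEN iffD2, OF subK'] by (auto simp: subspace_diff linear_diff[OF linPr])
      then have "N (y t) (a - b) = 0" by (simp add: N_def K'_def flip: matrix_vector_mul_assoc)
      then have "a - b = 0" using injN linear_injective_0[OF linN] by blast
      then show "a = b" by simp
    qed
    then have "dim (Pr ` K') = dim K'" by (rule dim_image_eq[OF linPr])
    moreover have "dim (Pr ` K') \<le> dim K" by (rule dim_subset) (use PrK in auto)
    moreover have "rank (R p) + dim K = CARD('a)" "rank (R (y t)) + dim Ky = CARD('a)"
      unfolding K_def Ky_def by (rule rank_add_nullity)+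
    ultimately have "dim K' \<le> dim Ky" using max[of "y t"] by linarith
    then have "Ky = K'" by (rule subspace_dim_equal[OF subKy subK' KyK'])
    moreover have "w t \<in> K'" using k1 by (simp add: K'_def matrix_vector_mul_assoc)
    ultimately show ?thesis by (auto simp: Ky_def)
  qed
  have const: "Q (y t) = Q p" if t: "\<bar>t\<bar> < \<delta>" for t
  proof -
    have "((\<lambda>t. Q (y t)) has_derivative (\<lambda>_. 0)) (at s within ball 0 \<delta>)" if "s \<in> ball 0 \<delta>" for s
    proof -
      have s: "\<bar>s\<bar> < \<delta>" using that by (simp add: dist_norm)
      from has_derivative_compose[OF dery[OF s, unfolded has_vector_derivative_def] derQ]
      have "((\<lambda>t. Q (y t)) has_derivative (\<lambda>h. 2 *\<^sub>R (R (y s) *v (h *\<^sub>R w s)))) (at s)" .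
      then have "((\<lambda>t. Q (y t)) has_derivative (\<lambda>_. 0)) (at s)"
        by (simp add: matrix_vector_mult_scaleR Rw[OF s])
      then show ?thesis by (rule has_derivative_at_withinI)
    qed
    from has_derivative_zero_constant[OF convex_ball this]
    obtain c where "\<And>s. s \<in> ball 0 \<delta> \<Longrightarrow> Q (y s) = c" by blast
    then show ?thesis using t \<delta>(1) y0 by (metis abs_zero dist_0_norm mem_ball real_norm_def)
  qed
  show ?thesis
  proof (rule that[of \<delta> y])
    show "\<delta> > 0" "y 0 = p" by (fact \<delta>(1) y0)+
    show der0: "(y has_vector_derivative v) (at 0)" using dery[of 0] \<delta>(1) w0 by simp
    show "continuous (at 0) y" by (rule has_vector_derivative_continuous[OF der0])
    show "R (y t) *v y t = R p *v p" if "\<bar>t\<bar> < \<delta>" for t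
      using const[OF that] by (simp add: Q_def)
  qed
qed

subsection \<open>Generic local rigidity\<close>

definition shared :: "('n \<times> 'm) set \<Rightarrow> 'n \<Rightarrow> 'n \<Rightarrow> bool" where
  "shared E k l \<longleftrightarrow> (\<exists>i. (k, i) \<in> E \<and> (l, i) \<in> E)"

text \<open>The classical rigidity matrix of the graph that joins points with a common view, with
  zero rows for the other pairs. Its integer coefficients make the entries rational polynomials in
  the points.\<close>

definition rigidity_mat :: "('n::finite \<times> 'm::finite) set \<Rightarrow> ('n \<Rightarrow> real^'d) \<Rightarrow> real^('n \<times> 'd)^('n \<times> 'n)" where
  "rigidity_mat E y = (\<chi> a b. if shared E (fst a) (snd a)
     then ((if fst b = fst a then 1 else 0) - (if fst b = snd a then 1 else 0)) * (y (fst a) $ snd b - y (snd a) $ snd b)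
     else 0)"

definition points :: "real^('n::finite \<times> 'd::finite) \<Rightarrow> 'n \<Rightarrow> real^'d" where
  "points u k = (\<chi> c. u $ (k, c))"

lemma points_linear:
  "points (u + v) k = points u k + points v k" "points (u - v) k = points u k - points v k"
  "points (a *\<^sub>R u) k = a *\<^sub>R points u k"
  by (simp_all add: points_def vec_eq_iff)

lemma rigidity_mat_mult:
  "(rigidity_mat E y *v v) $ (k, l) = (if shared E k l then (y k - y l) \<bullet> (points v k - points v l) else 0)"
proof -
  have "(\<Sum>j\<in>UNIV. \<Sum>c\<in>UNIV. ((if j = k then 1 else 0) - (if j = l then 1 else 0)) * (y k $ c - y l $ c) * v $ (j, c))
      = (\<Sum>j\<in>UNIV. ((if j = k then 1 else 0) - (if j = l then 1 else 0)) * ((y k - y l) \<bullet> points v j))"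
    by (simp add: inner_vec_def points_def sum_distrib_left mult.assoc)
  also have "\<dots> = (y k - y l) \<bullet> (points v k - points v l)"
    by (simp add: left_diff_distrib sum_subtractf inner_diff_right if_distrib[of "\<lambda>a. a * _"] cong: if_cong)
  finally show ?thesis
    by (simp add: rigidity_mat_def matrix_vector_mult_def sum_UNIV_prod)
qed

lemma rat_poly_rigidity_mat: "rat_poly (\<lambda>y. rigidity_mat E y $ a $ b)"
proof -
  define s :: int where "s = (if fst b = fst a then 1 else 0) - (if fst b = snd a then 1 else 0)"
  have "rigidity_mat E y $ a $ b = (if shared E (fst a) (snd a) then of_int s * (y (fst a) $ snd b - y (snd a) $ snd b) else 0)" for y
    by (simp add: rigidity_mat_def s_def)
  then show ?thesis
    by (simp only:) (intro rat_poly_if rat_poly_mult rat_poly_of_int rat_poly_diff rat_poly_coord rat_poly_0)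
qed

lemma rigidity_mat_translate: "rigidity_mat E (\<lambda>k. y k + t) = rigidity_mat E y"
  by (simp add: rigidity_mat_def vec_eq_iff)

context rigid_framework
begin

lemma r_dist:
  assumes "(k, i) \<in> E" "(l, i) \<in> E"
  shows "norm (r k - r l) = norm (x k i - x l i)"
proof -
  obtain t where "\<And>k. (k, i) \<in> E \<Longrightarrow> r k = transpose (row_block S i) *v x k i + t"
    using r_view by blast
  then have "r k - r l = transpose (row_block S i) *v (x k i - x l i)"
    using assms by (simp add: matrix_vector_mult_diff_distrib)
  then show ?thesis
    using orth[of i] by (simp add: norm_eq inner_mult_vec_left matrix_vector_mul_assoc orthogonal_matrix_def)
qed

text \<open>Equal distances within a view yield an orthogonal map of that view onto its points;
  these maps glue by construction, so their stack has cost zero.\<close>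

lemma isometric_points_alignment:
  fixes y :: "'n \<Rightarrow> real^'d"
  assumes iso: "\<And>k l i. (k, i) \<in> E \<Longrightarrow> (l, i) \<in> E \<Longrightarrow> norm (y k - y l) = norm (r k - r l)"
  obtains V where "perfect_alignment E x V" "glues E x (\<lambda>i. transpose (row_block V i)) y"
proof -
  have "\<exists>Q. orthogonal_matrix Q \<and> (\<exists>t. \<forall>k. (k, i) \<in> E \<longrightarrow> Q *v x k i = y k + t)" for i
  proof -
    obtain k0 where k0: "(k0, i) \<in> E" using nondegenerate_obtain[OF nondeg] .
    let ?a = "\<lambda>k. x k i - x k0 i" and ?b = "\<lambda>k. y k - y k0"
    have sp: "span (?a ` {k. (k, i) \<in> E}) = UNIV"
      by (rule nondegenerate_span[OF nondeg _ _ k0, where Q = "mat 1" and t = 0]) (auto simp: orthogonal_matrix_id)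
    have "?a k \<bullet> ?a l = ?b k \<bullet> ?b l" if "(k, i) \<in> E" "(l, i) \<in> E" for k l
    proof -
      have d: "(x p i - x q i) \<bullet> (x p i - x q i) = (y p - y q) \<bullet> (y p - y q)" if "(p, i) \<in> E" "(q, i) \<in> E" for p q
        using iso[OF that] r_dist[OF that] by (simp add: norm_eq)
      show ?thesis
        using d[OF \<open>(k, i) \<in> E\<close> k0] d[OF \<open>(l, i) \<in> E\<close> k0] d[OF that]
        by (simp add: inner_diff_left inner_diff_right inner_commute)
    qed
    then obtain Q where Q: "orthogonal_matrix Q" "\<And>k. (k, i) \<in> E \<Longrightarrow> ?b k = Q *v ?a k"
      by - (rule orthogonal_interpolation[OF sp, of ?b], auto)
    have "Q *v x k i = y k + (Q *v x k0 i - y k0)" if "(k, i) \<in> E" for k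
      using Q(2)[OF that] by (simp add: matrix_vector_mult_diff_distrib algebra_simps)
    then show ?thesis using Q(1) by blast
  qed
  then obtain Q t where Q: "\<And>i. orthogonal_matrix (Q i)" and t: "\<And>i k. (k, i) \<in> E \<Longrightarrow> Q i *v x k i = y k + t i"
    by metis
  define V where "V = stack (\<lambda>i. transpose (Q i))"
  have g: "glues E x (\<lambda>i. transpose (row_block V i)) y"
    unfolding glues_def V_def using t by (intro exI[of _ t]) auto
  have "V \<in> alignments" using Q by (simp add: V_def alignments_def)
  moreover have "C_mat E x ** V = 0" by (rule glues_imp(1)[OF conn g])
  ultimately show ?thesis using g that by (simp add: perfect_alignment_iff[OF conn])
qed

lemma realization_mult_orthogonal:
  assumes "orthogonal_matrix Q"
  shows "norm (column k (realization E x (S ** Q)) - column l (realization E x (S ** Q))) = norm (r k - r l)"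
proof -
  have "realization E x (S ** Q) = transpose Q ** realization E x S"
    by (simp add: realization_def matrix_transpose_mul matrix_mul_assoc)
  then have "column k (realization E x (S ** Q)) - column l (realization E x (S ** Q)) = transpose Q *v (r k - r l)"
    by (simp add: column_matrix_mult matrix_vector_mult_diff_distrib)
  then show ?thesis
    using assms by (simp add: norm_eq inner_mult_vec_left matrix_vector_mul_assoc orthogonal_matrix_def)
qed

text \<open>Local rigidity upgrades a curve preserving the distances within views to one preserving
  all distances. Differentiating at 0 gives the flex equation for every pair of points; as
  differences of the points span, \<open>p\<close> is a trivial flex.\<close>

lemma locally_rigid_imp_infinitesimally_rigid:
  assumes gen: "generic_realization E x S" and rigid: "locally_rigid E x S"
  shows "infinitesimally_rigid E x S"
  unfolding infinitesimally_rigid_def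
proof (intro allI impI)
  fix p :: "'n \<Rightarrow> real^'d"
  assume p: "\<forall>i k1 k2. (k1, i) \<in> E \<and> (k2, i) \<in> E \<longrightarrow> (r k1 - r k2) \<bullet> (p k1 - p k2) = 0"
  define u0 :: "real^('n \<times> 'd)" where "u0 = (\<chi> a. r (fst a) $ snd a)"
  define v :: "real^('n \<times> 'd)" where "v = (\<chi> a. p (fst a) $ snd a)"
  have pu0: "points u0 = r" and pv: "points v = p"
    by (auto simp: points_def u0_def v_def vec_eq_iff)
  define R where "R u = rigidity_mat E (points u)" for u :: "real^('n \<times> 'd)"
  have R: "(R u *v w) $ (k, l) = (if shared E k l then (points u k - points u l) \<bullet> (points w k - points w l) else 0)"
    for u w k l by (simp add: R_def rigidity_mat_mult)
  have lin: "linear R"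
    by (rule linearI) (simp_all add: R_def rigidity_mat_def points_linear vec_eq_iff algebra_simps)
  have sym: "R u *v w = R w *v u" for u w
    by (simp add: vec_eq_iff R inner_commute)
  have max: "rank (R u) \<le> rank (R u0)" for u
  proof -
    \<comment> \<open>The rigidity matrix does not see translations, so genericity up to translation
      is enough.\<close>
    obtain t where "generic_points (\<lambda>k. r k + t)" using gen by (auto simp: generic_realization_def)
    from generic_rank_max[OF rat_poly_rigidity_mat this]
    show ?thesis by (simp add: R_def rigidity_mat_translate pu0)
  qed
  have Rv: "R u0 *v v = 0"
    using p by (auto simp: vec_eq_iff R pu0 pv shared_def)
  obtain \<delta> y where \<delta>: "\<delta> > 0" and y0: "y 0 = u0" and der: "(y has_vector_derivative v) (at 0)"
    and fib: "\<And>t. \<bar>t\<bar> < \<delta> \<Longrightarrow> R (y t) *v y t = R u0 *v u0" and cont: "continuous (at 0) y"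
    using quadratic_fibre_curve[OF lin sym max Rv] by blast
  \<comment> \<open>Configurations on the curve must be centred before they can be compared with
    realizations.\<close>
  define Y where "Y u = (\<chi> c k. points u k $ c - (\<Sum>l\<in>UNIV. points u l $ c) / real CARD('n))" for u :: "real^('n \<times> 'd)"
  have colY: "column k (Y u) = points u k - (1 / real CARD('n)) *\<^sub>R (\<Sum>l\<in>UNIV. points u l)" for u k
    by (simp add: Y_def column_def vec_eq_iff)
  have Y0: "Y u0 = realization E x S"
    by (simp add: matrix_eq_columns colY pu0 sum_column_realization)
  obtain \<epsilon> where \<epsilon>: "\<epsilon> > 0" and loc: "\<And>V. perfect_alignment E x V \<Longrightarrow>
      norm (realization E x V - realization E x S) < \<epsilon> \<Longrightarrow>
      \<exists>Q. orthogonal_matrix Q \<and> realization E x V = realization E x (S ** Q)"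
    using rigid unfolding locally_rigid_def by blast
  have "linear Y"
  proof (rule linearI)
    show "Y (u + w) = Y u + Y w" for u w
      by (simp add: Y_def points_linear vec_eq_iff sum.distrib add_divide_distrib)
    show "Y (a *\<^sub>R u) = a *\<^sub>R Y u" for a u
      by (simp add: Y_def points_linear vec_eq_iff right_diff_distrib sum_distrib_left)
  qed
  then have "bounded_linear Y" by (rule linear_conv_bounded_linear[THEN iffD1])
  then have "continuous (at 0) (\<lambda>t. Y (y t))" using cont by (rule bounded_linear.continuous)
  then obtain \<delta>' where \<delta>': "\<delta>' > 0" "\<And>t. \<bar>t\<bar> < \<delta>' \<Longrightarrow> norm (Y (y t) - realization E x S) < \<epsilon>"
    unfolding continuous_at_eps_delta using \<epsilon> unfolding y0 Y0 dist_norm by (metis diff_zero real_norm_def)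
  have const: "norm (points (y t) k - points (y t) l) = norm (r k - r l)" if t: "\<bar>t\<bar> < min \<delta> \<delta>'" for t k l
  proof -
    have "norm (points (y t) k - points (y t) l) = norm (r k - r l)" if "(k, i) \<in> E" "(l, i) \<in> E" for k l i
      using arg_cong[OF fib[of t], of "\<lambda>w. w $ (k, l)"] t that by (auto simp: R shared_def pu0 norm_eq split: if_splits)
    then obtain V where V: "perfect_alignment E x V" "glues E x (\<lambda>i. transpose (row_block V i)) (points (y t))"
      by (rule isometric_points_alignment)
    have YV: "Y (y t) = realization E x V"
      by (simp add: matrix_eq_columns colY glues_imp(2)[OF conn V(2)])
    then obtain Q where Q: "orthogonal_matrix Q" "Y (y t) = realization E x (S ** Q)"
      using loc[OF V(1)] \<delta>'(2)[of t] t by auto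
    have "points (y t) k - points (y t) l = column k (Y (y t)) - column l (Y (y t))"
      by (simp add: colY)
    then show ?thesis using realization_mult_orthogonal[OF Q(1)] by (simp add: Q(2))
  qed
  have flex: "(r k - r l) \<bullet> (p k - p l) = 0" for k l
  proof -
    let ?f = "\<lambda>t. \<Sum>c\<in>UNIV. (y t $ (k, c) - y t $ (l, c))\<^sup>2"
    have "((\<lambda>t. y t $ a) has_field_derivative v $ a) (at 0)" for a
      unfolding has_real_derivative_iff_has_vector_derivative
      by (rule bounded_linear.has_vector_derivative[OF bounded_linear_vec_nth der])
    then have "(?f has_field_derivative (\<Sum>c\<in>UNIV. 2 * (y 0 $ (k, c) - y 0 $ (l, c)) * (v $ (k, c) - v $ (l, c)))) (at 0)"
      by (auto intro!: derivative_eq_intros simp: algebra_simps)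
    moreover have f: "?f t = (norm (points (y t) k - points (y t) l))\<^sup>2" for t
      unfolding power2_norm_eq_inner inner_vec_def by (simp add: points_def power2_eq_square)
    have "\<forall>t. \<bar>0 - t\<bar> < min \<delta> \<delta>' \<longrightarrow> ?f 0 = ?f t"
      unfolding f using const[of 0] const \<delta> \<delta>'(1) by simp
    ultimately have "(\<Sum>c\<in>UNIV. 2 * (y 0 $ (k, c) - y 0 $ (l, c)) * (v $ (k, c) - v $ (l, c))) = 0"
      using DERIV_local_const[of ?f _ 0 "min \<delta> \<delta>'"] \<delta> \<delta>'(1) by auto
    then show ?thesis
      by (simp add: y0 u0_def v_def inner_vec_def mult.assoc del: right_diff_distrib_numeral flip: sum_distrib_left)
  qed
  define i :: 'm where "i = undefined"
  obtain k0 where k0: "(k0, i) \<in> E" using nondegenerate_obtain[OF nondeg] .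
  obtain t where t: "\<And>k. (k, i) \<in> E \<Longrightarrow> r k = transpose (row_block S i) *v x k i + t"
    using r_view by blast
  let ?a = "\<lambda>k. r k - r k0" and ?b = "\<lambda>k. p k - p k0"
  have "span (?a ` {k. (k, i) \<in> E}) = UNIV"
    by (rule nondegenerate_span[OF nondeg t _ k0]) (auto simp: orth)
  then have sp: "span (range ?a) = UNIV"
    using span_mono[of "?a ` {k. (k, i) \<in> E}" "range ?a"] by auto
  have "?a k \<bullet> ?b l + ?a l \<bullet> ?b k = 0" for k l
    using flex[of k k0] flex[of l k0] flex[of k l] by (simp add: inner_diff_left inner_diff_right)
  then obtain \<Omega> where \<Omega>: "transpose \<Omega> = - \<Omega>" "\<And>k. ?b k = \<Omega> *v ?a k"
    by - (rule skew_interpolation[OF sp, of ?b], auto)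
  have "p k = \<Omega> *v r k + (p k0 - \<Omega> *v r k0)" for k
    using \<Omega>(2)[of k] by (simp add: matrix_vector_mult_diff_distrib algebra_simps)
  then show "\<exists>\<Omega> t. transpose \<Omega> = - \<Omega> \<and> (\<forall>k. p k = \<Omega> *v r k + t)"
    using \<Omega>(1) by blast
qed

end

theorem theorem5p3:
  fixes E :: "('n::finite \<times> 'm::{finite,linorder}) set"
    and x :: "'n \<Rightarrow> 'm \<Rightarrow> real^'d::{finite,linorder}"
    and S :: "real^'d::_^('m \<times> 'd)"
    and \<beta> \<gamma> :: real
  assumes "graph_connected E"
    and "\<And>i. affinely_nondegenerate E x i"
    and "perfect_alignment E x S"
    and "0 < \<beta>" "\<beta> < 1" "0 < \<gamma>" "\<gamma> < 1"
  shows
    "(rank (C_mat E x) = (CARD('m) - 1) * CARD('d) \<or>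
      rank (L_bb E x S) = (CARD('m) - 1) * CARD('d) * (CARD('d) - 1) div 2 \<longrightarrow>
        rgd_converges_locally_linearly E x \<beta> \<gamma> (reduce S)) \<and>
     (rank (C_mat E x) = (CARD('m) - 1) * CARD('d) \<longrightarrow>
        rank (L_bb E x S) = (CARD('m) - 1) * CARD('d) * (CARD('d) - 1) div 2) \<and>
     (rank (C_mat E x) = (CARD('m) - 1) * CARD('d) \<longleftrightarrow> affinely_rigid E x S) \<and>
     (rank (L_bb E x S) = (CARD('m) - 1) * CARD('d) * (CARD('d) - 1) div 2 \<longleftrightarrow>
        infinitesimally_rigid E x S) \<and>
     (generic_realization E x S \<longrightarrow>
        (rank (L_bb E x S) = (CARD('m) - 1) * CARD('d) * (CARD('d) - 1) div 2 \<longleftrightarrow>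
          locally_rigid E x S))"
proof -
  have S: "S \<in> alignments" "C_mat E x ** S = 0"
    using assms(3) by (auto simp: perfect_alignment_iff[OF assms(1)])
  interpret rigid_framework E x S
    by unfold_locales (fact assms(1,2) S)+
  note C = rank_C_mat_iff[OF S] and L = rank_L_bb_iff[OF assms(1) S]
  note imp = kernel_imp_skew_flex_trivial
  note conv = rgd_local_linear_convergence[OF assms(1) S _ assms(4-7)]
  show ?thesis
    \<comment> \<open>Both ranks and both linear notions of rigidity become either the kernel
      condition or \<open>skew_flex_trivial\<close>; what remains are the implications between these
      two, convergence and local rigidity.\<close>
    unfolding C L affinely_rigid_iff infinitesimally_rigid_iff
    using imp conv skew_flex_trivial_imp_locally_rigid
      locally_rigid_imp_infinitesimally_rigid[unfolded infinitesimally_rigid_iff] by blast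
qed

end
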